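(* Let $\mathrm{H}^2_{\alpha}$ and $\mathrm{H}^2_{\beta}$ be two Möbius invariant weighted Hardy spaces, both having property A for some integer $n_0\ge 2$. Suppose that the weight sequences $\alpha$ and $\beta$ satisfy $$\sup_{k\ge 0}\frac{\beta(k)}{\alpha(k)}<\infty\quad\text{and}\quad \lim_{k\to\infty}\frac{\alpha(k)}{k\,\beta(k)}=0.$$ Let $h\in \mathrm{Hol}(\overline{\mathbb{D}})$ and let $T$ be the operator $$T=\begin{pmatrix} M_{\alpha,z}^* & M_{\alpha,\beta,h}^*\\ 0 & M_{\beta,z}^*\end{pmatrix}$$ on $\mathrm{H}^2_{\alpha}\oplus \mathrm{H}^2_{\beta}$. If for every finite Blaschke product $B$ the operator $B(T)$ is similar to $\oplus_1^n T$ (the direct sum of $n$ copies of $T$), where $n$ is the order of $B$, then $h=0$.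
   Context: $\mathbb{D}$ is the open unit disk in $\mathbb{C}$, $\overline{\mathbb{D}}$ the closed unit disk; $\mathrm{Hol}(\mathbb{D})$ is the set of analytic functions on $\mathbb{D}$, and $\mathrm{Hol}(\overline{\mathbb{D}})$ the set of functions analytic on (a neighbourhood of) $\overline{\mathbb{D}}$. For $f\in\mathrm{Hol}(\mathbb{D})$ write $f(z)=\sum_{k\ge0}\hat f(k)z^k$. Weighted Hardy space: for a sequence $\alpha=(\alpha(k))_{k=0}^\infty$ of positive numbers, always assumed to satisfy $\lim_{k\to\infty}\alpha(k+1)/\alpha(k)=1$, let $\mathrm{H}^2_{\alpha}=\{f\in\mathrm{Hol}(\mathbb{D}):\sum_{k}|\hat f(k)|^2\alpha(k)^2<\infty\}$, a Hilbert space with inner product $\langle f,g\rangle_\alpha=\sum_k\hat f(k)\overline{\hat g(k)}\alpha(k)^2$. Multipliers: $\mathrm{Mult}(\mathrm{H}^2_\alpha,\mathrm{H}^2_\beta)$ is the set of $h\in\mathrm{Hol}(\mathbb{D})$ with $hf\in\mathrm{H}^2_\beta$ for all $f\in\mathrm{H}^2_\alpha$; for such $h$, $M_{\alpha,\beta,h}:\mathrm{H}^2_\alpha\to\mathrm{H}^2_\beta$, $f\mapsto hf$ (a bounded operator), and $M_{\alpha,h}=M_{\alpha,\alpha,h}$; $M_{\alpha,z}$ is multiplication by the coordinate function. When $\sup_k\beta(k)/\alpha(k)<\infty$, one has $\mathrm{Hol}(\overline{\mathbb{D}})\subseteq\mathrm{Mult}(\mathrm{H}^2_\alpha,\mathrm{H}^2_\beta)$.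 Möbius invariant: $\mathrm{H}^2_\alpha$ is Möbius invariant if for every analytic automorphism $\phi$ of $\mathbb{D}$, $f\circ\phi\in\mathrm{H}^2_\alpha$ whenever $f\in\mathrm{H}^2_\alpha$. Property A: $\mathrm{H}^2_\alpha$ has property A for a positive integer $n$ if there exist $c_1,c_2>0$ (depending on $n$) such that $\alpha(k)\le c_1\alpha(j+kn)$ and $\alpha(j+kn)\le c_2\alpha(k)$ for all $j=0,1,\dots,n-1$ and $k=0,1,\dots$. A finite Blaschke product of order $n$ is a function $B(z)=e^{i\theta}\prod_{j=1}^n\frac{z-a_j}{1-\overline{a_j}z}$ with $\theta\in[0,2\pi)$, $a_1,\dots,a_n\in\mathbb{D}$. $B(T)$ is defined by the analytic functional calculus (here $\sigma(T)\subseteq\overline{\mathbb{D}}$). Two bounded operators $T,\tilde T$ are similar if $TX=X\tilde T$ for some bounded invertible $X$. *)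

theory Defs
  imports "HOL-Complex_Analysis.Complex_Analysis"
begin

(* The weight sequence is a term, so the spaces depending on it cannot be types: a complex inner
   product space is a record with an explicit carrier, the inner product being linear in its first
   argument. Operators are functions whose values outside the carrier are irrelevant. *)
record 'a ip_space =
  vecs :: "'a set"
  vadd :: "'a \<Rightarrow> 'a \<Rightarrow> 'a"
  vscale :: "complex \<Rightarrow> 'a \<Rightarrow> 'a"
  ip :: "'a \<Rightarrow> 'a \<Rightarrow> complex"

definition vnorm :: "'a ip_space \<Rightarrow> 'a \<Rightarrow> real" where
  "vnorm H x = sqrt (Re (ip H x x))"

definition bounded_op :: "'a ip_space \<Rightarrow> 'b ip_space \<Rightarrow> ('a \<Rightarrow> 'b) \<Rightarrow> bool" where
  "bounded_op H K A \<longleftrightarrow>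
     (\<forall>x\<in>vecs H. A x \<in> vecs K) \<and>
     (\<forall>x\<in>vecs H. \<forall>y\<in>vecs H. A (vadd H x y) = vadd K (A x) (A y)) \<and>
     (\<forall>c. \<forall>x\<in>vecs H. A (vscale H c x) = vscale K c (A x)) \<and>
     (\<exists>C. \<forall>x\<in>vecs H. vnorm K (A x) \<le> C * vnorm H x)"

definition adjoint_op :: "'a ip_space \<Rightarrow> 'b ip_space \<Rightarrow> ('a \<Rightarrow> 'b) \<Rightarrow> 'b \<Rightarrow> 'a" where
  "adjoint_op H K A y = (THE x. x \<in> vecs H \<and> (\<forall>v\<in>vecs H. ip K (A v) y = ip H v x))"

definition similar_op :: "'a ip_space \<Rightarrow> ('a \<Rightarrow> 'a) \<Rightarrow> 'b ip_space \<Rightarrow> ('b \<Rightarrow> 'b) \<Rightarrow> bool" where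
  "similar_op H T K S \<longleftrightarrow>
     (\<exists>X Y. bounded_op K H X \<and> bounded_op H K Y \<and>
        (\<forall>x\<in>vecs K. Y (X x) = x) \<and> (\<forall>x\<in>vecs H. X (Y x) = x) \<and>
        (\<forall>x\<in>vecs K. T (X x) = X (S x)))"

definition orth_sum :: "'a ip_space \<Rightarrow> 'b ip_space \<Rightarrow> ('a \<times> 'b) ip_space" where
  "orth_sum H K = \<lparr>
     vecs = vecs H \<times> vecs K,
     vadd = (\<lambda>(x, y) (x', y'). (vadd H x x', vadd K y y')),
     vscale = (\<lambda>c (x, y). (vscale H c x, vscale K c y)),
     ip = (\<lambda>(x, y) (x', y'). ip H x x' + ip K y y') \<rparr>"

definition copies :: "nat \<Rightarrow> 'a ip_space \<Rightarrow> (nat \<Rightarrow> 'a) ip_space" where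
  "copies n H = \<lparr>
     vecs = (\<Pi>\<^sub>E i\<in>{..<n}. vecs H),
     vadd = (\<lambda>x y. \<lambda>i\<in>{..<n}. vadd H (x i) (y i)),
     vscale = (\<lambda>c x. \<lambda>i\<in>{..<n}. vscale H c (x i)),
     ip = (\<lambda>x y. \<Sum>i<n. ip H (x i) (y i)) \<rparr>"

definition copies_op :: "nat \<Rightarrow> ('a \<Rightarrow> 'a) \<Rightarrow> (nat \<Rightarrow> 'a) \<Rightarrow> (nat \<Rightarrow> 'a)" where
  "copies_op n T x = (\<lambda>i\<in>{..<n}. T (x i))"

definition resolvent_op :: "'a ip_space \<Rightarrow> ('a \<Rightarrow> 'a) \<Rightarrow> complex \<Rightarrow> 'a \<Rightarrow> 'a" where
  "resolvent_op H T l =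
     inv_into (vecs H) (\<lambda>x. vadd H (vscale H l x) (vscale H (-1) (T x)))"

(* Analytic functional calculus for an operator with spectrum in the closed unit disc and a function
   f analytic on a neighbourhood of that disc: f(T) = 1/(2 pi i) * integral of f(l) (l - T)^{-1} dl
   (taken in the weak sense) over a circle of radius R > 1 with f analytic on |l| <= R. By Cauchy's
   theorem the integral does not depend on the R that is selected. *)
definition fun_calc :: "'a ip_space \<Rightarrow> ('a \<Rightarrow> 'a) \<Rightarrow> (complex \<Rightarrow> complex) \<Rightarrow> 'a \<Rightarrow> 'a" where
  "fun_calc H T f x =
     (let R = (SOME R::real. R > 1 \<and> f analytic_on cball 0 R) in
      THE v. v \<in> vecs H \<and>
        (\<forall>y\<in>vecs H. ip H v y =
           1 / (2 * of_real pi * \<i>) *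
           contour_integral (circlepath 0 R) (\<lambda>l. f l * ip H (resolvent_op H T l x) y)))"

definition weight_seq :: "(nat \<Rightarrow> real) \<Rightarrow> bool" where
  "weight_seq \<alpha> \<longleftrightarrow> (\<forall>k. \<alpha> k > 0) \<and> (\<lambda>k. \<alpha> (Suc k) / \<alpha> k) \<longlonglongrightarrow> 1"

definition taylor_coeff :: "(complex \<Rightarrow> complex) \<Rightarrow> nat \<Rightarrow> complex" where
  "taylor_coeff f k = (deriv ^^ k) f 0 / fact k"

(* An analytic function on the unit disc is represented by its extension by zero to the complex
   plane, so that equality of elements is equality on the disc. *)
definition hardy :: "(nat \<Rightarrow> real) \<Rightarrow> (complex \<Rightarrow> complex) ip_space" where
  "hardy \<alpha> = \<lparr>
     vecs = {f. f holomorphic_on ball 0 1 \<and> (\<forall>z. z \<notin> ball 0 1 \<longrightarrow> f z = 0) \<and>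
                summable (\<lambda>k. (cmod (taylor_coeff f k))\<^sup>2 * (\<alpha> k)\<^sup>2)},
     vadd = (\<lambda>f g z. f z + g z),
     vscale = (\<lambda>c f z. c * f z),
     ip = (\<lambda>f g. \<Sum>k. taylor_coeff f k * cnj (taylor_coeff g k) * (of_real (\<alpha> k))\<^sup>2) \<rparr>"

definition mult_op :: "(complex \<Rightarrow> complex) \<Rightarrow> (complex \<Rightarrow> complex) \<Rightarrow> (complex \<Rightarrow> complex)" where
  "mult_op h f = (\<lambda>z. h z * f z)"

definition disc_automorphism :: "(complex \<Rightarrow> complex) \<Rightarrow> bool" where
  "disc_automorphism \<phi> \<longleftrightarrow> \<phi> holomorphic_on ball 0 1 \<and> bij_betw \<phi> (ball 0 1) (ball 0 1)"

definition moebius_invariant :: "(nat \<Rightarrow> real) \<Rightarrow> bool" where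
  "moebius_invariant \<alpha> \<longleftrightarrow>
     (\<forall>\<phi>. disc_automorphism \<phi> \<longrightarrow>
        (\<forall>f\<in>vecs (hardy \<alpha>). (\<lambda>z. if z \<in> ball 0 1 then f (\<phi> z) else 0) \<in> vecs (hardy \<alpha>)))"

definition property_A :: "(nat \<Rightarrow> real) \<Rightarrow> nat \<Rightarrow> bool" where
  "property_A \<alpha> n \<longleftrightarrow>
     (\<exists>c1>0. \<exists>c2>0. \<forall>j<n. \<forall>k. \<alpha> k \<le> c1 * \<alpha> (j + k * n) \<and> \<alpha> (j + k * n) \<le> c2 * \<alpha> k)"

definition finite_blaschke :: "nat \<Rightarrow> (complex \<Rightarrow> complex) \<Rightarrow> bool" where
  "finite_blaschke n B \<longleftrightarrow>
     (\<exists>\<theta>::real. \<exists>a::nat \<Rightarrow> complex. 0 \<le> \<theta> \<and> \<theta> < 2 * pi \<and> (\<forall>j\<in>{1..n}. a j \<in> ball 0 1) \<and>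
        B = (\<lambda>z. exp (\<i> * of_real \<theta>) * (\<Prod>j=1..n. (z - a j) / (1 - cnj (a j) * z))))"

definition T_op ::
  "(nat \<Rightarrow> real) \<Rightarrow> (nat \<Rightarrow> real) \<Rightarrow> (complex \<Rightarrow> complex) \<Rightarrow>
   (complex \<Rightarrow> complex) \<times> (complex \<Rightarrow> complex) \<Rightarrow> (complex \<Rightarrow> complex) \<times> (complex \<Rightarrow> complex)" where
  "T_op \<alpha> \<beta> h = (\<lambda>(f, g).
     (vadd (hardy \<alpha>) (adjoint_op (hardy \<alpha>) (hardy \<alpha>) (mult_op (\<lambda>z. z)) f)
                     (adjoint_op (hardy \<alpha>) (hardy \<beta>) (mult_op h) g),
      adjoint_op (hardy \<beta>) (hardy \<beta>) (mult_op (\<lambda>z. z)) g))"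

end

theory Submission
  imports Defs "Jordan_Normal_Form.Determinant"
begin

text \<open>
  Passing to adjoints, $T$ becomes $S(f, g) = (z f, h f + z g)$ and $B(T)$ becomes
  $(f, g) \mapsto (b f, b' h f + b g)$ with $b(z) = \overline{B(\overline z)}$. A similarity yields operators
  $P_1, \dots, P_n$ that intertwine $S$ with this operator and have jointly surjective range. An
  intertwiner has to be of the form $(f, g) \mapsto (a \cdot f \circ b - x \cdot h \circ b \cdot f' \circ b + x \cdot g \circ b, \dots)$;
  when $b(z) = \phi(z^n)$ with a disc automorphism $\phi$, the growth condition on the weights forbids
  the terms with $f' \circ b$, which gives $x = 0$ and $b' h a = d \cdot h \circ b$, where $d$ is the factor of
  $g \circ b$ in the second component. If $b'(0) h(0) = 0$ and $h(b(0)) \neq 0$, then $d(0) = 0$, and comparing the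
  Taylor coefficients of order less than $n$ contradicts surjectivity. Applying this to $b(z) = z^{n_0}$
  gives $h(0) = 0$; then $n = 1$ and $\phi(0) = w$ give $h(w) = 0$ for every $w$ in the disc.
\<close>

section \<open>Coefficients of functions in weighted Hardy spaces\<close>

text \<open>The form of an intertwiner comes from exact division, not from approximation by
  polynomials. To find a component at z0, f is written as f = f(p) + (z - p) q with p = b(z0) and q
  in the same space, which Moebius invariance allows; the intertwining relation cancels (z - p) q up
  to a contribution of h, and there q(p) = f'(p) appears. Linearity of the intertwiner is enough for
  this.

  Terms with f' are excluded because differentiation gains a factor k that the two weights cannot
  absorb. Property A reduces z^n to z by splitting power series into residue classes mod n, and
  Moebius invariance then removes \<phi>.

  The condition b'(0) h(0) = 0 forces two stages: an order of at least 2 makes b'(0) vanish, and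
  only the resulting h(0) = 0 opens order one, where b can send 0 to any w.

  Surjectivity breaks because s(\<phi>(z^n)) has no terms of degree 1 to n - 1. With s_i the first
  component fed to P_i, the n numbers s_i(w) fix both the first n coefficients of the first
  component and the second component at 0.\<close>

lemma weight_shift_bound:
  fixes \<gamma> :: "nat \<Rightarrow> real"
  assumes pos: "\<And>k. \<gamma> k > 0" and lim: "(\<lambda>k. \<gamma> (Suc k) / \<gamma> k) \<longlonglongrightarrow> 1" and "\<rho> > 1"
  obtains C where "C > 0" "\<And>m j. \<gamma> (m + j) \<le> C * \<rho> ^ j * \<gamma> m"
proof -
  \<comment> \<open>\<open>q\<close> is the factor by which a ratio exceeds \<rho>. It differs from
    1 only below \<open>N\<close>, so its product over the indices below \<open>N\<close> is a
    constant that serves every starting index \<open>m\<close>.\<close>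
  define q where "q i = max 1 (\<gamma> (Suc i) / (\<rho> * \<gamma> i))" for i
  have "eventually (\<lambda>k. \<gamma> (Suc k) / \<gamma> k < \<rho>) sequentially"
    using order_tendstoD(2)[OF lim \<open>\<rho> > 1\<close>] .
  then obtain N where N: "\<And>k. k \<ge> N \<Longrightarrow> \<gamma> (Suc k) / \<gamma> k < \<rho>"
    by (auto simp: eventually_sequentially)
  have q1: "q i \<ge> 1" for i by (simp add: q_def)
  have qN: "q i = 1" if "i \<ge> N" for i
    using N[OF that] pos[of i] \<open>\<rho> > 1\<close> by (simp add: q_def field_simps)
  have step: "\<gamma> (Suc i) \<le> q i * \<rho> * \<gamma> i" for i
    using pos[of i] \<open>\<rho> > 1\<close> by (simp add: q_def max_def field_simps)
  have A: "\<gamma> (m + j) \<le> (\<Prod>i\<in>{m..<m+j}. q i) * \<rho> ^ j * \<gamma> m" for m j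
  proof (induction j)
    case (Suc j)
    have "\<gamma> (m + Suc j) \<le> q (m + j) * \<rho> * \<gamma> (m + j)"
      using step[of "m + j"] by simp
    also have "\<dots> \<le> q (m + j) * \<rho> * ((\<Prod>i\<in>{m..<m+j}. q i) * \<rho> ^ j * \<gamma> m)"
      using q1[of "m + j"] \<open>\<rho> > 1\<close> Suc by (intro mult_left_mono) auto
    finally show ?case by (simp add: mult_ac)
  qed simp
  have B: "(\<Prod>i\<in>{m..<m+j}. q i) \<le> (\<Prod>i<N. q i)" for m j
  proof -
    have "(\<Prod>i\<in>{m..<m+j}. q i) = (\<Prod>i\<in>{m..<m+j} \<inter> {..<N}. q i)"
      by (intro prod.mono_neutral_right) (use qN leI in auto)
    also have "\<dots> \<le> (\<Prod>i<N. q i)"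
    proof (rule prod_mono2)
      show "0 \<le> q a" if "a \<in> {m..<m + j} \<inter> {..<N}" for a
        using q1[of a] by linarith
    qed (use q1 in auto)
    finally show ?thesis .
  qed
  show ?thesis
  proof (rule that)
    show "(\<Prod>i<N. q i) > 0" using q1 by (intro prod_pos) (smt (verit, best))
    show "\<gamma> (m + j) \<le> (\<Prod>i<N. q i) * \<rho> ^ j * \<gamma> m" for m j
      using A[of m j] B[of m j] pos[of m] \<open>\<rho> > 1\<close>
      by (smt (verit, best) mult_right_mono zero_le_power)
  qed
qed

lemma weight_seq_pos: "weight_seq \<alpha> \<Longrightarrow> \<alpha> k > 0"
  by (simp add: weight_seq_def)

lemma weight_seq_upper:
  assumes "weight_seq \<alpha>" "\<rho> > 1"
  obtains C where "C > 0" "\<And>m j. \<alpha> (m + j) \<le> C * \<rho> ^ j * \<alpha> m"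
  using weight_shift_bound[of \<alpha> \<rho>] assms by (auto simp: weight_seq_def)

text \<open>The upper bound applied to the reciprocal weights, whose ratios also tend to 1.\<close>

lemma weight_seq_lower:
  assumes "weight_seq \<alpha>" "\<rho> > 1"
  obtains C where "C > 0" "\<And>m j. \<alpha> m \<le> C * \<rho> ^ j * \<alpha> (m + j)"
proof -
  have "(\<lambda>k. inverse (\<alpha> (Suc k) / \<alpha> k)) \<longlonglongrightarrow> inverse 1"
    using assms(1) by (intro tendsto_inverse) (auto simp: weight_seq_def)
  then have "(\<lambda>k. inverse (\<alpha> (Suc k)) / inverse (\<alpha> k)) \<longlonglongrightarrow> 1"
    by (simp add: field_simps)
  with weight_shift_bound[of "\<lambda>k. inverse (\<alpha> k)" \<rho>] assms weight_seq_pos[OF assms(1)]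
  obtain C where C: "C > 0" "\<And>m j. inverse (\<alpha> (m + j)) \<le> C * \<rho> ^ j * inverse (\<alpha> m)"
    by auto
  show ?thesis
    by (rule that[OF C(1)]) (use C(2) weight_seq_pos[OF assms(1)] in \<open>simp add: field_simps\<close>)
qed

section \<open>Arithmetic of Taylor coefficients\<close>

lemma taylor_coeff_eq_fps_nth:
  "f has_fps_expansion F \<Longrightarrow> taylor_coeff f k = fps_nth F k"
  by (simp add: taylor_coeff_def fps_nth_fps_expansion)

lemma has_fps_expansion_taylor:
  assumes "f holomorphic_on ball 0 r" "r > 0"
  shows "f has_fps_expansion Abs_fps (taylor_coeff f)"
  using has_fps_expansion_fps_expansion[of "ball 0 r" f] assms
  by (auto simp: fps_expansion_def taylor_coeff_def[abs_def])

lemma taylor_sums: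
  assumes "f holomorphic_on ball 0 r" "cmod z < r"
  shows "(\<lambda>k. taylor_coeff f k * z ^ k) sums f z"
  using holomorphic_power_series[of f 0 r z] assms by (simp add: taylor_coeff_def)

lemma taylor_coeff_add:
  assumes "f holomorphic_on ball 0 r" "g holomorphic_on ball 0 r" "r > 0"
  shows "taylor_coeff (\<lambda>z. f z + g z) k = taylor_coeff f k + taylor_coeff g k"
  using taylor_coeff_eq_fps_nth[OF has_fps_expansion_add[OF
      has_fps_expansion_taylor[OF assms(1,3)] has_fps_expansion_taylor[OF assms(2,3)]]] by simp

lemma taylor_coeff_cmult:
  assumes "f holomorphic_on ball 0 r" "r > 0"
  shows "taylor_coeff (\<lambda>z. c * f z) k = c * taylor_coeff f k"
  using taylor_coeff_eq_fps_nth[OF has_fps_expansion_cmult_left[OF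
      has_fps_expansion_taylor[OF assms]]] by simp

lemma taylor_coeff_mult:
  assumes "f holomorphic_on ball 0 r" "g holomorphic_on ball 0 r" "r > 0"
  shows "taylor_coeff (\<lambda>z. f z * g z) k = (\<Sum>i=0..k. taylor_coeff f i * taylor_coeff g (k - i))"
  using taylor_coeff_eq_fps_nth[OF has_fps_expansion_mult[OF
      has_fps_expansion_taylor[OF assms(1,3)] has_fps_expansion_taylor[OF assms(2,3)]]]
  by (simp add: fps_mult_nth)

lemma holomorphic_eqI_taylor:
  assumes "f holomorphic_on ball 0 r" "g holomorphic_on ball 0 r"
    and "\<And>k. taylor_coeff f k = taylor_coeff g k" "cmod z < r"
  shows "f z = g z"
proof (rule sums_unique2)
  show "(\<lambda>k. taylor_coeff f k * z ^ k) sums f z" by (rule taylor_sums[OF assms(1,4)])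
  show "(\<lambda>k. taylor_coeff f k * z ^ k) sums g z"
    using taylor_sums[OF assms(2,4)] by (simp add: assms(3))
qed

text \<open>The value 0 off the disc is the normal form in which \<open>hardy\<close> stores its
  elements, so these functions can be members of the carrier.\<close>

definition series_fun :: "(nat \<Rightarrow> complex) \<Rightarrow> complex \<Rightarrow> complex" where
  "series_fun c = (\<lambda>z. if z \<in> ball 0 1 then eval_fps (Abs_fps c) z else 0)"

lemma
  assumes "fps_conv_radius (Abs_fps c) \<ge> 1"
  shows holomorphic_series_fun: "series_fun c holomorphic_on ball 0 1"
    and taylor_coeff_series_fun: "taylor_coeff (series_fun c) k = c k"
proof -
  have le: "ball 0 1 \<subseteq> eball (0::complex) (fps_conv_radius (Abs_fps c))"
    proof
    fix z :: complex assume "z \<in> ball 0 1"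
    then have "ereal (cmod z) < 1" by (simp add: one_ereal_def)
    also note assms
    finally show "z \<in> eball 0 (fps_conv_radius (Abs_fps c))" by simp
  qed
  show "series_fun c holomorphic_on ball 0 1"
    by (rule holomorphic_transform[OF holomorphic_on_eval_fps[OF le]]) (simp add: series_fun_def)
  have "eval_fps (Abs_fps c) has_fps_expansion Abs_fps c"
    using less_le_trans[of "0::ereal" 1, OF _ assms] by (intro eval_fps_has_fps_expansion) simp
  moreover have "eventually (\<lambda>z. series_fun c z = eval_fps (Abs_fps c) z) (nhds 0)"
    using eventually_nhds_in_open[of "ball 0 1" "0::complex"]
    by (auto elim!: eventually_mono simp: series_fun_def)
  ultimately have "series_fun c has_fps_expansion Abs_fps c"
    using has_fps_expansion_cong by blast
  from taylor_coeff_eq_fps_nth[OF this] show "taylor_coeff (series_fun c) k = c k"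
    by simp
qed

lemma mem_hardy:
  "f \<in> vecs (hardy \<alpha>) \<longleftrightarrow> f holomorphic_on ball 0 1 \<and> (\<forall>z. cmod z \<ge> 1 \<longrightarrow> f z = 0) \<and>
     summable (\<lambda>k. (cmod (taylor_coeff f k))\<^sup>2 * (\<alpha> k)\<^sup>2)"
  by (auto simp: hardy_def not_less)

lemma hardy_coeff_bounded:
  assumes "summable (\<lambda>k. (cmod (c k))\<^sup>2 * (\<alpha> k)\<^sup>2)"
  obtains M where "\<And>k. cmod (c k) * \<bar>\<alpha> k\<bar> \<le> M"
proof -
  have "(\<lambda>k. sqrt ((cmod (c k))\<^sup>2 * (\<alpha> k)\<^sup>2)) \<longlonglongrightarrow> sqrt 0"
    by (intro tendsto_real_sqrt summable_LIMSEQ_zero assms)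
  then have "(\<lambda>k. cmod (c k) * \<bar>\<alpha> k\<bar>) \<longlonglongrightarrow> 0"
    by (simp add: real_sqrt_mult)
  then have "Bseq (\<lambda>k. cmod (c k) * \<bar>\<alpha> k\<bar>)"
    by (intro convergent_imp_Bseq) (auto simp: convergent_def)
  then obtain K where "\<And>k. norm (cmod (c k) * \<bar>\<alpha> k\<bar>) \<le> K"
    by (auto simp: Bseq_def)
  then show ?thesis using that[of K] by (auto simp: abs_mult)
qed

text \<open>Square summability bounds the coefficients by a multiple of 1/\<alpha>(k), and
  1/\<alpha>(k) grows at most like \<rho>^k for every \<rho> > 1.\<close>

lemma conv_radius_hardy:
  assumes "weight_seq \<alpha>" "summable (\<lambda>k. (cmod (c k))\<^sup>2 * (\<alpha> k)\<^sup>2)"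
  shows "fps_conv_radius (Abs_fps c) \<ge> 1"
  unfolding fps_conv_radius_def
proof (rule conv_radius_geI_ex)
  fix r :: real assume r: "0 < r" "ereal r < 1"
  then have r1: "r < 1" by simp
  \<comment> \<open>The midpoint of 1 and 1/r: above 1, as the weight bound requires, and with
    \<rho> r < 1.\<close>
  define \<rho> where "\<rho> = (1 + 1 / r) / 2"
  have \<rho>: "\<rho> > 1" "\<rho> * r < 1" using r r1 by (auto simp: \<rho>_def field_simps)
  obtain M where M: "\<And>k. cmod (c k) * \<bar>\<alpha> k\<bar> \<le> M"
    using hardy_coeff_bounded[OF assms(2)] by blast
  obtain C where C: "C > 0" "\<And>m j. \<alpha> m \<le> C * \<rho> ^ j * \<alpha> (m + j)"
    using weight_seq_lower[OF assms(1) \<rho>(1)] by blast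
  have "M \<ge> 0" using M[of 0] by (smt (verit) mult_nonneg_nonneg norm_ge_zero)
  have bound: "cmod (c k * of_real r ^ k) \<le> M * C / \<alpha> 0 * (\<rho> * r) ^ k" for k
  proof -
    have a: "\<alpha> k > 0" "\<alpha> 0 > 0" using weight_seq_pos[OF assms(1)] by auto
    have "cmod (c k) * \<alpha> 0 \<le> cmod (c k) * (C * \<rho> ^ k * \<alpha> k)"
      using C(2)[of 0 k] by (intro mult_left_mono) auto
    also have "\<dots> \<le> C * \<rho> ^ k * M"
      using mult_left_mono[OF M[of k], of "C * \<rho> ^ k"] C(1) \<rho> a by (simp add: mult_ac)
    finally have "cmod (c k) \<le> M * C / \<alpha> 0 * \<rho> ^ k" using a by (simp add: field_simps)
    then have "cmod (c k) * r ^ k \<le> M * C / \<alpha> 0 * \<rho> ^ k * r ^ k"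
      using r by (intro mult_right_mono) auto
    then show ?thesis
      using r by (simp add: norm_mult norm_power power_mult_distrib mult_ac)
  qed
  have "summable (\<lambda>k. M * C / \<alpha> 0 * (\<rho> * r) ^ k)"
    using \<rho> r by (intro summable_mult summable_geometric) auto
  then have "summable (\<lambda>k. c k * of_real r ^ k)"
    by (rule summable_comparison_test'[of _ 0]) (use bound in auto)
  then show "\<exists>z. cmod z = r \<and> summable (\<lambda>n. fps_nth (Abs_fps c) n * z ^ n)"
    using r by (intro exI[of _ "of_real r"]) auto
qed

lemma series_fun_mem:
  assumes "weight_seq \<alpha>" "summable (\<lambda>k. (cmod (c k))\<^sup>2 * (\<alpha> k)\<^sup>2)"
  shows "series_fun c \<in> vecs (hardy \<alpha>)" "taylor_coeff (series_fun c) = c"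
proof -
  note r = conv_radius_hardy[OF assms]
  show t: "taylor_coeff (series_fun c) = c" using taylor_coeff_series_fun[OF r] by auto
  show "series_fun c \<in> vecs (hardy \<alpha>)"
    using holomorphic_series_fun[OF r] assms(2) unfolding mem_hardy t
    by (auto simp: series_fun_def)
qed

lemma hardy_eqI:
  assumes "f \<in> vecs (hardy \<alpha>)" "g \<in> vecs (hardy \<beta>)" "\<And>k. taylor_coeff f k = taylor_coeff g k"
  shows "f = g"
proof
  show "f z = g z" for z
    using holomorphic_eqI_taylor[of f 1 g z] assms by (cases "cmod z < 1") (auto simp: mem_hardy)
qed

lemma hardy_ip_bound: "cmod (a * cnj b * (of_real w)\<^sup>2) \<le> ((cmod a)\<^sup>2 * w\<^sup>2 + (cmod b)\<^sup>2 * w\<^sup>2) / 2"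
proof -
  have "cmod (a * cnj b * (of_real w)\<^sup>2) = cmod a * cmod b * w\<^sup>2"
    by (simp add: norm_mult norm_power)
  also have "\<dots> \<le> ((cmod a)\<^sup>2 + (cmod b)\<^sup>2) / 2 * w\<^sup>2"
    using sum_squares_bound[of "cmod a" "cmod b"] by (intro mult_right_mono) auto
  finally show ?thesis by (simp add: algebra_simps)
qed

lemma summable_hardy_ip:
  assumes "summable (\<lambda>k. (cmod (c k))\<^sup>2 * (\<alpha> k)\<^sup>2)" "summable (\<lambda>k. (cmod (d k))\<^sup>2 * (\<alpha> k)\<^sup>2)"
  shows "summable (\<lambda>k. c k * cnj (d k) * (of_real (\<alpha> k))\<^sup>2)"
  by (rule summable_comparison_test'[of "\<lambda>k. ((cmod (c k))\<^sup>2 * (\<alpha> k)\<^sup>2 + (cmod (d k))\<^sup>2 * (\<alpha> k)\<^sup>2) / 2" 0])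
    (use assms hardy_ip_bound in \<open>auto intro!: summable_divide summable_add\<close>)

lemma summable_hardy_add:
  assumes "summable (\<lambda>k. (cmod (c k))\<^sup>2 * (\<alpha> k)\<^sup>2)" "summable (\<lambda>k. (cmod (d k))\<^sup>2 * (\<alpha> k)\<^sup>2)"
  shows "summable (\<lambda>k. (cmod (c k + d k))\<^sup>2 * (\<alpha> k)\<^sup>2)"
proof (rule summable_comparison_test'[of "\<lambda>k. 2 * ((cmod (c k))\<^sup>2 * (\<alpha> k)\<^sup>2 + (cmod (d k))\<^sup>2 * (\<alpha> k)\<^sup>2)" 0])
  show "summable (\<lambda>k. 2 * ((cmod (c k))\<^sup>2 * (\<alpha> k)\<^sup>2 + (cmod (d k))\<^sup>2 * (\<alpha> k)\<^sup>2))"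
    using assms by (intro summable_mult summable_add)
  show "norm ((cmod (c k + d k))\<^sup>2 * (\<alpha> k)\<^sup>2) \<le> 2 * ((cmod (c k))\<^sup>2 * (\<alpha> k)\<^sup>2 + (cmod (d k))\<^sup>2 * (\<alpha> k)\<^sup>2)" for k
  proof -
    have "(cmod (c k + d k))\<^sup>2 \<le> (cmod (c k) + cmod (d k))\<^sup>2"
      by (intro power_mono norm_triangle_ineq) auto
    also have "\<dots> \<le> 2 * ((cmod (c k))\<^sup>2 + (cmod (d k))\<^sup>2)"
      using sum_squares_bound[of "cmod (c k)" "cmod (d k)"] by (simp add: power2_sum)
    finally have "(cmod (c k + d k))\<^sup>2 * (\<alpha> k)\<^sup>2 \<le> 2 * ((cmod (c k))\<^sup>2 + (cmod (d k))\<^sup>2) * (\<alpha> k)\<^sup>2"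
      by (intro mult_right_mono) auto
    then show ?thesis by (simp add: algebra_simps)
  qed
qed

lemma hardy_add_mem:
  assumes "f \<in> vecs (hardy \<alpha>)" "g \<in> vecs (hardy \<alpha>)"
  shows "(\<lambda>z. f z + g z) \<in> vecs (hardy \<alpha>)"
proof -
  have t: "taylor_coeff (\<lambda>z. f z + g z) = (\<lambda>k. taylor_coeff f k + taylor_coeff g k)"
    using assms taylor_coeff_add[of f 1 g] by (auto simp: mem_hardy)
  show ?thesis
    unfolding mem_hardy t
    using assms by (intro conjI summable_hardy_add holomorphic_intros) (simp_all add: mem_hardy)
qed

lemma hardy_scale_mem:
  assumes "f \<in> vecs (hardy \<alpha>)"
  shows "(\<lambda>z. c * f z) \<in> vecs (hardy \<alpha>)"
proof -
  have t: "taylor_coeff (\<lambda>z. c * f z) = (\<lambda>k. c * taylor_coeff f k)"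
    using assms taylor_coeff_cmult[of f 1] by (auto simp: mem_hardy)
  have "summable (\<lambda>k. (cmod c)\<^sup>2 * ((cmod (taylor_coeff f k))\<^sup>2 * (\<alpha> k)\<^sup>2))"
    using assms by (intro summable_mult) (simp add: mem_hardy)
  then have "summable (\<lambda>k. (cmod (c * taylor_coeff f k))\<^sup>2 * (\<alpha> k)\<^sup>2)"
    by (simp add: norm_mult power_mult_distrib mult.assoc)
  then show ?thesis
    unfolding mem_hardy t using assms
    by (intro conjI holomorphic_intros) (simp_all add: mem_hardy)
qed

section \<open>Abstract Hilbert spaces and adjoints\<close>

text \<open>The last clause does the work of the vector space axioms: vectors with the same inner
  products are equal, so algebraic identities can be tested against all vectors.\<close>

definition pre_hilbert :: "'a ip_space \<Rightarrow> bool" where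
  "pre_hilbert H \<longleftrightarrow>
     (\<forall>x\<in>vecs H. \<forall>y\<in>vecs H. vadd H x y \<in> vecs H) \<and>
     (\<forall>c. \<forall>x\<in>vecs H. vscale H c x \<in> vecs H) \<and>
     (\<forall>x\<in>vecs H. \<forall>y\<in>vecs H. \<forall>z\<in>vecs H. ip H (vadd H x y) z = ip H x z + ip H y z) \<and>
     (\<forall>c. \<forall>x\<in>vecs H. \<forall>z\<in>vecs H. ip H (vscale H c x) z = c * ip H x z) \<and>
     (\<forall>x\<in>vecs H. \<forall>y\<in>vecs H. ip H y x = cnj (ip H x y)) \<and>
     (\<forall>x\<in>vecs H. Re (ip H x x) \<ge> 0) \<and>
     (\<forall>x\<in>vecs H. \<forall>y\<in>vecs H. (\<forall>v\<in>vecs H. ip H v x = ip H v y) \<longrightarrow> x = y)"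

text \<open>Riesz representation stands in for completeness.\<close>

definition riesz_property :: "'a ip_space \<Rightarrow> bool" where
  "riesz_property H \<longleftrightarrow>
     (\<forall>L C. (\<forall>x\<in>vecs H. \<forall>y\<in>vecs H. L (vadd H x y) = L x + L y) \<longrightarrow>
        (\<forall>c. \<forall>x\<in>vecs H. L (vscale H c x) = c * L x) \<longrightarrow>
        (\<forall>x\<in>vecs H. cmod (L x) \<le> C * vnorm H x) \<longrightarrow>
        (\<exists>y\<in>vecs H. \<forall>x\<in>vecs H. L x = ip H x y))"

definition hilbert_like :: "'a ip_space \<Rightarrow> bool" where
  "hilbert_like H \<longleftrightarrow> pre_hilbert H \<and> riesz_property H"

lemma
  assumes "hilbert_like H"
  shows hilbert_add: "\<lbrakk>x \<in> vecs H; y \<in> vecs H\<rbrakk> \<Longrightarrow> vadd H x y \<in> vecs H"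
    and hilbert_scale: "x \<in> vecs H \<Longrightarrow> vscale H c x \<in> vecs H"
    and hilbert_ip_add: "\<lbrakk>x \<in> vecs H; y \<in> vecs H; z \<in> vecs H\<rbrakk> \<Longrightarrow> ip H (vadd H x y) z = ip H x z + ip H y z"
    and hilbert_ip_scale: "\<lbrakk>x \<in> vecs H; z \<in> vecs H\<rbrakk> \<Longrightarrow> ip H (vscale H c x) z = c * ip H x z"
    and hilbert_ip_sym: "\<lbrakk>x \<in> vecs H; y \<in> vecs H\<rbrakk> \<Longrightarrow> ip H y x = cnj (ip H x y)"
    and hilbert_ip_ge: "x \<in> vecs H \<Longrightarrow> Re (ip H x x) \<ge> 0"
    and hilbert_eqI: "\<lbrakk>x \<in> vecs H; y \<in> vecs H; \<And>v. v \<in> vecs H \<Longrightarrow> ip H v x = ip H v y\<rbrakk> \<Longrightarrow> x = y"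
  using assms unfolding hilbert_like_def pre_hilbert_def by blast+

lemma hilbert_riesz:
  assumes "hilbert_like H"
    and "\<And>x y. x \<in> vecs H \<Longrightarrow> y \<in> vecs H \<Longrightarrow> L (vadd H x y) = L x + L y"
    and "\<And>c x. x \<in> vecs H \<Longrightarrow> L (vscale H c x) = c * L x"
    and "\<And>x. x \<in> vecs H \<Longrightarrow> cmod (L x) \<le> C * vnorm H x"
  obtains y where "y \<in> vecs H" "\<And>x. x \<in> vecs H \<Longrightarrow> L x = ip H x y"
proof -
  have "\<exists>y\<in>vecs H. \<forall>x\<in>vecs H. L x = ip H x y"
    using assms(1) unfolding hilbert_like_def riesz_property_def
    by (elim conjE allE[of _ L] allE[of _ C]) (use assms(2-4) in simp)
  then show ?thesis using that by blast
qed

lemma hilbert_ip_add_right: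
  assumes "hilbert_like H" "x \<in> vecs H" "y \<in> vecs H" "z \<in> vecs H"
  shows "ip H z (vadd H x y) = ip H z x + ip H z y"
  using assms hilbert_add[of H x y]
  by (simp add: hilbert_ip_sym[OF assms(1) _ assms(4)] hilbert_ip_add)

lemma hilbert_ip_scale_right:
  assumes "hilbert_like H" "x \<in> vecs H" "z \<in> vecs H"
  shows "ip H z (vscale H c x) = cnj c * ip H z x"
  using assms hilbert_scale[of H x c]
  by (simp add: hilbert_ip_sym[OF assms(1) _ assms(3)] hilbert_ip_scale)

lemma hilbert_ip_self:
  assumes "hilbert_like H" "x \<in> vecs H"
  shows "ip H x x = of_real ((vnorm H x)\<^sup>2)"
proof -
  have "ip H x x = cnj (ip H x x)" using hilbert_ip_sym[OF assms assms(2)] .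
  then have "Im (ip H x x) = 0" by (simp add: complex_eq_iff)
  then show ?thesis
    using hilbert_ip_ge[OF assms] by (simp add: vnorm_def complex_eq_iff)
qed

lemma vnorm_nonneg: "hilbert_like H \<Longrightarrow> x \<in> vecs H \<Longrightarrow> vnorm H x \<ge> 0"
  by (simp add: vnorm_def hilbert_ip_ge)

lemma hilbert_cauchy_schwarz:
  assumes H: "hilbert_like H" and x: "x \<in> vecs H" and y: "y \<in> vecs H"
  shows "cmod (ip H x y) \<le> vnorm H x * vnorm H y"
proof -
  define p where "p = ip H x y"
  define a where "a = (vnorm H x)\<^sup>2"
  define b where "b = (vnorm H y)\<^sup>2"
  have yx: "ip H y x = cnj p" using hilbert_ip_sym[OF H x y] by (simp add: p_def)
  have key: "0 \<le> a + 2 * Re (cnj c * p) + (cmod c)\<^sup>2 * b" for c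
  proof -
    have v: "vscale H c y \<in> vecs H" using hilbert_scale[OF H y] .
    have s: "vadd H x (vscale H c y) \<in> vecs H" using hilbert_add[OF H x v] .
    have "ip H (vadd H x (vscale H c y)) (vadd H x (vscale H c y))
        = of_real a + cnj c * p + c * cnj p + c * (cnj c * of_real b)"
      using x y v s H yx
      by (simp add: hilbert_ip_add hilbert_ip_add_right hilbert_ip_scale hilbert_ip_scale_right
          hilbert_ip_self[OF H x] hilbert_ip_self[OF H y] a_def b_def p_def[symmetric] algebra_simps)
    also have "\<dots> = of_real a + cnj c * p + cnj (cnj c * p) + of_real ((cmod c)\<^sup>2 * b)"
      using complex_norm_square[of c] by (simp add: algebra_simps)
    finally show ?thesis
      using hilbert_ip_ge[OF H s] by simp
  qed
  have b0: "b \<ge> 0" "a \<ge> 0" by (simp_all add: a_def b_def)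
  have "(cmod p)\<^sup>2 \<le> a * b"
  proof (cases "b = 0")
    \<comment> \<open>With b = 0 the inequality \<open>key\<close> is linear along c = -t p; at t =
      (a + 1) / (2 |p|^2) it would read a + 1 \<le> a.\<close>
    case True
    have "(cmod p)\<^sup>2 * (2 * t) \<le> a" for t :: real
    proof -
      have "Re (cnj (of_real (- t) * p) * p) = - t * (cmod p)\<^sup>2"
        using cmod_power2[of p] by (simp add: power2_eq_square algebra_simps)
      then show ?thesis using key[of "of_real (- t) * p"] True by (simp add: algebra_simps)
    qed
    from this[of "(a + 1) / (2 * (cmod p)\<^sup>2)"] have "p = 0"
      by (cases "p = 0") auto
    then show ?thesis using True by simp
  next
    case False
    then have "b > 0" using b0 by simp
    \<comment> \<open>Along c = -t p the quadratic in \<open>key\<close> is smallest at t =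
      1/b.\<close>
    define t where "t = 1 / b"
    have "Re (cnj (of_real (- t) * p) * p) = - t * (cmod p)\<^sup>2"
      using cmod_power2[of p] by (simp add: power2_eq_square algebra_simps)
    moreover have "(cmod (of_real (- t) * p))\<^sup>2 * b = t * (cmod p)\<^sup>2"
      using \<open>b > 0\<close> by (simp add: norm_mult norm_divide power_mult_distrib t_def power2_eq_square)
    ultimately have "0 \<le> a - t * (cmod p)\<^sup>2"
      using key[of "of_real (- t) * p"] by simp
    then show ?thesis using \<open>b > 0\<close> by (simp add: t_def field_simps)
  qed
  then have "(cmod p)\<^sup>2 \<le> (vnorm H x * vnorm H y)\<^sup>2"
    by (simp add: a_def b_def power_mult_distrib)
  then show ?thesis
    unfolding p_def by (rule power2_le_imp_le) (simp add: vnorm_nonneg[OF H x] vnorm_nonneg[OF H y])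
qed

text \<open>\<open>adjoint_op\<close> is a definite description: Riesz representation of the
  functional v -> ip K (A v) y gives existence, and separation by inner products gives
  uniqueness.\<close>

lemma
  assumes H: "hilbert_like H" and K: "hilbert_like K" and A: "bounded_op H K A" and y: "y \<in> vecs K"
  shows adjoint_op_mem: "adjoint_op H K A y \<in> vecs H"
    and adjoint_op_ip: "v \<in> vecs H \<Longrightarrow> ip K (A v) y = ip H v (adjoint_op H K A y)"
proof -
  obtain C where C: "\<forall>x\<in>vecs H. vnorm K (A x) \<le> C * vnorm H x"
    using A by (auto simp: bounded_op_def)
  have AK: "A x \<in> vecs K" if "x \<in> vecs H" for x using A that by (simp add: bounded_op_def)
  have "cmod (ip K (A x) y) \<le> C * vnorm K y * vnorm H x" if x: "x \<in> vecs H" for x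
  proof -
    have "cmod (ip K (A x) y) \<le> vnorm K (A x) * vnorm K y"
      using hilbert_cauchy_schwarz[OF K AK[OF x] y] .
    also have "\<dots> \<le> (C * vnorm H x) * vnorm K y"
      using C x vnorm_nonneg[OF K y] by (intro mult_right_mono) auto
    finally show ?thesis by (simp add: mult_ac)
  qed
  then obtain z where z: "z \<in> vecs H" "\<And>x. x \<in> vecs H \<Longrightarrow> ip K (A x) y = ip H x z"
    using hilbert_riesz[OF H, of "\<lambda>x. ip K (A x) y" "C * vnorm K y"] A y K AK
    by (auto simp: bounded_op_def hilbert_ip_add hilbert_ip_scale)
  have "adjoint_op H K A y = z"
    unfolding adjoint_op_def
  proof (rule the_equality)
    show "z \<in> vecs H \<and> (\<forall>v\<in>vecs H. ip K (A v) y = ip H v z)" using z by auto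
    show "x = z" if "x \<in> vecs H \<and> (\<forall>v\<in>vecs H. ip K (A v) y = ip H v x)" for x
      using hilbert_eqI[OF H, of x z] z that by auto
  qed
  with z show "adjoint_op H K A y \<in> vecs H"
    "v \<in> vecs H \<Longrightarrow> ip K (A v) y = ip H v (adjoint_op H K A y)" by auto
qed

lemma adjoint_op_eqI:
  assumes "hilbert_like H" "hilbert_like K" "bounded_op H K A" "y \<in> vecs K" "x \<in> vecs H"
    and "\<And>v. v \<in> vecs H \<Longrightarrow> ip K (A v) y = ip H v x"
  shows "adjoint_op H K A y = x"
  using hilbert_eqI[OF assms(1) adjoint_op_mem[OF assms(1-4)] assms(5)]
    adjoint_op_ip[OF assms(1-4)] assms(6) by simp

lemma hilbert_zero:
  assumes "hilbert_like H" "x \<in> vecs H" "v \<in> vecs H"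
  shows "ip H v (vscale H 0 x) = 0" "ip H (vscale H 0 x) v = 0"
  using assms by (simp_all add: hilbert_ip_scale hilbert_ip_scale_right)

lemma adjoint_op_linear:
  assumes H: "hilbert_like H" and K: "hilbert_like K" and A: "bounded_op H K A"
    and x: "x \<in> vecs K" and y: "y \<in> vecs K"
  shows "adjoint_op H K A (vadd K x y) = vadd H (adjoint_op H K A x) (adjoint_op H K A y)"
    and "adjoint_op H K A (vscale K c x) = vscale H c (adjoint_op H K A x)"
proof -
  note mem = adjoint_op_mem[OF H K A]
  have AK: "A v \<in> vecs K" if "v \<in> vecs H" for v using A that by (simp add: bounded_op_def)
  show "adjoint_op H K A (vadd K x y) = vadd H (adjoint_op H K A x) (adjoint_op H K A y)"
    using mem[OF x] mem[OF y] adjoint_op_ip[OF H K A] H K x y AK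
    by (intro adjoint_op_eqI[OF H K A]) (auto simp: hilbert_add hilbert_ip_add_right)
  show "adjoint_op H K A (vscale K c x) = vscale H c (adjoint_op H K A x)"
    using mem[OF x] adjoint_op_ip[OF H K A] H K x AK
    by (intro adjoint_op_eqI[OF H K A]) (auto simp: hilbert_scale hilbert_ip_scale_right)
qed

section \<open>Orthogonal sums of two spaces\<close>

lemma orth_sum_simps:
  "vecs (orth_sum H K) = vecs H \<times> vecs K"
  "vadd (orth_sum H K) x y = (vadd H (fst x) (fst y), vadd K (snd x) (snd y))"
  "vscale (orth_sum H K) c x = (vscale H c (fst x), vscale K c (snd x))"
  "ip (orth_sum H K) x y = ip H (fst x) (fst y) + ip K (snd x) (snd y)"
  by (simp_all add: orth_sum_def split_beta)

lemma vnorm_orth_sum: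
  assumes "hilbert_like H" "hilbert_like K" "x \<in> vecs H" "y \<in> vecs K"
  shows "vnorm (orth_sum H K) (x, y) = sqrt ((vnorm H x)\<^sup>2 + (vnorm K y)\<^sup>2)"
  using assms hilbert_ip_ge[of H x] hilbert_ip_ge[of K y]
  by (simp add: vnorm_def orth_sum_simps)

text \<open>The records carry no zero vector, so it is the multiple of any vector by 0.\<close>

definition vzero :: "'a ip_space \<Rightarrow> 'a" where
  "vzero H = vscale H 0 (SOME x. x \<in> vecs H)"

lemma
  assumes H: "hilbert_like H"
  shows vzero_mem: "vzero H \<in> vecs H"
    and ip_vzero_left: "v \<in> vecs H \<Longrightarrow> ip H (vzero H) v = 0"
    and vscale_vzero: "vscale H c (vzero H) = vzero H"
    and vadd_vzero_right: "v \<in> vecs H \<Longrightarrow> vadd H v (vzero H) = v"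
    and vadd_vzero_left: "v \<in> vecs H \<Longrightarrow> vadd H (vzero H) v = v"
    and vnorm_vzero: "vnorm H (vzero H) = 0"
proof -
  define y where "y = (SOME x. x \<in> vecs H)"
  obtain y' where "y' \<in> vecs H"
    using hilbert_riesz[OF H, of "\<lambda>_. 0" 0] by auto
  then have y: "y \<in> vecs H" unfolding y_def by (rule someI)
  show z: "vzero H \<in> vecs H"
    unfolding vzero_def y_def[symmetric] using hilbert_scale[OF H y] .
  have r: "ip H v (vzero H) = 0" if "v \<in> vecs H" for v
    unfolding vzero_def y_def[symmetric] using hilbert_zero[OF H y that] by auto
  show l: "ip H (vzero H) v = 0" if "v \<in> vecs H" for v
    unfolding vzero_def y_def[symmetric] using hilbert_zero[OF H y that] by auto
  show "vscale H c (vzero H) = vzero H"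
  proof (rule hilbert_eqI[OF H hilbert_scale[OF H z] z])
    show "ip H v (vscale H c (vzero H)) = ip H v (vzero H)" if "v \<in> vecs H" for v
      by (simp add: hilbert_ip_scale_right[OF H z that] r[OF that])
  qed
  show "vadd H v (vzero H) = v" if v: "v \<in> vecs H" for v
  proof (rule hilbert_eqI[OF H hilbert_add[OF H v z] v])
    show "ip H u (vadd H v (vzero H)) = ip H u v" if "u \<in> vecs H" for u
      by (simp add: hilbert_ip_add_right[OF H v z that] r[OF that])
  qed
  show "vadd H (vzero H) v = v" if v: "v \<in> vecs H" for v
  proof (rule hilbert_eqI[OF H hilbert_add[OF H z v] v])
    show "ip H u (vadd H (vzero H) v) = ip H u v" if "u \<in> vecs H" for u
      by (simp add: hilbert_ip_add_right[OF H z v that] r[OF that])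
  qed
  show "vnorm H (vzero H) = 0" by (simp add: vnorm_def r[OF z])
qed

lemma hilbert_like_orth_sum:
  assumes H: "hilbert_like H" and K: "hilbert_like K"
  shows "hilbert_like (orth_sum H K)"
  unfolding hilbert_like_def
proof
  show "riesz_property (orth_sum H K)"
    unfolding riesz_property_def
  proof (intro allI impI)
    fix L :: "'a \<times> 'b \<Rightarrow> complex" and C
    assume add: "\<forall>x\<in>vecs (orth_sum H K). \<forall>y\<in>vecs (orth_sum H K). L (vadd (orth_sum H K) x y) = L x + L y"
      and sc: "\<forall>c. \<forall>x\<in>vecs (orth_sum H K). L (vscale (orth_sum H K) c x) = c * L x"
      and bd: "\<forall>x\<in>vecs (orth_sum H K). cmod (L x) \<le> C * vnorm (orth_sum H K) x"
    note z = vzero_mem[OF H] vadd_vzero_left[OF H] vadd_vzero_right[OF H] vnorm_vzero[OF H] vscale_vzero[OF H]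
    note w = vzero_mem[OF K] vadd_vzero_left[OF K] vadd_vzero_right[OF K] vnorm_vzero[OF K] vscale_vzero[OF K]
    \<comment> \<open>The representing vector is found one summand at a time, on vectors whose other
      component is zero.\<close>
    obtain p where p: "p \<in> vecs H" "\<And>x. x \<in> vecs H \<Longrightarrow> L (x, vzero K) = ip H x p"
    proof (rule hilbert_riesz[OF H, of "\<lambda>x. L (x, vzero K)" C])
      show "L (vadd H x y, vzero K) = L (x, vzero K) + L (y, vzero K)" if "x \<in> vecs H" "y \<in> vecs H" for x y
        using add[rule_format, of "(x, vzero K)" "(y, vzero K)"] that w by (simp add: orth_sum_simps)
      show "L (vscale H c x, vzero K) = c * L (x, vzero K)" if "x \<in> vecs H" for c x
        using sc[rule_format, of "(x, vzero K)" c] that w by (simp add: orth_sum_simps)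
      show "cmod (L (x, vzero K)) \<le> C * vnorm H x" if "x \<in> vecs H" for x
        using bd[rule_format, of "(x, vzero K)"] that w vnorm_nonneg[OF H that]
        by (simp add: vnorm_orth_sum[OF H K] orth_sum_simps)
    qed auto
    obtain q where q: "q \<in> vecs K" "\<And>x. x \<in> vecs K \<Longrightarrow> L (vzero H, x) = ip K x q"
    proof (rule hilbert_riesz[OF K, of "\<lambda>x. L (vzero H, x)" C])
      show "L (vzero H, vadd K x y) = L (vzero H, x) + L (vzero H, y)" if "x \<in> vecs K" "y \<in> vecs K" for x y
        using add[rule_format, of "(vzero H, x)" "(vzero H, y)"] that z by (simp add: orth_sum_simps)
      show "L (vzero H, vscale K c x) = c * L (vzero H, x)" if "x \<in> vecs K" for c x
        using sc[rule_format, of "(vzero H, x)" c] that z by (simp add: orth_sum_simps)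
      show "cmod (L (vzero H, x)) \<le> C * vnorm K x" if "x \<in> vecs K" for x
        using bd[rule_format, of "(vzero H, x)"] that z vnorm_nonneg[OF K that]
        by (simp add: vnorm_orth_sum[OF H K] orth_sum_simps)
    qed auto
    show "\<exists>y\<in>vecs (orth_sum H K). \<forall>x\<in>vecs (orth_sum H K). L x = ip (orth_sum H K) x y"
    proof (intro bexI[of _ "(p, q)"] ballI)
      fix x assume "x \<in> vecs (orth_sum H K)"
      then obtain x1 x2 where x: "x = (x1, x2)" "x1 \<in> vecs H" "x2 \<in> vecs K" by (auto simp: orth_sum_simps)
      have "L x = L (x1, vzero K) + L (vzero H, x2)"
        using add[rule_format, of "(x1, vzero K)" "(vzero H, x2)"] x z w by (simp add: orth_sum_simps)
      then show "L x = ip (orth_sum H K) x (p, q)" using p q x by (simp add: orth_sum_simps)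
    qed (use p q in \<open>simp add: orth_sum_simps\<close>)
  qed
  have eq: "x = y" if xy: "x \<in> vecs (orth_sum H K)" "y \<in> vecs (orth_sum H K)"
    and eq: "\<And>v. v\<in>vecs (orth_sum H K) \<Longrightarrow> ip (orth_sum H K) v x = ip (orth_sum H K) v y" for x y
  proof -
    have m: "fst x \<in> vecs H" "fst y \<in> vecs H" "snd x \<in> vecs K" "snd y \<in> vecs K"
      using xy by (auto simp: orth_sum_simps)
    have "ip H v (fst x) = ip H v (fst y)" if "v \<in> vecs H" for v
      using eq[of "(v, vzero K)"] that m vzero_mem[OF K] by (simp add: orth_sum_simps ip_vzero_left[OF K])
    moreover have "ip K v (snd x) = ip K v (snd y)" if "v \<in> vecs K" for v
      using eq[of "(vzero H, v)"] that m vzero_mem[OF H] by (simp add: orth_sum_simps ip_vzero_left[OF H])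
    ultimately show "x = y"
      using hilbert_eqI[OF H m(1,2)] hilbert_eqI[OF K m(3,4)] by (simp add: prod_eq_iff)
  qed
  show "pre_hilbert (orth_sum H K)"
    unfolding pre_hilbert_def
  proof (intro conjI allI ballI impI)
    show "x = y" if "x \<in> vecs (orth_sum H K)" "y \<in> vecs (orth_sum H K)"
      "\<forall>v\<in>vecs (orth_sum H K). ip (orth_sum H K) v x = ip (orth_sum H K) v y" for x y
      using eq that by blast
    show "ip (orth_sum H K) y x = cnj (ip (orth_sum H K) x y)"
      if "x \<in> vecs (orth_sum H K)" "y \<in> vecs (orth_sum H K)" for x y
      using that hilbert_ip_sym[OF H, of "fst x" "fst y"] hilbert_ip_sym[OF K, of "snd x" "snd y"]
      by (auto simp: orth_sum_simps)
  qed (use H K in \<open>auto simp: orth_sum_simps hilbert_add hilbert_scale hilbert_ip_add hilbert_ip_scale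
      hilbert_ip_ge algebra_simps\<close>)
qed

section \<open>Weighted Hardy spaces are Hilbert spaces\<close>

lemma hardy_simps:
  "vadd (hardy \<alpha>) f g = (\<lambda>z. f z + g z)"
  "vscale (hardy \<alpha>) c f = (\<lambda>z. c * f z)"
  "ip (hardy \<alpha>) f g = (\<Sum>k. taylor_coeff f k * cnj (taylor_coeff g k) * (of_real (\<alpha> k))\<^sup>2)"
  by (simp_all add: hardy_def)

lemma hardy_summable:
  "f \<in> vecs (hardy \<alpha>) \<Longrightarrow> summable (\<lambda>k. (cmod (taylor_coeff f k))\<^sup>2 * (\<alpha> k)\<^sup>2)"
  by (simp add: mem_hardy)

lemma hardy_holomorphic: "f \<in> vecs (hardy \<alpha>) \<Longrightarrow> f holomorphic_on ball 0 1"
  by (simp add: mem_hardy)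

lemma hardy_coeff_add:
  "f \<in> vecs (hardy \<alpha>) \<Longrightarrow> g \<in> vecs (hardy \<beta>) \<Longrightarrow>
     taylor_coeff (\<lambda>z. f z + g z) = (\<lambda>k. taylor_coeff f k + taylor_coeff g k)"
  using taylor_coeff_add[of f 1 g] by (auto simp: mem_hardy)

lemma hardy_coeff_scale:
  "f \<in> vecs (hardy \<alpha>) \<Longrightarrow> taylor_coeff (\<lambda>z. c * f z) = (\<lambda>k. c * taylor_coeff f k)"
  using taylor_coeff_cmult[of f 1] by (auto simp: mem_hardy)

lemma hardy_ip_sums:
  assumes "f \<in> vecs (hardy \<alpha>)" "g \<in> vecs (hardy \<alpha>)"
  shows "(\<lambda>k. taylor_coeff f k * cnj (taylor_coeff g k) * (of_real (\<alpha> k))\<^sup>2) sums ip (hardy \<alpha>) f g"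
  unfolding hardy_simps
  by (intro summable_sums summable_hardy_ip hardy_summable assms)

lemma hardy_ip_self:
  assumes "f \<in> vecs (hardy \<alpha>)"
  shows "ip (hardy \<alpha>) f f = of_real (\<Sum>k. (cmod (taylor_coeff f k))\<^sup>2 * (\<alpha> k)\<^sup>2)"
proof -
  have "(\<lambda>k. of_real ((cmod (taylor_coeff f k))\<^sup>2 * (\<alpha> k)\<^sup>2) :: complex) sums
      of_real (\<Sum>k. (cmod (taylor_coeff f k))\<^sup>2 * (\<alpha> k)\<^sup>2)"
    by (intro sums_of_real summable_sums hardy_summable assms)
  moreover have "(\<lambda>k. of_real ((cmod (taylor_coeff f k))\<^sup>2 * (\<alpha> k)\<^sup>2) :: complex) =
      (\<lambda>k. taylor_coeff f k * cnj (taylor_coeff f k) * (of_real (\<alpha> k))\<^sup>2)"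
    by (rule ext) (simp only: of_real_mult complex_norm_square, simp)
  ultimately show ?thesis
    using sums_unique2[OF hardy_ip_sums[OF assms assms]] by simp
qed

lemma hardy_vnorm:
  assumes "f \<in> vecs (hardy \<alpha>)"
  shows "vnorm (hardy \<alpha>) f = sqrt (\<Sum>k. (cmod (taylor_coeff f k))\<^sup>2 * (\<alpha> k)\<^sup>2)"
  by (simp add: vnorm_def hardy_ip_self[OF assms])

definition disc_monom :: "nat \<Rightarrow> complex \<Rightarrow> complex" where
  "disc_monom n = series_fun (\<lambda>k. if k = n then 1 else 0)"

lemma
  assumes "weight_seq \<alpha>" "\<And>k. k \<ge> N \<Longrightarrow> c k = 0"
  shows finite_series_mem: "series_fun c \<in> vecs (hardy \<alpha>)"
    and finite_series_coeff: "taylor_coeff (series_fun c) = c"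
proof -
  have "summable (\<lambda>k. (cmod (c k))\<^sup>2 * (\<alpha> k)\<^sup>2)"
    using assms(2) by (intro summable_finite[of "{..<N}"]) (auto simp: not_less)
  from series_fun_mem[OF assms(1) this]
  show "series_fun c \<in> vecs (hardy \<alpha>)" "taylor_coeff (series_fun c) = c" by auto
qed

lemma
  assumes "weight_seq \<alpha>"
  shows disc_monom_mem: "disc_monom n \<in> vecs (hardy \<alpha>)"
    and disc_monom_coeff: "taylor_coeff (disc_monom n) = (\<lambda>k. if k = n then 1 else 0)"
  using finite_series_mem[OF assms, of "Suc n" "\<lambda>k. if k = n then 1 else 0"]
    finite_series_coeff[OF assms, of "Suc n" "\<lambda>k. if k = n then 1 else 0"]
  unfolding disc_monom_def by auto

lemma disc_monom_ip:
  assumes "weight_seq \<alpha>" "f \<in> vecs (hardy \<alpha>)"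
  shows "ip (hardy \<alpha>) (disc_monom n) f = cnj (taylor_coeff f n) * (of_real (\<alpha> n))\<^sup>2"
proof (rule sums_unique2[OF hardy_ip_sums[OF disc_monom_mem[OF assms(1)] assms(2)]])
  have "(\<lambda>k. if k = n then cnj (taylor_coeff f k) * (of_real (\<alpha> k))\<^sup>2 else 0) sums
      (cnj (taylor_coeff f n) * (of_real (\<alpha> n))\<^sup>2)"
    by (rule sums_single)
  then show "(\<lambda>k. taylor_coeff (disc_monom n) k * cnj (taylor_coeff f k) * (complex_of_real (\<alpha> k))\<^sup>2) sums
      (cnj (taylor_coeff f n) * (of_real (\<alpha> n))\<^sup>2)"
    unfolding disc_monom_coeff[OF assms(1)] by (simp add: if_distrib[of "\<lambda>x. x * _"] cong: if_cong)
qed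

lemma pre_hilbert_hardy:
  assumes a: "weight_seq \<alpha>"
  shows "pre_hilbert (hardy \<alpha>)"
  unfolding pre_hilbert_def
proof (intro conjI allI ballI impI)
  fix f g h assume f: "f \<in> vecs (hardy \<alpha>)" and g: "g \<in> vecs (hardy \<alpha>)" and h: "h \<in> vecs (hardy \<alpha>)"
  have fg: "vadd (hardy \<alpha>) f g \<in> vecs (hardy \<alpha>)"
    using hardy_add_mem[OF f g] by (simp add: hardy_simps)
  show "ip (hardy \<alpha>) (vadd (hardy \<alpha>) f g) h = ip (hardy \<alpha>) f h + ip (hardy \<alpha>) g h"
  proof (rule sums_unique2[OF hardy_ip_sums[OF fg h]])
    show "(\<lambda>k. taylor_coeff (vadd (hardy \<alpha>) f g) k * cnj (taylor_coeff h k) * (complex_of_real (\<alpha> k))\<^sup>2) sums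
        (ip (hardy \<alpha>) f h + ip (hardy \<alpha>) g h)"
      using sums_add[OF hardy_ip_sums[OF f h] hardy_ip_sums[OF g h]]
      unfolding hardy_simps(1) hardy_coeff_add[OF f g] by (simp only: distrib_right)
  qed
next
  fix f h c assume f: "f \<in> vecs (hardy \<alpha>)" and h: "h \<in> vecs (hardy \<alpha>)"
  have cf: "vscale (hardy \<alpha>) c f \<in> vecs (hardy \<alpha>)"
    using hardy_scale_mem[OF f] by (simp add: hardy_simps)
  show "ip (hardy \<alpha>) (vscale (hardy \<alpha>) c f) h = c * ip (hardy \<alpha>) f h"
  proof (rule sums_unique2[OF hardy_ip_sums[OF cf h]])
    show "(\<lambda>k. taylor_coeff (vscale (hardy \<alpha>) c f) k * cnj (taylor_coeff h k) * (complex_of_real (\<alpha> k))\<^sup>2) sums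
        (c * ip (hardy \<alpha>) f h)"
      using sums_mult[OF hardy_ip_sums[OF f h], of c]
      unfolding hardy_simps(2) hardy_coeff_scale[OF f] by (simp only: mult.assoc)
  qed
next
  fix f h assume f: "f \<in> vecs (hardy \<alpha>)" and h: "h \<in> vecs (hardy \<alpha>)"
  show "ip (hardy \<alpha>) h f = cnj (ip (hardy \<alpha>) f h)"
  proof (rule sums_unique2[OF hardy_ip_sums[OF h f]])
    have "(\<lambda>k. cnj (taylor_coeff f k * cnj (taylor_coeff h k) * (complex_of_real (\<alpha> k))\<^sup>2)) sums
        cnj (ip (hardy \<alpha>) f h)"
      using hardy_ip_sums[OF f h] by (simp only: sums_cnj)
    then show "(\<lambda>k. taylor_coeff h k * cnj (taylor_coeff f k) * (complex_of_real (\<alpha> k))\<^sup>2) sums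
        cnj (ip (hardy \<alpha>) f h)"
      by (simp add: mult_ac)
  qed
next
  fix f assume f: "f \<in> vecs (hardy \<alpha>)"
  show "0 \<le> Re (ip (hardy \<alpha>) f f)"
    unfolding hardy_ip_self[OF f] by (simp add: suminf_nonneg hardy_summable[OF f])
next
  fix f g assume f: "f \<in> vecs (hardy \<alpha>)" and g: "g \<in> vecs (hardy \<alpha>)"
    and eq: "\<forall>v\<in>vecs (hardy \<alpha>). ip (hardy \<alpha>) v f = ip (hardy \<alpha>) v g"
  show "f = g"
  proof (rule hardy_eqI[OF f g])
    fix k
    have "\<alpha> k \<noteq> 0" using weight_seq_pos[OF a, of k] by simp
    then show "taylor_coeff f k = taylor_coeff g k"
      using bspec[OF eq disc_monom_mem[OF a, of k]]
      by (simp add: disc_monom_ip[OF a f] disc_monom_ip[OF a g])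
  qed
qed (use hardy_add_mem hardy_scale_mem in \<open>simp_all add: hardy_simps\<close>)

lemma suminf_tail_tendsto:
  fixes a :: "nat \<Rightarrow> real"
  assumes "summable a"
  shows "(\<lambda>N. \<Sum>k. if k < N then 0 else a k) \<longlonglongrightarrow> 0"
proof -
  have "(\<Sum>k. if k < N then 0 else a k) = (\<Sum>k. a k) - (\<Sum>k<N. a k)" for N
  proof -
    have "(\<lambda>k. if k \<in> {..<N} then a k else 0) sums (\<Sum>k<N. a k)"
      by (rule sums_If_finite_set) simp
    then have "(\<lambda>k. a k - (if k \<in> {..<N} then a k else 0)) sums ((\<Sum>k. a k) - (\<Sum>k<N. a k))"
      by (intro sums_diff summable_sums assms)
    moreover have "(\<lambda>k. a k - (if k \<in> {..<N} then a k else 0)) = (\<lambda>k. if k < N then 0 else a k)"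
      by auto
    ultimately show ?thesis by (simp add: sums_iff)
  qed
  moreover have "(\<lambda>N. (\<Sum>k. a k) - (\<Sum>k<N. a k)) \<longlonglongrightarrow> (\<Sum>k. a k) - (\<Sum>k. a k)"
    by (intro tendsto_diff tendsto_const summable_LIMSEQ assms)
  ultimately show ?thesis by simp
qed

text \<open>The values of L on monomials prescribe the coefficients of the representing function.
  Testing L on truncations of that candidate shows that it lies in the space, and boundedness of L
  makes the tails of any x negligible.\<close>

lemma riesz_hardy:
  assumes a: "weight_seq \<alpha>"
  shows "riesz_property (hardy \<alpha>)"
  unfolding riesz_property_def
proof (intro allI impI)
  fix L :: "(complex \<Rightarrow> complex) \<Rightarrow> complex" and C
  assume add: "\<forall>x\<in>vecs (hardy \<alpha>). \<forall>y\<in>vecs (hardy \<alpha>). L (vadd (hardy \<alpha>) x y) = L x + L y"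
    and sc: "\<forall>c. \<forall>x\<in>vecs (hardy \<alpha>). L (vscale (hardy \<alpha>) c x) = c * L x"
    and bd: "\<forall>x\<in>vecs (hardy \<alpha>). cmod (L x) \<le> C * vnorm (hardy \<alpha>) x"
  note pos = weight_seq_pos[OF a]
  define tr where "tr c N = series_fun (\<lambda>k. if k < N then c k else 0)" for c :: "nat \<Rightarrow> complex" and N
  have tr: "tr c N \<in> vecs (hardy \<alpha>)" "taylor_coeff (tr c N) = (\<lambda>k. if k < N then c k else 0)" for c N
    unfolding tr_def using finite_series_mem[OF a, of N] finite_series_coeff[OF a, of N] by simp_all
  have Ltr: "L (tr c N) = (\<Sum>k<N. c k * L (disc_monom k))" for c N
  proof (induction N)
    case 0
    \<comment> \<open>The empty truncation is the zero function; writing it as 0 times itself lets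
      homogeneity give the value 0 of L.\<close>
    have E: "tr c 0 = vscale (hardy \<alpha>) 0 (tr c 0)"
    proof (rule hardy_eqI[OF tr(1)])
      show "vscale (hardy \<alpha>) 0 (tr c 0) \<in> vecs (hardy \<alpha>)"
        using hardy_scale_mem[OF tr(1), of 0 c 0] by (simp only: hardy_simps)
      show "taylor_coeff (tr c 0) k = taylor_coeff (vscale (hardy \<alpha>) 0 (tr c 0)) k" for k
        by (simp only: hardy_simps hardy_coeff_scale[OF tr(1)] tr(2)) simp
    qed
    have "L (vscale (hardy \<alpha>) 0 (tr c 0)) = 0" using sc tr(1)[of c 0] by simp
    then have "L (tr c 0) = 0" by (rule trans[OF arg_cong[OF E]])
    then show ?case by simp
  next
    case (Suc N)
    let ?e = "vscale (hardy \<alpha>) (c N) (disc_monom N)"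
    have e: "?e \<in> vecs (hardy \<alpha>)"
      using hardy_scale_mem[OF disc_monom_mem[OF a]] by (simp add: hardy_simps)
    have ec: "taylor_coeff ?e = (\<lambda>k. if k = N then c N else 0)"
      by (auto simp: hardy_simps hardy_coeff_scale[OF disc_monom_mem[OF a]] disc_monom_coeff[OF a])
    have "tr c (Suc N) = vadd (hardy \<alpha>) (tr c N) ?e"
    proof (rule hardy_eqI[OF tr(1)])
      show "vadd (hardy \<alpha>) (tr c N) ?e \<in> vecs (hardy \<alpha>)"
        using hardy_add_mem[OF tr(1) e] by (simp add: hardy_simps)
      show "taylor_coeff (tr c (Suc N)) k = taylor_coeff (vadd (hardy \<alpha>) (tr c N) ?e) k" for k
        unfolding hardy_simps(1) hardy_coeff_add[OF tr(1) e] ec tr(2) by auto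
    qed
    then show ?case using add tr(1) e sc disc_monom_mem[OF a] Suc by simp
  qed
  \<comment> \<open>The coefficients forced by \<open>disc_monom_ip\<close>: L of a monomial has to
    be \<open>cnj (y k)\<close> times the squared weight.\<close>
  define y where "y k = cnj (L (disc_monom k)) / (of_real (\<alpha> k))\<^sup>2" for k
  have Le: "L (disc_monom k) = cnj (y k) * (of_real (\<alpha> k))\<^sup>2" for k
    using pos[of k] by (simp add: y_def)
  define s where "s N = (\<Sum>k<N. (cmod (y k))\<^sup>2 * (\<alpha> k)\<^sup>2)" for N
  have s: "s N \<le> C\<^sup>2" for N
  proof -
    have s0: "s N \<ge> 0" by (simp add: s_def sum_nonneg)
    \<comment> \<open>On the truncation of y, L takes the squared norm of that truncation as its
      value, so boundedness becomes s(N) \<le> C sqrt(s(N)).\<close>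
    have "L (tr y N) = of_real (s N)"
      unfolding Ltr s_def Le of_real_sum of_real_mult complex_norm_square
      by (simp add: mult.assoc)
    moreover have "(\<Sum>k. (cmod (taylor_coeff (tr y N) k))\<^sup>2 * (\<alpha> k)\<^sup>2) = s N"
      unfolding s_def tr(2) by (subst suminf_finite[of "{..<N}"]) auto
    ultimately have "s N \<le> C * sqrt (s N)"
      using bspec[OF bd tr(1)[of y N]] s0 by (simp add: hardy_vnorm[OF tr(1)])
    then have "sqrt (s N) * sqrt (s N) \<le> C * sqrt (s N)" using s0 by simp
    then have "sqrt (s N) \<le> \<bar>C\<bar>"
      using mult_right_le_imp_le[of "sqrt (s N)" "sqrt (s N)" C] s0 by (cases "s N = 0") auto
    from power_mono[OF this, of 2] show ?thesis using s0 by simp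
  qed
  have ysum: "summable (\<lambda>k. (cmod (y k))\<^sup>2 * (\<alpha> k)\<^sup>2)"
    by (rule summableI_nonneg_bounded[of _ "C\<^sup>2"]) (use s in \<open>auto simp: s_def\<close>)
  note Y = series_fun_mem[OF a ysum]
  show "\<exists>y\<in>vecs (hardy \<alpha>). \<forall>x\<in>vecs (hardy \<alpha>). L x = ip (hardy \<alpha>) x y"
  proof (intro bexI[OF _ Y(1)] ballI)
    fix x assume x: "x \<in> vecs (hardy \<alpha>)"
    define t where "t N = vadd (hardy \<alpha>) x (vscale (hardy \<alpha>) (-1) (tr (taylor_coeff x) N))" for N
    have m: "vscale (hardy \<alpha>) (-1) (tr (taylor_coeff x) N) \<in> vecs (hardy \<alpha>)" for N
      using hardy_scale_mem[OF tr(1), of "-1"] by (simp add: hardy_simps)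
    have t: "t N \<in> vecs (hardy \<alpha>)" for N
      using hardy_add_mem[OF x m] by (simp add: t_def hardy_simps)
    have tc: "taylor_coeff (t N) = (\<lambda>k. if k < N then 0 else taylor_coeff x k)" for N
      unfolding t_def hardy_simps(1) hardy_coeff_add[OF x m] unfolding hardy_simps(2) hardy_coeff_scale[OF tr(1)] tr(2)
      by auto
    have "vnorm (hardy \<alpha>) (t N) = sqrt (\<Sum>k. if k < N then 0 else (cmod (taylor_coeff x k))\<^sup>2 * (\<alpha> k)\<^sup>2)" for N
      unfolding hardy_vnorm[OF t] tc by (intro arg_cong[of _ _ sqrt] suminf_cong) auto
    moreover have "(\<lambda>N. C * sqrt (\<Sum>k. if k < N then 0 else (cmod (taylor_coeff x k))\<^sup>2 * (\<alpha> k)\<^sup>2)) \<longlonglongrightarrow> C * sqrt 0"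
      by (intro tendsto_intros suminf_tail_tendsto hardy_summable x)
    ultimately have "(\<lambda>N. C * vnorm (hardy \<alpha>) (t N)) \<longlonglongrightarrow> 0" by simp
    then have "(\<lambda>N. L (t N)) \<longlonglongrightarrow> 0"
      by (rule Lim_null_comparison[rotated]) (use bd t in auto)
    moreover have "L (t N) = L x - (\<Sum>k<N. taylor_coeff x k * L (disc_monom k))" for N
      using add x m sc tr(1) by (simp add: t_def Ltr)
    ultimately have "(\<lambda>N. L x - (\<Sum>k<N. taylor_coeff x k * L (disc_monom k))) \<longlonglongrightarrow> 0" by simp
    then have "(\<lambda>N. \<Sum>k<N. taylor_coeff x k * L (disc_monom k)) \<longlonglongrightarrow> L x"
      using tendsto_diff[OF tendsto_const[of "L x"], of _ 0] by fastforce
    then have "(\<lambda>k. taylor_coeff x k * cnj (y k) * (of_real (\<alpha> k))\<^sup>2) sums L x"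
      unfolding sums_def Le by (simp only: mult.assoc)
    then show "L x = ip (hardy \<alpha>) x (series_fun y)"
      using hardy_ip_sums[OF x Y(1)] unfolding Y(2) using sums_unique2 by blast
  qed
qed

lemma hilbert_like_hardy: "weight_seq \<alpha> \<Longrightarrow> hilbert_like (hardy \<alpha>)"
  by (simp add: hilbert_like_def pre_hilbert_hardy riesz_hardy)

lemma
  assumes "\<And>k. \<beta> k \<le> D * \<alpha> k" "weight_seq \<alpha>" "weight_seq \<beta>" "f \<in> vecs (hardy \<alpha>)"
  shows hardy_embed: "f \<in> vecs (hardy \<beta>)"
    and hardy_embed_norm: "vnorm (hardy \<beta>) f \<le> D * vnorm (hardy \<alpha>) f"
proof -
  have D: "D > 0" using assms(1)[of 0] weight_seq_pos[OF assms(2), of 0] weight_seq_pos[OF assms(3), of 0]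
    by (smt (verit) mult_nonpos_nonneg)
  have le: "(cmod (taylor_coeff f k))\<^sup>2 * (\<beta> k)\<^sup>2 \<le> D\<^sup>2 * ((cmod (taylor_coeff f k))\<^sup>2 * (\<alpha> k)\<^sup>2)" for k
  proof -
    have "(\<beta> k)\<^sup>2 \<le> (D * \<alpha> k)\<^sup>2"
      using assms(1)[of k] weight_seq_pos[OF assms(3), of k] by (intro power_mono) auto
    then have "(cmod (taylor_coeff f k))\<^sup>2 * (\<beta> k)\<^sup>2 \<le> (cmod (taylor_coeff f k))\<^sup>2 * (D * \<alpha> k)\<^sup>2"
      by (intro mult_left_mono) auto
    then show ?thesis by (simp add: power_mult_distrib mult_ac)
  qed
  note sf = hardy_summable[OF assms(4)]
  have sg: "summable (\<lambda>k. (cmod (taylor_coeff f k))\<^sup>2 * (\<beta> k)\<^sup>2)"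
    by (rule summable_comparison_test'[OF summable_mult[OF sf, of "D\<^sup>2"], of 0]) (use le in auto)
  then show mem: "f \<in> vecs (hardy \<beta>)" using assms(4) by (simp add: mem_hardy)
  have "(\<Sum>k. (cmod (taylor_coeff f k))\<^sup>2 * (\<beta> k)\<^sup>2) \<le> D\<^sup>2 * (\<Sum>k. (cmod (taylor_coeff f k))\<^sup>2 * (\<alpha> k)\<^sup>2)"
    unfolding suminf_mult[OF sf, symmetric] by (intro suminf_le le sg summable_mult sf)
  from real_sqrt_le_mono[OF this] show "vnorm (hardy \<beta>) f \<le> D * vnorm (hardy \<alpha>) f"
    unfolding hardy_vnorm[OF mem] hardy_vnorm[OF assms(4)] using D by (simp add: real_sqrt_mult)
qed

section \<open>Multipliers analytic on the closed disc\<close>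

text \<open>Compactness gives a uniform margin e around the closed disc, and radial projection to
  the unit circle shows that this margin contains the whole annulus up to radius 1 + e.\<close>

lemma analytic_on_cball_extend:
  assumes "f analytic_on cball (0::complex) 1"
  obtains r where "r > 1" "f holomorphic_on ball 0 r"
proof -
  obtain S where S: "open S" "cball 0 1 \<subseteq> S" "f holomorphic_on S"
    using assms by (auto simp: analytic_on_holomorphic)
  obtain e where e: "e > 0" "(\<Union>x\<in>cball 0 1. ball x e) \<subseteq> S"
    using compact_subset_open_imp_ball_epsilon_subset[OF compact_cball S(1,2)] by blast
  have "ball 0 (1 + e) \<subseteq> S"
  proof
    fix z :: complex assume z: "z \<in> ball 0 (1 + e)"
    show "z \<in> S"
    proof (cases "cmod z \<le> 1")
      case False
      let ?x = "z / of_real (cmod z)"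
      have "z \<noteq> 0" using False by auto
      then have "?x - z = of_real (1 - cmod z) * ?x" by (simp add: left_diff_distrib diff_divide_distrib)
      then have "cmod (?x - z) = \<bar>1 - cmod z\<bar> * cmod ?x" by (metis norm_mult norm_of_real)
      moreover have x: "cmod ?x = 1" using False by (auto simp: norm_divide)
      ultimately have "z \<in> ball ?x e" using z False by (simp add: dist_norm)
      moreover have "?x \<in> cball 0 1" using x by simp
      ultimately show ?thesis using e(2) by blast
    qed (use S in auto)
  qed
  then show ?thesis using that[of "1 + e"] e(1) holomorphic_on_subset[OF S(3)] by auto
qed

lemma taylor_coeff_abs_summable:
  assumes "k holomorphic_on ball 0 r" "0 \<le> \<rho>" "\<rho> < r"
  shows "summable (\<lambda>i. cmod (taylor_coeff k i) * \<rho> ^ i)"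
proof -
  define s where "s = (\<rho> + r) / 2"
  have s: "\<rho> < s" "s < r" using assms by (auto simp: s_def)
  have "summable (\<lambda>i. taylor_coeff k i * of_real s ^ i)"
    using taylor_sums[OF assms(1), of "of_real s"] s assms by (auto simp: sums_iff)
  then have "summable (\<lambda>i. norm (taylor_coeff k i * of_real \<rho> ^ i))"
    by (rule powser_insidea) (use s assms in auto)
  then show ?thesis using assms by (simp add: norm_mult norm_power)
qed

text \<open>Once \<rho>^i is moved from the weight to the multiplier, the product is dominated by
  the convolution of a summable sequence \<open>w\<close> with a square summable one
  \<open>b\<close>. The constant depends only on the weight and \<rho>, so the bound applies
  uniformly to the powers z^i and to the tails of a Taylor series.\<close>

lemma hardy_mult_bound:
  assumes a: "weight_seq \<alpha>" and "\<rho> > 1"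
  obtains C where "C > 0"
    "\<And>k f. k holomorphic_on ball 0 1 \<Longrightarrow> summable (\<lambda>i. cmod (taylor_coeff k i) * \<rho> ^ i) \<Longrightarrow>
       f \<in> vecs (hardy \<alpha>) \<Longrightarrow> mult_op k f \<in> vecs (hardy \<alpha>) \<and>
       vnorm (hardy \<alpha>) (mult_op k f) \<le> C * (\<Sum>i. cmod (taylor_coeff k i) * \<rho> ^ i) * vnorm (hardy \<alpha>) f"
proof -
  obtain C where C: "C > 0" "\<And>m j. \<alpha> (m + j) \<le> C * \<rho> ^ j * \<alpha> m"
    using weight_seq_upper[OF assms] by blast
  note pos = weight_seq_pos[OF a]
  show ?thesis
  proof (rule that[OF C(1)])
    fix k f assume k: "k holomorphic_on ball 0 1" "summable (\<lambda>i. cmod (taylor_coeff k i) * \<rho> ^ i)"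
      and f: "f \<in> vecs (hardy \<alpha>)"
    define w where "w i = cmod (taylor_coeff k i) * \<rho> ^ i" for i
    define b where "b j = cmod (taylor_coeff f j) * \<alpha> j" for j
    have w0: "w i \<ge> 0" for i using \<open>\<rho> > 1\<close> by (simp add: w_def)
    have sw: "summable w" using k(2) by (simp add: w_def[abs_def])
    define W where "W = suminf w"
    have W0: "W \<ge> 0" unfolding W_def by (intro suminf_nonneg sw w0)
    have bsq: "(b j)\<^sup>2 = (cmod (taylor_coeff f j))\<^sup>2 * (\<alpha> j)\<^sup>2" for j by (simp add: b_def power_mult_distrib)
    have sb: "summable (\<lambda>j. (b j)\<^sup>2)" using hardy_summable[OF f] by (simp add: bsq)
    have hol: "mult_op k f holomorphic_on ball 0 1"
      unfolding mult_op_def using k(1) hardy_holomorphic[OF f] by (intro holomorphic_intros)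
    have tc: "taylor_coeff (mult_op k f) m = (\<Sum>i\<le>m. taylor_coeff k i * taylor_coeff f (m - i))" for m
      unfolding mult_op_def using taylor_coeff_mult[OF k(1) hardy_holomorphic[OF f]] by (simp add: atMost_atLeast0)
    have le: "(cmod (taylor_coeff (mult_op k f) m))\<^sup>2 * (\<alpha> m)\<^sup>2 \<le> C\<^sup>2 * W * (\<Sum>i\<le>m. w i * (b (m - i))\<^sup>2)" for m
    proof -
      have "cmod (taylor_coeff (mult_op k f) m) * \<alpha> m \<le> (\<Sum>i\<le>m. cmod (taylor_coeff k i * taylor_coeff f (m - i))) * \<alpha> m"
        unfolding tc using pos[of m] by (intro mult_right_mono norm_sum) auto
      also have "\<dots> = (\<Sum>i\<le>m. cmod (taylor_coeff k i) * cmod (taylor_coeff f (m - i)) * \<alpha> m)"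
        by (simp add: sum_distrib_right norm_mult)
      also have "\<dots> \<le> (\<Sum>i\<le>m. C * (w i * b (m - i)))"
      proof (intro sum_mono)
        fix i assume "i \<in> {..m}"
        then have "\<alpha> m \<le> C * \<rho> ^ i * \<alpha> (m - i)" using C(2)[of "m - i" i] by simp
        then have "cmod (taylor_coeff k i) * cmod (taylor_coeff f (m - i)) * \<alpha> m \<le>
            cmod (taylor_coeff k i) * cmod (taylor_coeff f (m - i)) * (C * \<rho> ^ i * \<alpha> (m - i))"
          by (intro mult_left_mono) auto
        then show "cmod (taylor_coeff k i) * cmod (taylor_coeff f (m - i)) * \<alpha> m \<le> C * (w i * b (m - i))"
          by (simp add: w_def b_def mult_ac)
      qed
      \<comment> \<open>Splitting \<open>w\<close> into two square roots lets Cauchy-Schwarz produce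
        one factor bounded by \<open>W\<close> and one that is a term of a Cauchy product.\<close>
      also have "\<dots> = C * (\<Sum>i\<le>m. sqrt (w i) * (sqrt (w i) * b (m - i)))"
        using w0 by (simp add: sum_distrib_left mult.assoc[symmetric])
      finally have "(cmod (taylor_coeff (mult_op k f) m) * \<alpha> m)\<^sup>2 \<le> (C * (\<Sum>i\<le>m. sqrt (w i) * (sqrt (w i) * b (m - i))))\<^sup>2"
        using pos[of m] by (intro power_mono) auto
      also have "\<dots> = C\<^sup>2 * (\<Sum>i\<le>m. sqrt (w i) * (sqrt (w i) * b (m - i)))\<^sup>2"
        by (simp add: power_mult_distrib)
      also have "\<dots> \<le> C\<^sup>2 * ((\<Sum>i\<le>m. (sqrt (w i))\<^sup>2) * (\<Sum>i\<le>m. (sqrt (w i) * b (m - i))\<^sup>2))"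
        by (intro mult_left_mono Cauchy_Schwarz_ineq_sum) auto
      also have "\<dots> = C\<^sup>2 * ((\<Sum>i\<le>m. w i) * (\<Sum>i\<le>m. w i * (b (m - i))\<^sup>2))"
        using w0 by (simp add: power_mult_distrib)
      also have "\<dots> \<le> C\<^sup>2 * (W * (\<Sum>i\<le>m. w i * (b (m - i))\<^sup>2))"
        unfolding W_def using w0 sw by (intro mult_left_mono mult_right_mono sum_le_suminf sum_nonneg) auto
      finally show ?thesis by (simp add: power_mult_distrib mult.assoc)
    qed
    have cp: "(\<lambda>m. \<Sum>i\<le>m. w i * (b (m - i))\<^sup>2) sums (W * (\<Sum>j. (b j)\<^sup>2))"
      unfolding W_def using w0 sw sb by (intro Cauchy_product_sums) auto
    have cs: "summable (\<lambda>m. C\<^sup>2 * W * (\<Sum>i\<le>m. w i * (b (m - i))\<^sup>2))"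
      by (intro summable_mult sums_summable[OF cp])
    have s: "summable (\<lambda>m. (cmod (taylor_coeff (mult_op k f) m))\<^sup>2 * (\<alpha> m)\<^sup>2)"
      by (rule summable_comparison_test'[OF cs, of 0]) (use le in auto)
    have mem: "mult_op k f \<in> vecs (hardy \<alpha>)"
      using s hol f by (simp add: mem_hardy mult_op_def)
    have "(\<Sum>m. (cmod (taylor_coeff (mult_op k f) m))\<^sup>2 * (\<alpha> m)\<^sup>2) \<le> C\<^sup>2 * W * (W * (\<Sum>j. (b j)\<^sup>2))"
      using suminf_le[OF le s cs] suminf_mult[OF sums_summable[OF cp], of "C\<^sup>2 * W"] cp
      by (simp add: sums_iff)
    then have "sqrt (\<Sum>m. (cmod (taylor_coeff (mult_op k f) m))\<^sup>2 * (\<alpha> m)\<^sup>2) \<le> sqrt ((C * W)\<^sup>2 * (\<Sum>j. (b j)\<^sup>2))"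
      by (intro real_sqrt_le_mono) (simp add: power2_eq_square mult_ac)
    also have "\<dots> = C * W * sqrt (\<Sum>j. (b j)\<^sup>2)"
      using C(1) W0 by (simp add: real_sqrt_mult)
    finally have "vnorm (hardy \<alpha>) (mult_op k f) \<le> C * W * vnorm (hardy \<alpha>) f"
      unfolding hardy_vnorm[OF mem] hardy_vnorm[OF f] bsq .
    with mem show "mult_op k f \<in> vecs (hardy \<alpha>) \<and>
       vnorm (hardy \<alpha>) (mult_op k f) \<le> C * (\<Sum>i. cmod (taylor_coeff k i) * \<rho> ^ i) * vnorm (hardy \<alpha>) f"
      by (simp add: W_def w_def[abs_def])
  qed
qed

lemma hardy_mult_bounded:
  assumes a: "weight_seq \<alpha>" and k: "k analytic_on cball 0 1"
  obtains C where "C \<ge> 0" "\<And>f. f \<in> vecs (hardy \<alpha>) \<Longrightarrow> mult_op k f \<in> vecs (hardy \<alpha>) \<and>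
       vnorm (hardy \<alpha>) (mult_op k f) \<le> C * vnorm (hardy \<alpha>) f"
proof -
  obtain r where r: "r > 1" "k holomorphic_on ball 0 r" using analytic_on_cball_extend[OF k] by blast
  define \<rho> where "\<rho> = (1 + r) / 2"
  have \<rho>: "\<rho> > 1" "\<rho> < r" using r by (auto simp: \<rho>_def)
  have s: "summable (\<lambda>i. cmod (taylor_coeff k i) * \<rho> ^ i)"
    by (rule taylor_coeff_abs_summable[OF r(2)]) (use \<rho> in auto)
  have h: "k holomorphic_on ball 0 1" using r by (auto intro: holomorphic_on_subset)
  obtain C where C: "C > 0"
    "\<And>k f. k holomorphic_on ball 0 1 \<Longrightarrow> summable (\<lambda>i. cmod (taylor_coeff k i) * \<rho> ^ i) \<Longrightarrow>
       f \<in> vecs (hardy \<alpha>) \<Longrightarrow> mult_op k f \<in> vecs (hardy \<alpha>) \<and>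
       vnorm (hardy \<alpha>) (mult_op k f) \<le> C * (\<Sum>i. cmod (taylor_coeff k i) * \<rho> ^ i) * vnorm (hardy \<alpha>) f"
    using hardy_mult_bound[OF a \<rho>(1)] by blast
  show ?thesis
  proof (rule that[of "C * (\<Sum>i. cmod (taylor_coeff k i) * \<rho> ^ i)"])
    show "0 \<le> C * (\<Sum>i. cmod (taylor_coeff k i) * \<rho> ^ i)"
      using C(1) s \<rho> by (intro mult_nonneg_nonneg suminf_nonneg) auto
  qed (rule C(2)[OF h s])
qed

lemma bounded_op_mult:
  assumes a: "weight_seq \<alpha>" and b: "weight_seq \<beta>" and D: "\<And>k. \<beta> k \<le> D * \<alpha> k"
    and k: "k analytic_on cball 0 1"
  shows "bounded_op (hardy \<alpha>) (hardy \<beta>) (mult_op k)"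
proof -
  obtain C where C: "C \<ge> 0" "\<And>f. f \<in> vecs (hardy \<alpha>) \<Longrightarrow> mult_op k f \<in> vecs (hardy \<alpha>) \<and>
       vnorm (hardy \<alpha>) (mult_op k f) \<le> C * vnorm (hardy \<alpha>) f"
    using hardy_mult_bounded[OF a k] by blast
  have D0: "D \<ge> 0" using D[of 0] weight_seq_pos[OF a, of 0] weight_seq_pos[OF b, of 0]
    by (smt (verit) mult_nonpos_nonneg)
  have "vnorm (hardy \<beta>) (mult_op k f) \<le> (D * C) * vnorm (hardy \<alpha>) f" if f: "f \<in> vecs (hardy \<alpha>)" for f
  proof -
    have "vnorm (hardy \<beta>) (mult_op k f) \<le> D * vnorm (hardy \<alpha>) (mult_op k f)"
      using hardy_embed_norm[OF D a b] C(2)[OF f] by blast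
    also have "\<dots> \<le> D * (C * vnorm (hardy \<alpha>) f)"
      using C(2)[OF f] D0 by (intro mult_left_mono) auto
    finally show ?thesis by (simp add: mult.assoc)
  qed
  then show ?thesis
    unfolding bounded_op_def
    using C(2) hardy_embed[OF D a b]
    by (intro conjI ballI allI exI[of _ "D * C"]) (auto simp: hardy_simps mult_op_def algebra_simps)
qed

text \<open>A weak form of the fact that multiplication by z has spectral radius at most 1. It makes
  the expansion of the resolvent in powers of 1/l converge on circles of radius above 1.\<close>

lemma ip_shift_bound:
  assumes a: "weight_seq \<alpha>" and "\<rho> > 1" and f: "f \<in> vecs (hardy \<alpha>)" and x: "x \<in> vecs (hardy \<alpha>)"
  obtains K where "\<And>i. cmod (ip (hardy \<alpha>) x (mult_op (\<lambda>z. z ^ i) f)) \<le> K * \<rho> ^ i"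
proof -
  obtain C where C: "C > 0"
    "\<And>k f. k holomorphic_on ball 0 1 \<Longrightarrow> summable (\<lambda>i. cmod (taylor_coeff k i) * \<rho> ^ i) \<Longrightarrow>
       f \<in> vecs (hardy \<alpha>) \<Longrightarrow> mult_op k f \<in> vecs (hardy \<alpha>) \<and>
       vnorm (hardy \<alpha>) (mult_op k f) \<le> C * (\<Sum>i. cmod (taylor_coeff k i) * \<rho> ^ i) * vnorm (hardy \<alpha>) f"
    using hardy_mult_bound[OF assms(1,2)] by blast
  note H = hilbert_like_hardy[OF a]
  show ?thesis
  proof (rule that)
    fix i
    let ?g = "mult_op (\<lambda>z. z ^ i) f"
    have tc: "taylor_coeff (\<lambda>z. z ^ i) j = (if j = i then 1 else 0)" for j
      using taylor_coeff_eq_fps_nth[OF has_fps_expansion_fps_X_power[of i]] by (auto simp: fps_X_power_iff)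
    have "(\<lambda>j. if j = i then \<rho> ^ j else 0) sums \<rho> ^ i" by (rule sums_single)
    moreover have "(\<lambda>j. cmod (taylor_coeff (\<lambda>z. z ^ i) j) * \<rho> ^ j) = (\<lambda>j. if j = i then \<rho> ^ j else 0)"
      by (auto simp: tc)
    ultimately have s: "(\<lambda>j. cmod (taylor_coeff (\<lambda>z. z ^ i) j) * \<rho> ^ j) sums \<rho> ^ i" by simp
    have hol: "(\<lambda>z. z ^ i) holomorphic_on ball (0::complex) 1" by (intro holomorphic_intros)
    have g: "?g \<in> vecs (hardy \<alpha>)" "vnorm (hardy \<alpha>) ?g \<le> C * \<rho> ^ i * vnorm (hardy \<alpha>) f"
      using C(2)[OF hol sums_summable[OF s] f] sums_unique[OF s] by auto
    have "cmod (ip (hardy \<alpha>) x ?g) \<le> vnorm (hardy \<alpha>) x * vnorm (hardy \<alpha>) ?g"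
      by (rule hilbert_cauchy_schwarz[OF H x g(1)])
    also have "\<dots> \<le> vnorm (hardy \<alpha>) x * (C * \<rho> ^ i * vnorm (hardy \<alpha>) f)"
      using g(2) vnorm_nonneg[OF H x] by (intro mult_left_mono)
    finally show "cmod (ip (hardy \<alpha>) x ?g) \<le> (vnorm (hardy \<alpha>) x * C * vnorm (hardy \<alpha>) f) * \<rho> ^ i"
      by (simp add: mult_ac)
  qed
qed

text \<open>Removing the first N Taylor terms of k leaves a multiplier whose weighted coefficient
  sum is the tail of a convergent series, so it tends to 0 in operator norm. The conjugate comes
  from the second slot of the inner product.\<close>

lemma ip_mult_sums:
  assumes a: "weight_seq \<alpha>" and k: "k holomorphic_on ball 0 r" "r > 1"
    and f: "f \<in> vecs (hardy \<alpha>)" and x: "x \<in> vecs (hardy \<alpha>)"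
  shows "(\<lambda>i. cnj (taylor_coeff k i) * ip (hardy \<alpha>) x (mult_op (\<lambda>z. z ^ i) f)) sums
           ip (hardy \<alpha>) x (mult_op k f)"
proof -
  define \<rho> where "\<rho> = (1 + r) / 2"
  have \<rho>: "\<rho> > 1" "\<rho> < r" using k by (auto simp: \<rho>_def)
  obtain C where C: "C > 0"
    "\<And>k f. k holomorphic_on ball 0 1 \<Longrightarrow> summable (\<lambda>i. cmod (taylor_coeff k i) * \<rho> ^ i) \<Longrightarrow>
       f \<in> vecs (hardy \<alpha>) \<Longrightarrow> mult_op k f \<in> vecs (hardy \<alpha>) \<and>
       vnorm (hardy \<alpha>) (mult_op k f) \<le> C * (\<Sum>i. cmod (taylor_coeff k i) * \<rho> ^ i) * vnorm (hardy \<alpha>) f"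
    using hardy_mult_bound[OF a \<rho>(1)] by blast
  note H = hilbert_like_hardy[OF a]
  have sk: "summable (\<lambda>i. cmod (taylor_coeff k i) * \<rho> ^ i)"
    by (rule taylor_coeff_abs_summable[OF k(1)]) (use \<rho> in auto)
  define p where "p N z = k z - (\<Sum>i<N. taylor_coeff k i * z ^ i)" for N z
  have hol: "p N holomorphic_on ball 0 1" for N
    unfolding p_def using k by (intro holomorphic_intros) (auto intro: holomorphic_on_subset)
  have "p N has_fps_expansion (Abs_fps (taylor_coeff k) - (\<Sum>i<N. fps_const (taylor_coeff k i) * fps_X ^ i))" for N
    unfolding p_def using k has_fps_expansion_taylor[OF k(1)]
    by (intro fps_expansion_intros) auto
  from taylor_coeff_eq_fps_nth[OF this]
  have tc: "taylor_coeff (p N) i = (if i < N then 0 else taylor_coeff k i)" for N i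
    by (simp add: fps_sum_nth fps_X_power_iff if_distrib[of "\<lambda>x. _ * x"] cong: if_cong)
  have eqw: "(\<lambda>i. cmod (taylor_coeff (p N) i) * \<rho> ^ i) =
      (\<lambda>i. if i < N then 0 else cmod (taylor_coeff k i) * \<rho> ^ i)" for N
    by (auto simp: tc)
  have sp: "summable (\<lambda>i. cmod (taylor_coeff (p N) i) * \<rho> ^ i)" for N
    by (rule summable_comparison_test'[OF sk, of 0]) (use \<rho> in \<open>auto simp: tc\<close>)
  have pf: "mult_op (p N) f \<in> vecs (hardy \<alpha>)"
    "vnorm (hardy \<alpha>) (mult_op (p N) f) \<le> C * (\<Sum>i. if i < N then 0 else cmod (taylor_coeff k i) * \<rho> ^ i) * vnorm (hardy \<alpha>) f" for N
    using C(2)[OF hol sp f, of N] unfolding eqw by auto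
  have zf: "mult_op (\<lambda>z. z ^ i) f \<in> vecs (hardy \<alpha>)" for i
    by (rule hardy_mult_bounded[OF a, of "\<lambda>z. z ^ i"]) (auto intro!: analytic_intros f)
  have ipp: "ip (hardy \<alpha>) x (mult_op k f) =
      (\<Sum>i<N. cnj (taylor_coeff k i) * ip (hardy \<alpha>) x (mult_op (\<lambda>z. z ^ i) f)) + ip (hardy \<alpha>) x (mult_op (p N) f)" for N
  proof (induction N)
    case (Suc N)
    let ?c = "taylor_coeff k N"
    have m: "vscale (hardy \<alpha>) ?c (mult_op (\<lambda>z. z ^ N) f) \<in> vecs (hardy \<alpha>)"
      using hilbert_scale[OF H zf] .
    have "mult_op (p N) f = vadd (hardy \<alpha>) (vscale (hardy \<alpha>) ?c (mult_op (\<lambda>z. z ^ N) f)) (mult_op (p (Suc N)) f)"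
      by (rule ext) (simp add: mult_op_def p_def hardy_simps algebra_simps)
    then have "ip (hardy \<alpha>) x (mult_op (p N) f) =
        cnj ?c * ip (hardy \<alpha>) x (mult_op (\<lambda>z. z ^ N) f) + ip (hardy \<alpha>) x (mult_op (p (Suc N)) f)"
      using hilbert_ip_add_right[OF H m pf(1) x] hilbert_ip_scale_right[OF H zf x] by simp
    then show ?case using Suc by simp
  qed (simp add: p_def[abs_def])
  have "(\<lambda>N. ip (hardy \<alpha>) x (mult_op (p N) f)) \<longlonglongrightarrow> 0"
  proof (rule Lim_null_comparison)
    have "(\<lambda>N. vnorm (hardy \<alpha>) x * (C * (\<Sum>i. if i < N then 0 else cmod (taylor_coeff k i) * \<rho> ^ i) * vnorm (hardy \<alpha>) f))
        \<longlonglongrightarrow> vnorm (hardy \<alpha>) x * (C * 0 * vnorm (hardy \<alpha>) f)"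
      by (intro tendsto_intros suminf_tail_tendsto sk)
    then show "(\<lambda>N. vnorm (hardy \<alpha>) x * (C * (\<Sum>i. if i < N then 0 else cmod (taylor_coeff k i) * \<rho> ^ i) * vnorm (hardy \<alpha>) f)) \<longlonglongrightarrow> 0"
      by simp
    show "\<forall>\<^sub>F N in sequentially. cmod (ip (hardy \<alpha>) x (mult_op (p N) f)) \<le>
        vnorm (hardy \<alpha>) x * (C * (\<Sum>i. if i < N then 0 else cmod (taylor_coeff k i) * \<rho> ^ i) * vnorm (hardy \<alpha>) f)"
      using order_trans[OF hilbert_cauchy_schwarz[OF H x pf(1)] mult_left_mono[OF pf(2) vnorm_nonneg[OF H x]]]
      by (intro always_eventually) auto
  qed
  then have "(\<lambda>N. ip (hardy \<alpha>) x (mult_op k f) - ip (hardy \<alpha>) x (mult_op (p N) f)) \<longlonglongrightarrow> ip (hardy \<alpha>) x (mult_op k f) - 0"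
    by (intro tendsto_intros)
  moreover have "ip (hardy \<alpha>) x (mult_op k f) - ip (hardy \<alpha>) x (mult_op (p N) f) =
      (\<Sum>i<N. cnj (taylor_coeff k i) * ip (hardy \<alpha>) x (mult_op (\<lambda>z. z ^ i) f))" for N
    using ipp[of N] by simp
  ultimately show ?thesis by (simp add: sums_def)
qed

section \<open>Triangular multiplication operators\<close>

lemma vnorm_triangle:
  assumes H: "hilbert_like H" and x: "x \<in> vecs H" and y: "y \<in> vecs H"
  shows "vnorm H (vadd H x y) \<le> vnorm H x + vnorm H y"
proof -
  have "ip H (vadd H x y) (vadd H x y) = ip H x x + ip H x y + (ip H y x + ip H y y)"
    using x y H by (simp add: hilbert_ip_add hilbert_ip_add_right hilbert_add)
  then have "Re (ip H (vadd H x y) (vadd H x y)) = (vnorm H x)\<^sup>2 + 2 * Re (ip H x y) + (vnorm H y)\<^sup>2"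
    using hilbert_ip_sym[OF H x y] by (simp add: hilbert_ip_self[OF H x] hilbert_ip_self[OF H y])
  also have "\<dots> \<le> (vnorm H x)\<^sup>2 + 2 * (vnorm H x * vnorm H y) + (vnorm H y)\<^sup>2"
    using complex_Re_le_cmod[of "ip H x y"] hilbert_cauchy_schwarz[OF H x y] by linarith
  also have "\<dots> = (vnorm H x + vnorm H y)\<^sup>2" by (simp add: power2_sum)
  finally have "Re (ip H (vadd H x y) (vadd H x y)) \<le> (vnorm H x + vnorm H y)\<^sup>2" .
  then have "sqrt (Re (ip H (vadd H x y) (vadd H x y))) \<le> sqrt ((vnorm H x + vnorm H y)\<^sup>2)"
    by (rule real_sqrt_le_mono)
  then show ?thesis
    unfolding vnorm_def[of H "vadd H x y"] using vnorm_nonneg[OF H x] vnorm_nonneg[OF H y] by simp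
qed

text \<open>The adjoint of $T$, its resolvents and the adjoint of $B(T)$ all have this form.\<close>

definition tri_mult :: "(complex \<Rightarrow> complex) \<Rightarrow> (complex \<Rightarrow> complex) \<Rightarrow>
    (complex \<Rightarrow> complex) \<times> (complex \<Rightarrow> complex) \<Rightarrow> (complex \<Rightarrow> complex) \<times> (complex \<Rightarrow> complex)" where
  "tri_mult k l v = (mult_op k (fst v), (\<lambda>z. mult_op l (fst v) z + mult_op k (snd v) z))"

text \<open>The symbols multiply like dual numbers k + l eps with eps^2 = 0. Hence an inverse has
  symbols 1/k and -l/k^2, and a power series F evaluated at z + h eps has symbols F and F'
  h.\<close>

lemma tri_mult_tri_mult:
  "tri_mult k l (tri_mult k' l' v) = tri_mult (\<lambda>z. k z * k' z) (\<lambda>z. l z * k' z + k z * l' z) v"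
  by (auto simp: tri_mult_def mult_op_def algebra_simps)

text \<open>In the application the series is the weak expansion of the resolvent. Weierstrass' test
  permits termwise integration, and Cauchy's formula for derivatives turns the term of index i into
  the Taylor coefficient of index i.\<close>

lemma contour_integral_series_circlepath:
  assumes R: "R > 0" and B: "B analytic_on cball 0 R"
    and nu: "summable (\<lambda>i. cmod (\<nu> i) / R ^ i)"
    and s: "(\<lambda>i. \<nu> i * taylor_coeff B i) sums s"
  shows "contour_integral (circlepath 0 R) (\<lambda>l. B l * (\<Sum>i. \<nu> i / l ^ Suc i)) = 2 * pi * \<i> * s"
proof -
  have holo: "B holomorphic_on cball 0 R" using B analytic_imp_holomorphic by blast
  have cont: "continuous_on (cball 0 R) B" using holomorphic_on_imp_continuous_on[OF holo] .
  have holb: "B holomorphic_on ball 0 R" using holo by (rule holomorphic_on_subset) auto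
  have tm: "((\<lambda>l. B l * (\<nu> i / l ^ Suc i)) has_contour_integral (2 * pi * \<i> * (\<nu> i * taylor_coeff B i)))
      (circlepath 0 R)" for i
    using has_contour_integral_lmul[OF Cauchy_has_contour_integral_higher_derivative_circlepath[OF cont holb, of 0 i], of "\<nu> i"] R
    by (simp add: taylor_coeff_def mult_ac)
  define f where "f N l = (\<Sum>i<N. B l * (\<nu> i / l ^ Suc i))" for N l
  have int: "(f N has_contour_integral (\<Sum>i<N. 2 * pi * \<i> * (\<nu> i * taylor_coeff B i))) (circlepath 0 R)" for N
    unfolding f_def[abs_def] by (intro has_contour_integral_sum tm) auto
  have "compact (B ` sphere 0 R)"
    by (intro compact_continuous_image continuous_on_subset[OF cont]) auto
  then have "bounded (B ` sphere 0 R)" by (rule compact_imp_bounded)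
  then obtain K where "\<forall>x\<in>B ` sphere 0 R. cmod x \<le> K" unfolding bounded_iff by blast
  then have K: "\<And>l. l \<in> sphere 0 R \<Longrightarrow> cmod (B l) \<le> K" by blast
  have "summable (\<lambda>i. K / R * (cmod (\<nu> i) / R ^ i))" by (intro summable_mult nu)
  moreover have "cmod (B l * (\<nu> i / l ^ Suc i)) \<le> K / R * (cmod (\<nu> i) / R ^ i)" if "l \<in> sphere 0 R" for i l
  proof -
    have "cmod (B l * (\<nu> i / l ^ Suc i)) = cmod (B l) * (cmod (\<nu> i) / R ^ Suc i)"
      using that by (simp add: norm_mult norm_divide norm_power)
    also have "\<dots> \<le> K * (cmod (\<nu> i) / R ^ Suc i)"
      using K[OF that] R by (intro mult_right_mono) auto
    finally show ?thesis by simp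
  qed
  ultimately have ul: "uniform_limit (sphere 0 R) f (\<lambda>l. \<Sum>i. B l * (\<nu> i / l ^ Suc i)) sequentially"
    unfolding f_def[abs_def] by (intro Weierstrass_m_test) auto
  have lim: "(\<lambda>N. contour_integral (circlepath 0 R) (f N)) \<longlonglongrightarrow>
      contour_integral (circlepath 0 R) (\<lambda>l. \<Sum>i. B l * (\<nu> i / l ^ Suc i))"
  proof (rule contour_integral_uniform_limit_circlepath(2)[OF _ ul])
    show "\<forall>\<^sub>F n in sequentially. f n contour_integrable_on circlepath 0 R"
      using int by (intro always_eventually) (auto simp: contour_integrable_on_def)
  qed (use R in auto)
  have "contour_integral (circlepath 0 R) (f N) = (\<Sum>i<N. 2 * pi * \<i> * (\<nu> i * taylor_coeff B i))" for N
    by (rule contour_integral_unique[OF int])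
  then have "(\<lambda>i. 2 * pi * \<i> * (\<nu> i * taylor_coeff B i)) sums
      contour_integral (circlepath 0 R) (\<lambda>l. \<Sum>i. B l * (\<nu> i / l ^ Suc i))"
    using lim by (simp add: sums_def)
  moreover have "(\<lambda>i. 2 * pi * \<i> * (\<nu> i * taylor_coeff B i)) sums (2 * pi * \<i> * s)"
    by (intro sums_mult s)
  ultimately have e1: "contour_integral (circlepath 0 R) (\<lambda>l. \<Sum>i. B l * (\<nu> i / l ^ Suc i)) = 2 * pi * \<i> * s"
    by (rule sums_unique2)
  have "contour_integral (circlepath 0 R) (\<lambda>l. B l * (\<Sum>i. \<nu> i / l ^ Suc i)) =
      contour_integral (circlepath 0 R) (\<lambda>l. \<Sum>i. B l * (\<nu> i / l ^ Suc i))"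
  proof (rule contour_integral_eq)
    fix l assume "l \<in> path_image (circlepath 0 R)"
    then have l: "cmod l = R" using R by simp
    have "summable (\<lambda>i. \<nu> i / l ^ Suc i)"
    proof (rule summable_comparison_test'[of "\<lambda>i. 1 / R * (cmod (\<nu> i) / R ^ i)" 0])
      show "summable (\<lambda>i. 1 / R * (cmod (\<nu> i) / R ^ i))" by (intro summable_mult nu)
      show "norm (\<nu> i / l ^ Suc i) \<le> 1 / R * (cmod (\<nu> i) / R ^ i)" for i
        using l by (simp add: norm_divide norm_mult norm_power)
    qed
    then show "B l * (\<Sum>i. \<nu> i / l ^ Suc i) = (\<Sum>i. B l * (\<nu> i / l ^ Suc i))"
      by (rule suminf_mult[symmetric])
  qed
  with e1 show ?thesis by simp
qed

text \<open>A geometric series and its derivative; the two functions are the symbols of the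
  resolvent before the factor h is attached.\<close>

lemma
  assumes "cmod w > 1"
  shows taylor_coeff_resolvent: "taylor_coeff (\<lambda>z. 1 / (w - z)) i = 1 / w ^ Suc i"
    and taylor_coeff_resolvent_sq: "taylor_coeff (\<lambda>z. 1 / (w - z)\<^sup>2) i = of_nat (Suc i) / w ^ (i + 2)"
proof -
  have w0: "w \<noteq> 0" using assms by auto
  have ev: "\<forall>\<^sub>F z in nhds 0. z \<in> ball (0::complex) 1" by (intro eventually_nhds_in_open) auto
  have eq: "1 / (w - z) = (1 / w) * (1 / (1 - z / w))" "1 / (w - z)\<^sup>2 = (1 / w\<^sup>2) * (1 / (1 - z / w)\<^sup>2)" for z
    using w0 by (auto simp: divide_simps power2_eq_square algebra_simps)
  have lt: "cmod (z / w) < 1" if "z \<in> ball 0 1" for z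
    using that assms by (simp add: norm_divide divide_simps)
  have "(\<lambda>z. 1 / (w - z)) has_fps_expansion Abs_fps (\<lambda>i. 1 / w ^ Suc i)"
  proof (rule has_fps_expansionI, rule eventually_mono[OF ev])
    fix z :: complex assume z: "z \<in> ball 0 1"
    have "(\<lambda>i. (1 / w) * (z / w) ^ i) sums ((1 / w) * (1 / (1 - z / w)))"
      by (intro sums_mult geometric_sums lt z)
    then show "(\<lambda>i. fps_nth (Abs_fps (\<lambda>i. 1 / w ^ Suc i)) i * z ^ i) sums (1 / (w - z))"
      unfolding eq by (simp add: power_divide)
  qed
  from taylor_coeff_eq_fps_nth[OF this] show "taylor_coeff (\<lambda>z. 1 / (w - z)) i = 1 / w ^ Suc i" by simp
  have "(\<lambda>z. 1 / (w - z)\<^sup>2) has_fps_expansion Abs_fps (\<lambda>i. of_nat (Suc i) / w ^ (i + 2))"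
  proof (rule has_fps_expansionI, rule eventually_mono[OF ev])
    fix z :: complex assume z: "z \<in> ball 0 1"
    have "(\<lambda>i. (1 / w\<^sup>2) * (of_nat (Suc i) * (z / w) ^ i)) sums ((1 / w\<^sup>2) * (1 / (1 - z / w)\<^sup>2))"
      by (intro sums_mult geometric_deriv_sums lt z)
    moreover have "(\<lambda>i. (1 / w\<^sup>2) * (of_nat (Suc i) * (z / w) ^ i)) =
        (\<lambda>i. fps_nth (Abs_fps (\<lambda>i. of_nat (Suc i) / w ^ (i + 2))) i * z ^ i)"
      by (rule ext) (simp add: power_divide power_add power2_eq_square)
    ultimately show "(\<lambda>i. fps_nth (Abs_fps (\<lambda>i. of_nat (Suc i) / w ^ (i + 2))) i * z ^ i) sums (1 / (w - z)\<^sup>2)"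
      unfolding eq by simp
  qed
  from taylor_coeff_eq_fps_nth[OF this]
  show "taylor_coeff (\<lambda>z. 1 / (w - z)\<^sup>2) i = of_nat (Suc i) / w ^ (i + 2)" by simp
qed

section \<open>The pair of spaces and the adjoint of \<open>T_op\<close>\<close>

locale hardy_pair =
  fixes \<alpha> \<beta> :: "nat \<Rightarrow> real" and D :: real and h :: "complex \<Rightarrow> complex"
  assumes wa: "weight_seq \<alpha>" and wb: "weight_seq \<beta>"
    and dom: "\<And>k. \<beta> k \<le> D * \<alpha> k"
    and h_an: "h analytic_on cball 0 1"
begin

abbreviation HH where "HH \<equiv> orth_sum (hardy \<alpha>) (hardy \<beta>)"

lemmas Ha = hilbert_like_hardy[OF wa]
lemmas Hb = hilbert_like_hardy[OF wb]
lemmas HHl = hilbert_like_orth_sum[OF Ha Hb]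

lemma mem_HH: "v \<in> vecs HH \<longleftrightarrow> fst v \<in> vecs (hardy \<alpha>) \<and> snd v \<in> vecs (hardy \<beta>)"
  by (cases v) (simp add: orth_sum_simps)

lemma mult_mem_a: "k analytic_on cball 0 1 \<Longrightarrow> f \<in> vecs (hardy \<alpha>) \<Longrightarrow> mult_op k f \<in> vecs (hardy \<alpha>)"
  using hardy_mult_bounded[OF wa, of k] by blast

lemma mult_mem_b: "k analytic_on cball 0 1 \<Longrightarrow> f \<in> vecs (hardy \<beta>) \<Longrightarrow> mult_op k f \<in> vecs (hardy \<beta>)"
  using hardy_mult_bounded[OF wb, of k] by blast

lemma embed_ab: "f \<in> vecs (hardy \<alpha>) \<Longrightarrow> f \<in> vecs (hardy \<beta>)"
  using hardy_embed[OF dom wa wb] .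

lemma tri_mult_mem:
  assumes "k analytic_on cball 0 1" "l analytic_on cball 0 1" "v \<in> vecs HH"
  shows "tri_mult k l v \<in> vecs HH"
proof -
  have v: "fst v \<in> vecs (hardy \<alpha>)" "snd v \<in> vecs (hardy \<beta>)" using assms(3) by (simp_all add: mem_HH)
  show ?thesis
    using mult_mem_a[OF assms(1) v(1)] hardy_add_mem[OF mult_mem_b[OF assms(2) embed_ab[OF v(1)]] mult_mem_b[OF assms(1) v(2)]]
    by (simp add: mem_HH tri_mult_def)
qed

lemma bounded_tri_mult:
  assumes k: "k analytic_on cball 0 1" and l: "l analytic_on cball 0 1"
  shows "bounded_op HH HH (tri_mult k l)"
proof -
  obtain C1 where C1: "C1 \<ge> 0" "\<And>f. f \<in> vecs (hardy \<alpha>) \<Longrightarrow> mult_op k f \<in> vecs (hardy \<alpha>) \<and>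
      vnorm (hardy \<alpha>) (mult_op k f) \<le> C1 * vnorm (hardy \<alpha>) f"
    using hardy_mult_bounded[OF wa k] by blast
  obtain C2 where C2: "C2 \<ge> 0" "\<And>f. f \<in> vecs (hardy \<beta>) \<Longrightarrow> mult_op k f \<in> vecs (hardy \<beta>) \<and>
      vnorm (hardy \<beta>) (mult_op k f) \<le> C2 * vnorm (hardy \<beta>) f"
    using hardy_mult_bounded[OF wb k] by blast
  obtain C3 where "\<forall>f\<in>vecs (hardy \<alpha>). vnorm (hardy \<beta>) (mult_op l f) \<le> C3 * vnorm (hardy \<alpha>) f"
    using bounded_op_mult[OF wa wb dom l] unfolding bounded_op_def by blast
  note C3 = bspec[OF this]
  have bound: "vnorm HH (tri_mult k l v) \<le> (C1 + C2 + \<bar>C3\<bar>) * vnorm HH v" if v: "v \<in> vecs HH" for v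
  proof -
    obtain f g where fg: "v = (f, g)" "f \<in> vecs (hardy \<alpha>)" "g \<in> vecs (hardy \<beta>)"
      using v by (cases v) (auto simp: mem_HH)
    have m: "mult_op k f \<in> vecs (hardy \<alpha>)" "mult_op l f \<in> vecs (hardy \<beta>)" "mult_op k g \<in> vecs (hardy \<beta>)"
      using mult_mem_a[OF k fg(2)] mult_mem_b[OF l embed_ab[OF fg(2)]] mult_mem_b[OF k fg(3)] by auto
    let ?s = "\<lambda>z. mult_op l f z + mult_op k g z"
    have s: "?s \<in> vecs (hardy \<beta>)" using m by (intro hardy_add_mem)
    have n0: "vnorm (hardy \<alpha>) f \<ge> 0" "vnorm (hardy \<beta>) g \<ge> 0"
      using vnorm_nonneg[OF Ha] vnorm_nonneg[OF Hb] fg by auto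
    have vv: "vnorm HH v = sqrt ((vnorm (hardy \<alpha>) f)\<^sup>2 + (vnorm (hardy \<beta>) g)\<^sup>2)"
      unfolding fg(1) by (rule vnorm_orth_sum[OF Ha Hb fg(2,3)])
    have f: "vnorm (hardy \<alpha>) f \<le> vnorm HH v" and g: "vnorm (hardy \<beta>) g \<le> vnorm HH v"
      unfolding vv by (rule real_le_rsqrt, simp)+
    have "vnorm HH (tri_mult k l v) = sqrt ((vnorm (hardy \<alpha>) (mult_op k f))\<^sup>2 + (vnorm (hardy \<beta>) ?s)\<^sup>2)"
      unfolding fg(1) tri_mult_def fst_conv snd_conv by (rule vnorm_orth_sum[OF Ha Hb m(1) s])
    also have "\<dots> \<le> vnorm (hardy \<alpha>) (mult_op k f) + vnorm (hardy \<beta>) ?s"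
      by (rule sqrt_sum_squares_le_sum) (use vnorm_nonneg[OF Ha m(1)] vnorm_nonneg[OF Hb s] in auto)
    also have "vnorm (hardy \<beta>) ?s \<le> vnorm (hardy \<beta>) (mult_op l f) + vnorm (hardy \<beta>) (mult_op k g)"
      using vnorm_triangle[OF Hb m(2,3)] by (simp add: hardy_simps)
    also have "vnorm (hardy \<alpha>) (mult_op k f) + (vnorm (hardy \<beta>) (mult_op l f) + vnorm (hardy \<beta>) (mult_op k g))
        \<le> C1 * vnorm (hardy \<alpha>) f + (C3 * vnorm (hardy \<alpha>) f + C2 * vnorm (hardy \<beta>) g)"
      using C1(2)[OF fg(2)] C2(2)[OF fg(3)] C3[OF fg(2)] by linarith
    also have "\<dots> \<le> C1 * vnorm HH v + (\<bar>C3\<bar> * vnorm HH v + C2 * vnorm HH v)"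
      using f g C1(1) C2(1) n0 by (intro add_mono mult_mono) auto
    finally show ?thesis by (simp add: algebra_simps)
  qed
  show ?thesis
    unfolding bounded_op_def
  proof (intro conjI ballI allI exI[of _ "C1 + C2 + \<bar>C3\<bar>"])
    show "vnorm HH (tri_mult k l v) \<le> (C1 + C2 + \<bar>C3\<bar>) * vnorm HH v" if "v \<in> vecs HH" for v
      using bound[OF that] .
    show "tri_mult k l v \<in> vecs HH" if "v \<in> vecs HH" for v using tri_mult_mem[OF k l that] .
  qed (auto simp: tri_mult_def orth_sum_simps hardy_simps mult_op_def algebra_simps)
qed

abbreviation adj where "adj \<equiv> adjoint_op HH HH"

lemmas adj_mem = adjoint_op_mem[OF HHl HHl]
lemmas adj_ip = adjoint_op_ip[OF HHl HHl]
lemmas adj_eqI = adjoint_op_eqI[OF HHl HHl]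

lemma adj_ip': 
  assumes "bounded_op HH HH A" "x \<in> vecs HH" "v \<in> vecs HH"
  shows "ip HH (adj A x) v = ip HH x (A v)"
proof -
  have "A v \<in> vecs HH" using assms by (simp add: bounded_op_def)
  then show ?thesis
    using adj_ip[OF assms] hilbert_ip_sym[OF HHl] adj_mem[OF assms(1,2)] assms by metis
qed

text \<open>Gives access to \<open>T_op\<close> through its adjoint, whose action is pointwise
  multiplication.\<close>

lemma T_op_eq:
  assumes v: "v \<in> vecs HH"
  shows "T_op \<alpha> \<beta> h v = adj (tri_mult (\<lambda>z. z) h) v"
proof -
  obtain f g where fg: "v = (f, g)" "f \<in> vecs (hardy \<alpha>)" "g \<in> vecs (hardy \<beta>)"
    using v by (cases v) (auto simp: mem_HH)
  have id: "(\<lambda>z. z) analytic_on cball 0 1" by (intro analytic_intros)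
  have b1: "bounded_op (hardy \<alpha>) (hardy \<alpha>) (mult_op (\<lambda>z. z))"
    by (rule bounded_op_mult[OF wa wa, of 1]) (use id in auto)
  have b2: "bounded_op (hardy \<beta>) (hardy \<beta>) (mult_op (\<lambda>z. z))"
    by (rule bounded_op_mult[OF wb wb, of 1]) (use id in auto)
  have b3: "bounded_op (hardy \<alpha>) (hardy \<beta>) (mult_op h)"
    by (rule bounded_op_mult[OF wa wb dom h_an])
  let ?a = "adjoint_op (hardy \<alpha>) (hardy \<alpha>) (mult_op (\<lambda>z. z)) f"
  let ?b = "adjoint_op (hardy \<alpha>) (hardy \<beta>) (mult_op h) g"
  let ?c = "adjoint_op (hardy \<beta>) (hardy \<beta>) (mult_op (\<lambda>z. z)) g"
  note m = adjoint_op_mem[OF Ha Ha b1 fg(2)] adjoint_op_mem[OF Ha Hb b3 fg(3)] adjoint_op_mem[OF Hb Hb b2 fg(3)]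
  have T: "T_op \<alpha> \<beta> h v = (vadd (hardy \<alpha>) ?a ?b, ?c)" by (simp add: T_op_def fg(1))
  have Tm: "T_op \<alpha> \<beta> h v \<in> vecs HH"
    unfolding T using m by (simp add: mem_HH hilbert_add[OF Ha])
  show ?thesis
  proof (rule adj_eqI[symmetric, OF bounded_tri_mult[OF id h_an] v Tm])
    fix u assume u: "u \<in> vecs HH"
    then have u1: "fst u \<in> vecs (hardy \<alpha>)" "snd u \<in> vecs (hardy \<beta>)" by (auto simp: mem_HH)
    have mu: "mult_op h (fst u) \<in> vecs (hardy \<beta>)" "mult_op (\<lambda>z. z) (snd u) \<in> vecs (hardy \<beta>)"
      using mult_mem_b[OF h_an embed_ab[OF u1(1)]] mult_mem_b[OF id u1(2)] by auto
    have "ip HH (tri_mult (\<lambda>z. z) h u) v = ip (hardy \<alpha>) (mult_op (\<lambda>z. z) (fst u)) f +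
        ip (hardy \<beta>) (vadd (hardy \<beta>) (mult_op h (fst u)) (mult_op (\<lambda>z. z) (snd u))) g"
      by (simp add: tri_mult_def orth_sum_simps fg(1) hardy_simps(1))
    also have "\<dots> = ip (hardy \<alpha>) (fst u) ?a + (ip (hardy \<alpha>) (fst u) ?b + ip (hardy \<beta>) (snd u) ?c)"
      using hilbert_ip_add[OF Hb mu fg(3)] adjoint_op_ip[OF Ha Ha b1 fg(2) u1(1)]
        adjoint_op_ip[OF Ha Hb b3 fg(3) u1(1)] adjoint_op_ip[OF Hb Hb b2 fg(3) u1(2)] by simp
    also have "\<dots> = ip HH u (T_op \<alpha> \<beta> h v)"
      unfolding T using hilbert_ip_add_right[OF Ha m(1,2) u1(1)] by (simp add: orth_sum_simps)
    finally show "ip HH (tri_mult (\<lambda>z. z) h u) v = ip HH u (T_op \<alpha> \<beta> h v)" .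
  qed
qed

text \<open>The operator l - T is the adjoint of the triangular operator with symbols cnj l - z and
  -h. Inverting these symbols as dual numbers gives \<open>R\<close>, and the adjoint of
  \<open>R\<close> inverts l - T.\<close>

lemma resolvent_op_T:
  assumes l: "cmod l > 1" and x: "x \<in> vecs HH"
  shows "resolvent_op HH (T_op \<alpha> \<beta> h) l x =
    adj (tri_mult (\<lambda>z. 1 / (cnj l - z)) (\<lambda>z. 1 / (cnj l - z)\<^sup>2 * h z)) x"
proof -
  define A where "A = tri_mult (\<lambda>z. cnj l - z) (\<lambda>z. - h z)"
  define R where "R = tri_mult (\<lambda>z. 1 / (cnj l - z)) (\<lambda>z. 1 / (cnj l - z)\<^sup>2 * h z)"
  define M where "M = (\<lambda>x. vadd HH (vscale HH l x) (vscale HH (-1) (T_op \<alpha> \<beta> h x)))"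
  have nz: "cnj l - z \<noteq> 0" if "z \<in> cball 0 1" for z
    using that l by (metis complex_mod_cnj eq_iff_diff_eq_0 mem_cball_0 not_less)
  have id: "(\<lambda>z. z) analytic_on cball 0 1" by (intro analytic_intros)
  have Ab: "bounded_op HH HH A" unfolding A_def
    by (intro bounded_tri_mult analytic_intros h_an)
  have Rb: "bounded_op HH HH R" unfolding R_def
    using nz by (intro bounded_tri_mult analytic_intros h_an) auto
  have Am: "A v \<in> vecs HH" and Rm: "R v \<in> vecs HH" if "v \<in> vecs HH" for v
    using Ab Rb that by (auto simp: bounded_op_def)
  have supp: "f z = 0" if "f \<in> vecs (hardy \<gamma>)" "\<not> cmod z < 1" for f z \<gamma>
    using that by (auto simp: mem_hardy)
  \<comment> \<open>The product symbols are 1 and 0 only in the disc; elements of the spaces vanish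
    elsewhere, so the operator is still the identity on them.\<close>
  have one: "tri_mult k k' v = v" if v: "v \<in> vecs HH"
    and k: "\<And>z. cmod z < 1 \<Longrightarrow> k z = 1" "\<And>z. cmod z < 1 \<Longrightarrow> k' z = 0" for k k' v
  proof -
    have "k z * fst v z = fst v z" "k' z * fst v z + k z * snd v z = snd v z" for z
      using k[of z] supp[of "fst v" \<alpha> z] supp[of "snd v" \<beta> z] v by (cases "cmod z < 1"; simp add: mem_HH)+
    then have "(\<lambda>z. k z * fst v z) = fst v" "(\<lambda>z. k' z * fst v z + k z * snd v z) = snd v"
      by (blast intro: ext)+
    then show ?thesis by (simp add: tri_mult_def mult_op_def prod_eq_iff)
  qed
  have AR: "A (R v) = v" if "v \<in> vecs HH" for v
    unfolding A_def R_def tri_mult_tri_mult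
  proof (rule one[OF that])
    fix z :: complex assume "cmod z < 1"
    then have z: "cnj l - z \<noteq> 0" using nz[of z] by simp
    show "(cnj l - z) * (1 / (cnj l - z)) = 1" using z by simp
    show "- h z * (1 / (cnj l - z)) + (cnj l - z) * (1 / (cnj l - z)\<^sup>2 * h z) = 0"
      using z by (simp add: power2_eq_square)
  qed
  have RA: "R (A v) = v" if "v \<in> vecs HH" for v
    unfolding A_def R_def tri_mult_tri_mult
  proof (rule one[OF that])
    fix z :: complex assume "cmod z < 1"
    then have z: "cnj l - z \<noteq> 0" using nz[of z] by simp
    show "1 / (cnj l - z) * (cnj l - z) = 1" using z by simp
    show "1 / (cnj l - z)\<^sup>2 * h z * (cnj l - z) + 1 / (cnj l - z) * - h z = 0"
      using z by (simp add: power2_eq_square)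
  qed
  note Sb = bounded_tri_mult[OF id h_an]
  \<comment> \<open>\<open>M\<close> acts as the adjoint of \<open>A\<close>; the scalar l becomes
    its conjugate because it changes slots.\<close>
  have MA: "M w \<in> vecs HH" "ip HH v (M w) = ip HH (A v) w" if w: "w \<in> vecs HH" and v: "v \<in> vecs HH" for v w
  proof -
    have T: "T_op \<alpha> \<beta> h w \<in> vecs HH" "ip HH v (T_op \<alpha> \<beta> h w) = ip HH (tri_mult (\<lambda>z. z) h v) w"
      using adj_mem[OF Sb w] adj_ip[OF Sb w v] by (simp_all add: T_op_eq[OF w])
    show "M w \<in> vecs HH" unfolding M_def
      using T w by (simp add: hilbert_add[OF HHl] hilbert_scale[OF HHl])
    have Sv: "tri_mult (\<lambda>z. z) h v \<in> vecs HH" using Sb v by (simp add: bounded_op_def)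
    have Av: "A v = vadd HH (vscale HH (cnj l) v) (vscale HH (-1) (tri_mult (\<lambda>z. z) h v))"
      by (simp add: A_def tri_mult_def orth_sum_simps hardy_simps mult_op_def algebra_simps)
    have "ip HH v (M w) = cnj l * ip HH v w - ip HH v (T_op \<alpha> \<beta> h w)"
      unfolding M_def using v w T
      by (simp add: hilbert_ip_add_right[OF HHl] hilbert_ip_scale_right[OF HHl] hilbert_scale[OF HHl])
    also have "\<dots> = ip HH (A v) w"
      unfolding Av using v w Sv T
      by (simp add: hilbert_ip_add[OF HHl] hilbert_ip_scale[OF HHl] hilbert_scale[OF HHl])
    finally show "ip HH v (M w) = ip HH (A v) w" .
  qed
  have left: "adj R (M w) = w" if w: "w \<in> vecs HH" for w
    by (rule adj_eqI[OF Rb MA(1)[OF w w] w]) (use MA(2)[OF w] Rm AR in auto)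
  have right: "M (adj R x) = x"
  proof (rule hilbert_eqI[OF HHl MA(1)[OF adj_mem[OF Rb x] x] x])
    show "ip HH v (M (adj R x)) = ip HH v x" if v: "v \<in> vecs HH" for v
      using MA(2)[OF adj_mem[OF Rb x] v] adj_ip[OF Rb x Am[OF v]] RA[OF v] by simp
  qed
  have inj: "inj_on M (vecs HH)" using left by (rule inj_on_inverseI)
  show ?thesis
    unfolding resolvent_op_def M_def[symmetric] R_def[symmetric]
    by (rule inv_into_f_eq[OF inj adj_mem[OF Rb x] right])
qed

end

section \<open>Functional calculus and similarity\<close>

lemma taylor_coeff_deriv: "taylor_coeff (deriv f) i = of_nat (Suc i) * taylor_coeff f (Suc i)"
proof -
  have "(deriv ^^ i) (deriv f) = (deriv ^^ Suc i) f" by (simp add: funpow_Suc_right del: funpow.simps)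
  then show ?thesis by (simp add: taylor_coeff_def field_simps del: funpow.simps of_nat_Suc)
qed

section \<open>Direct sums of copies and their coordinates\<close>

lemma copies_simps:
  "vecs (copies n H) = (\<Pi>\<^sub>E i\<in>{..<n}. vecs H)"
  "vadd (copies n H) x y = (\<lambda>i\<in>{..<n}. vadd H (x i) (y i))"
  "vscale (copies n H) c x = (\<lambda>i\<in>{..<n}. vscale H c (x i))"
  "ip (copies n H) x y = (\<Sum>i<n. ip H (x i) (y i))"
  by (simp_all add: copies_def)

definition single :: "nat \<Rightarrow> 'a ip_space \<Rightarrow> nat \<Rightarrow> 'a \<Rightarrow> nat \<Rightarrow> 'a" where
  "single n H i v = (\<lambda>j\<in>{..<n}. if j = i then v else vzero H)"

lemma bounded_op_single:
  assumes H: "hilbert_like H" and X: "bounded_op (copies n H) K X" and i: "i < n"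
  shows "bounded_op H K (\<lambda>v. X (single n H i v))"
proof -
  have m: "single n H i v \<in> vecs (copies n H)" if "v \<in> vecs H" for v
    using that vzero_mem[OF H] by (auto simp: single_def copies_simps)
  have add: "single n H i (vadd H u v) = vadd (copies n H) (single n H i u) (single n H i v)" for u v
    using vadd_vzero_left[OF H vzero_mem[OF H]] by (auto simp: single_def copies_simps)
  have sc: "single n H i (vscale H c v) = vscale (copies n H) c (single n H i v)" for c v
    using vscale_vzero[OF H] by (auto simp: single_def copies_simps)
  have nm: "vnorm (copies n H) (single n H i v) = vnorm H v" if "v \<in> vecs H" for v
  proof -
    have "ip H (single n H i v j) (single n H i v j) = (if j = i then ip H v v else 0)" if "j < n" for j
      using that ip_vzero_left[OF H vzero_mem[OF H]] by (simp add: single_def)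
    then have "ip (copies n H) (single n H i v) (single n H i v) = (\<Sum>j<n. if j = i then ip H v v else 0)"
      unfolding copies_simps by (intro sum.cong) auto
    then show ?thesis using i by (simp add: vnorm_def)
  qed
  obtain C where C: "\<forall>x\<in>vecs (copies n H). vnorm K (X x) \<le> C * vnorm (copies n H) x"
    using X unfolding bounded_op_def by blast
  show ?thesis
    unfolding bounded_op_def
  proof (intro conjI ballI allI exI[of _ C])
    show "X (single n H i v) \<in> vecs K" if "v \<in> vecs H" for v
      using X m[OF that] unfolding bounded_op_def by blast
    show "X (single n H i (vadd H u v)) = vadd K (X (single n H i u)) (X (single n H i v))"
      if "u \<in> vecs H" "v \<in> vecs H" for u v
      using X m[OF that(1)] m[OF that(2)] unfolding bounded_op_def add by blast
    show "X (single n H i (vscale H c v)) = vscale K c (X (single n H i v))" if "v \<in> vecs H" for c v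
      using X m[OF that] unfolding bounded_op_def sc by blast
    show "vnorm K (X (single n H i v)) \<le> C * vnorm H v" if "v \<in> vecs H" for v
      using bspec[OF C m[OF that]] nm[OF that] by simp
  qed
qed

lemma bounded_op_component:
  assumes K: "hilbert_like K" and Y: "bounded_op H (copies n K) Y" and i: "i < n"
  shows "bounded_op H K (\<lambda>v. Y v i)"
proof -
  have m: "Y v \<in> vecs (copies n K)" if "v \<in> vecs H" for v
    using Y that unfolding bounded_op_def by blast
  then have mi: "Y v j \<in> vecs K" if "v \<in> vecs H" "j < n" for v j
    using that by (auto simp: copies_simps)
  have le: "vnorm K (Y v i) \<le> vnorm (copies n K) (Y v)" if v: "v \<in> vecs H" for v
  proof -
    have "Re (ip K (Y v i) (Y v i)) \<le> (\<Sum>j<n. Re (ip K (Y v j) (Y v j)))"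
      using i mi[OF v] hilbert_ip_ge[OF K]
      by (intro member_le_sum[of i "{..<n}" "\<lambda>j. Re (ip K (Y v j) (Y v j))"]) auto
    then show ?thesis unfolding vnorm_def copies_simps by simp
  qed
  obtain C where C: "\<forall>x\<in>vecs H. vnorm (copies n K) (Y x) \<le> C * vnorm H x"
    using Y unfolding bounded_op_def by blast
  show ?thesis
    unfolding bounded_op_def
  proof (intro conjI ballI allI exI[of _ C])
    show "Y v i \<in> vecs K" if "v \<in> vecs H" for v using mi[OF that i] .
    show "Y (vadd H u v) i = vadd K (Y u i) (Y v i)" if "u \<in> vecs H" "v \<in> vecs H" for u v
    proof -
      have "Y (vadd H u v) = vadd (copies n K) (Y u) (Y v)"
        using Y that unfolding bounded_op_def by blast
      then show ?thesis using i by (simp add: copies_simps)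
    qed
    show "Y (vscale H c v) i = vscale K c (Y v i)" if "v \<in> vecs H" for c v
    proof -
      have "Y (vscale H c v) = vscale (copies n K) c (Y v)"
        using Y that unfolding bounded_op_def by blast
      then show ?thesis using i by (simp add: copies_simps)
    qed
    show "vnorm K (Y v i) \<le> C * vnorm H v" if "v \<in> vecs H" for v
      using le[OF that] bspec[OF C that] by linarith
  qed
qed

text \<open>The sum is taken over inner products because an \<open>ip_space\<close> provides binary
  addition only. The induction runs over the truncations \<open>tr m\<close>, which keep the first m
  coordinates.\<close>

lemma ip_single_sum:
  assumes H: "hilbert_like H" and K: "hilbert_like K" and X: "bounded_op (copies n H) K X"
    and w: "w \<in> vecs (copies n H)" and y: "y \<in> vecs K"
  shows "ip K (X w) y = (\<Sum>i<n. ip K (X (single n H i (w i))) y)"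
proof -
  define tr where "tr m = (\<lambda>j\<in>{..<n}. if j < m then w j else vzero H)" for m
  have wi: "w j \<in> vecs H" if "j < n" for j using w that by (auto simp: copies_simps)
  have trm: "tr m \<in> vecs (copies n H)" for m
    using wi vzero_mem[OF H] by (auto simp: tr_def copies_simps)
  have sm: "single n H i (w i) \<in> vecs (copies n H)" if "i < n" for i
    using wi[OF that] vzero_mem[OF H] by (auto simp: single_def copies_simps)
  have XK: "X u \<in> vecs K" if "u \<in> vecs (copies n H)" for u
    using X that unfolding bounded_op_def by blast
  have "m \<le> n \<Longrightarrow> ip K (X (tr m)) y = (\<Sum>i<m. ip K (X (single n H i (w i))) y)" for m
  proof (induction m)
    \<comment> \<open>The empty truncation is 0 times itself, so its image is orthogonal to every
      vector.\<close>
    case 0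
    have "tr 0 = vscale (copies n H) 0 (tr 0)"
      by (auto simp: tr_def copies_simps vscale_vzero[OF H])
    then have "X (tr 0) = X (vscale (copies n H) 0 (tr 0))" by (rule arg_cong)
    also have "\<dots> = vscale K 0 (X (tr 0))"
      using X trm unfolding bounded_op_def by blast
    finally have "ip K (X (tr 0)) y = ip K (vscale K 0 (X (tr 0))) y" by (rule arg_cong)
    then show ?case using hilbert_zero(2)[OF K XK[OF trm] y] by simp
  next
    case (Suc m)
    then have m: "m < n" by simp
    have "tr (Suc m) j = vadd (copies n H) (tr m) (single n H m (w m)) j" for j
    proof -
      consider "j < m" | "j = m" | "j > m" by linarith
      then show ?thesis
        using m wi[of j] vzero_mem[OF H] vadd_vzero_left[OF H] vadd_vzero_right[OF H]
        by cases (auto simp: tr_def single_def copies_simps restrict_def)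
    qed
    then have "tr (Suc m) = vadd (copies n H) (tr m) (single n H m (w m))" by blast
    then have "X (tr (Suc m)) = X (vadd (copies n H) (tr m) (single n H m (w m)))" by (rule arg_cong)
    also have "\<dots> = vadd K (X (tr m)) (X (single n H m (w m)))"
      using X trm sm[OF m] unfolding bounded_op_def by blast
    finally show ?case
      using Suc hilbert_ip_add[OF K XK[OF trm] XK[OF sm[OF m]] y] by simp
  qed
  from this[of n] have "ip K (X (tr n)) y = (\<Sum>i<n. ip K (X (single n H i (w i))) y)" by simp
  moreover have "tr n = w"
  proof (rule ext)
    show "tr n j = w j" for j
      using w by (auto simp: tr_def copies_simps restrict_def PiE_def extensional_def)
  qed
  ultimately show ?thesis by simp
qed

section \<open>B(T) as an adjoint, and the intertwiners of a similarity\<close>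

context hardy_pair
begin

text \<open>Weakly, the resolvent is the sum of \<nu>(i) / l^(i+1), where \<nu>(i) is the inner
  product of x with the i-th power of \<open>tri_mult (\<lambda>z. z) h\<close> applied to y. The
  contour integral replaces 1/l^(i+1) by the Taylor coefficients of B; in the second slot of the
  inner product these become their conjugates, the coefficients of \<open>Bt\<close>.\<close>

lemma fun_calc_T:
  assumes B: "B analytic_on cball 0 1" and Bt: "Bt analytic_on cball 0 1"
    and coeff: "\<And>i. taylor_coeff Bt i = cnj (taylor_coeff B i)" and x: "x \<in> vecs HH"
  shows "fun_calc HH (T_op \<alpha> \<beta> h) B x = adj (tri_mult Bt (\<lambda>z. deriv Bt z * h z)) x"
proof -
  \<comment> \<open>The radius chosen inside \<open>fun_calc\<close> is opaque; the argument works
    with the two properties that select it.\<close>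
  define R where "R = (SOME R::real. R > 1 \<and> B analytic_on cball 0 R)"
  have "R > 1 \<and> B analytic_on cball 0 R"
    unfolding R_def
  proof (rule someI_ex)
    obtain r where r: "r > 1" "B holomorphic_on ball 0 r" using analytic_on_cball_extend[OF B] by blast
    have "B analytic_on ball 0 r" using r(2) by (simp add: analytic_on_open)
    then have "B analytic_on cball 0 ((1 + r) / 2)"
      by (rule analytic_on_subset) (use r(1) in auto)
    then show "\<exists>R>1. B analytic_on cball 0 R" using r(1) by (intro exI[of _ "(1 + r) / 2"]) auto
  qed
  then have R: "R > 1" and BR: "B analytic_on cball 0 R" by auto
  define dB where "dB = deriv Bt"
  have dBan: "dB analytic_on cball 0 1" unfolding dB_def using Bt by (rule analytic_deriv)
  define W where "W = tri_mult Bt (\<lambda>z. dB z * h z)"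
  have Wb: "bounded_op HH HH W"
    unfolding W_def by (intro bounded_tri_mult Bt analytic_intros dBan h_an)
  obtain rB where rB: "rB > 1" "Bt holomorphic_on ball 0 rB" using analytic_on_cball_extend[OF Bt] by blast
  obtain rd where rd: "rd > 1" "dB holomorphic_on ball 0 rd" using analytic_on_cball_extend[OF dBan] by blast
  have key: "1 / (2 * of_real pi * \<i>) * contour_integral (circlepath 0 R)
      (\<lambda>l. B l * ip HH (resolvent_op HH (T_op \<alpha> \<beta> h) l x) y) = ip HH x (W y)" if y: "y \<in> vecs HH" for y
  proof -
    obtain x1 x2 where xx: "x = (x1, x2)" "x1 \<in> vecs (hardy \<alpha>)" "x2 \<in> vecs (hardy \<beta>)"
      using x by (cases x) (auto simp: mem_HH)
    obtain f g where fg: "y = (f, g)" "f \<in> vecs (hardy \<alpha>)" "g \<in> vecs (hardy \<beta>)"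
      using y by (cases y) (auto simp: mem_HH)
    define F where "F = mult_op h f"
    have F: "F \<in> vecs (hardy \<beta>)" unfolding F_def by (rule mult_mem_b[OF h_an embed_ab[OF fg(2)]])
    define m1 where "m1 i = ip (hardy \<alpha>) x1 (mult_op (\<lambda>z. z ^ i) f)" for i
    define m2 where "m2 i = ip (hardy \<beta>) x2 (mult_op (\<lambda>z. z ^ i) F)" for i
    define m3 where "m3 i = ip (hardy \<beta>) x2 (mult_op (\<lambda>z. z ^ i) g)" for i
    \<comment> \<open>The off-diagonal symbol of the i-th power is i z^(i-1) h, hence the shift of
      the index and the value 0 at i = 0.\<close>
    define n2 where "n2 i = (if i = 0 then 0 else of_nat i * m2 (i - 1))" for i
    define \<nu> where "\<nu> i = m1 i + n2 i + m3 i" for i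
    have ipt: "ip HH x (tri_mult k (\<lambda>z. l z * h z) y) =
        ip (hardy \<alpha>) x1 (mult_op k f) + ip (hardy \<beta>) x2 (mult_op l F) + ip (hardy \<beta>) x2 (mult_op k g)"
      if k: "k analytic_on cball 0 1" and l: "l analytic_on cball 0 1" for k l
    proof -
      have "tri_mult k (\<lambda>z. l z * h z) y = (mult_op k f, vadd (hardy \<beta>) (mult_op l F) (mult_op k g))"
        by (simp add: tri_mult_def fg(1) F_def mult_op_def hardy_simps mult.assoc)
      then show ?thesis
        using hilbert_ip_add_right[OF Hb mult_mem_b[OF l F] mult_mem_b[OF k fg(3)] xx(3)]
        by (simp add: xx(1) orth_sum_simps)
    qed
    \<comment> \<open>A growth rate for the moments that is above 1, as
      \<open>ip_shift_bound\<close> demands, and below R, so that they are summable against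
      R^(-i).\<close>
    define \<rho> where "\<rho> = (1 + R) / 2"
    have \<rho>: "1 < \<rho>" "\<rho> < R" using R by (auto simp: \<rho>_def)
    obtain K1 where K1: "\<And>i. cmod (m1 i) \<le> K1 * \<rho> ^ i"
      using ip_shift_bound[OF wa \<rho>(1) fg(2) xx(2)] unfolding m1_def by blast
    obtain K2 where K2: "\<And>i. cmod (m2 i) \<le> K2 * \<rho> ^ i"
      using ip_shift_bound[OF wb \<rho>(1) F xx(3)] unfolding m2_def by blast
    obtain K3 where K3: "\<And>i. cmod (m3 i) \<le> K3 * \<rho> ^ i"
      using ip_shift_bound[OF wb \<rho>(1) fg(3) xx(3)] unfolding m3_def by blast
    have geo: "summable (\<lambda>i. cmod (m i) / R ^ i)" if "\<And>i. cmod (m i) \<le> K * \<rho> ^ i" for m :: "nat \<Rightarrow> complex" and K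
    proof (rule summable_comparison_test'[of "\<lambda>i. K * (\<rho> / R) ^ i" 0])
      show "summable (\<lambda>i. K * (\<rho> / R) ^ i)"
        using \<rho> by (intro summable_mult summable_geometric) auto
      show "norm (cmod (m i) / R ^ i) \<le> K * (\<rho> / R) ^ i" for i
        using divide_right_mono[OF that[of i], of "R ^ i"] R by (simp add: power_divide)
    qed
    have s2: "summable (\<lambda>i. cmod (n2 i) / R ^ i)"
    proof (subst summable_Suc_iff[symmetric], rule summable_comparison_test'[of "\<lambda>i. K2 / R * (of_nat (Suc i) * (\<rho> / R) ^ i)" 0])
      show "summable (\<lambda>i. K2 / R * (of_nat (Suc i) * (\<rho> / R) ^ i))"
        using \<rho> by (intro summable_mult sums_summable[OF geometric_deriv_sums]) auto
      show "norm (cmod (n2 (Suc i)) / R ^ Suc i) \<le> K2 / R * (of_nat (Suc i) * (\<rho> / R) ^ i)" for i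
      proof -
        have "norm (cmod (n2 (Suc i)) / R ^ Suc i) = of_nat (Suc i) * cmod (m2 i) / R ^ Suc i"
          using R by (simp add: n2_def norm_mult del: of_nat_Suc)
        also have "\<dots> \<le> of_nat (Suc i) * (K2 * \<rho> ^ i) / R ^ Suc i"
          using K2[of i] R by (intro divide_right_mono mult_left_mono) auto
        finally show ?thesis by (simp add: power_divide mult_ac del: of_nat_Suc)
      qed
    qed
    have snu: "summable (\<lambda>i. cmod (\<nu> i) / R ^ i)"
    proof (rule summable_comparison_test'[of "\<lambda>i. cmod (m1 i) / R ^ i + cmod (n2 i) / R ^ i + cmod (m3 i) / R ^ i" 0])
      show "summable (\<lambda>i. cmod (m1 i) / R ^ i + cmod (n2 i) / R ^ i + cmod (m3 i) / R ^ i)"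
        by (intro summable_add s2 geo[OF K1] geo[OF K3])
      show "norm (cmod (\<nu> i) / R ^ i) \<le> cmod (m1 i) / R ^ i + cmod (n2 i) / R ^ i + cmod (m3 i) / R ^ i" for i
      proof -
        have "cmod (\<nu> i) \<le> cmod (m1 i) + cmod (n2 i) + cmod (m3 i)"
          unfolding \<nu>_def using norm_triangle_ineq[of "m1 i + n2 i" "m3 i"] norm_triangle_ineq[of "m1 i" "n2 i"]
          by linarith
        from divide_right_mono[OF this, of "R ^ i"] show ?thesis using R by (simp add: add_divide_distrib)
      qed
    qed
    \<comment> \<open>The Neumann series of the resolvent, tested against y and assembled from the
      three entries of the triangular operator.\<close>
    have res: "(\<Sum>i. \<nu> i / l ^ Suc i) = ip HH (resolvent_op HH (T_op \<alpha> \<beta> h) l x) y" if l: "cmod l = R" for l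
    proof -
      have l1: "cmod (cnj l) > 1" using l R by simp
      have nz: "cnj l - z \<noteq> 0" if "cmod z < R" for z
        using that l by (metis complex_mod_cnj eq_iff_diff_eq_0 less_irrefl)
      have k1: "(\<lambda>z. 1 / (cnj l - z)) analytic_on cball 0 1"
        and k2: "(\<lambda>z. 1 / (cnj l - z)\<^sup>2) analytic_on cball 0 1"
        using nz R by (auto intro!: analytic_intros)
      have h1: "(\<lambda>z. 1 / (cnj l - z)) holomorphic_on ball 0 R"
        and h2: "(\<lambda>z. 1 / (cnj l - z)\<^sup>2) holomorphic_on ball 0 R"
        using nz by (auto intro!: holomorphic_intros)
      have kh: "(\<lambda>z. 1 / (cnj l - z)\<^sup>2 * h z) analytic_on cball 0 1"
        by (intro analytic_on_mult k2 h_an)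
      have lc: "cmod l > 1" using l R by simp
      have "ip HH (resolvent_op HH (T_op \<alpha> \<beta> h) l x) y =
          ip HH x (tri_mult (\<lambda>z. 1 / (cnj l - z)) (\<lambda>z. 1 / (cnj l - z)\<^sup>2 * h z) y)"
        unfolding resolvent_op_T[OF lc x] by (rule adj_ip'[OF bounded_tri_mult[OF k1 kh] x y])
      also have "\<dots> = ip (hardy \<alpha>) x1 (mult_op (\<lambda>z. 1 / (cnj l - z)) f) +
          ip (hardy \<beta>) x2 (mult_op (\<lambda>z. 1 / (cnj l - z)\<^sup>2) F) + ip (hardy \<beta>) x2 (mult_op (\<lambda>z. 1 / (cnj l - z)) g)"
        by (rule ipt[OF k1 k2])
      finally have e: "ip HH (resolvent_op HH (T_op \<alpha> \<beta> h) l x) y = \<dots>" .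
      have t1: "(\<lambda>i. m1 i / l ^ Suc i) sums ip (hardy \<alpha>) x1 (mult_op (\<lambda>z. 1 / (cnj l - z)) f)"
        using ip_mult_sums[OF wa h1 R fg(2) xx(2)] unfolding taylor_coeff_resolvent[OF l1] m1_def[symmetric] by simp
      have t3: "(\<lambda>i. m3 i / l ^ Suc i) sums ip (hardy \<beta>) x2 (mult_op (\<lambda>z. 1 / (cnj l - z)) g)"
        using ip_mult_sums[OF wb h1 R fg(3) xx(3)] unfolding taylor_coeff_resolvent[OF l1] m3_def[symmetric] by simp
      have "(\<lambda>i. n2 (Suc i) / l ^ Suc (Suc i)) sums ip (hardy \<beta>) x2 (mult_op (\<lambda>z. 1 / (cnj l - z)\<^sup>2) F)"
        using ip_mult_sums[OF wb h2 R F xx(3)] unfolding taylor_coeff_resolvent_sq[OF l1] m2_def[symmetric]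
        by (simp add: n2_def)
      from sums_Suc[OF this] have t2: "(\<lambda>i. n2 i / l ^ Suc i) sums ip (hardy \<beta>) x2 (mult_op (\<lambda>z. 1 / (cnj l - z)\<^sup>2) F)"
        by (simp add: n2_def)
      show ?thesis
        using sums_add[OF sums_add[OF t1 t2] t3] unfolding e by (simp add: \<nu>_def add_divide_distrib sums_iff)
    qed
    have s: "(\<lambda>i. \<nu> i * taylor_coeff B i) sums ip HH x (W y)"
    proof -
      have t1: "(\<lambda>i. m1 i * taylor_coeff B i) sums ip (hardy \<alpha>) x1 (mult_op Bt f)"
        using ip_mult_sums[OF wa rB(2,1) fg(2) xx(2)] unfolding coeff m1_def[symmetric] by (simp add: mult.commute)
      have t3: "(\<lambda>i. m3 i * taylor_coeff B i) sums ip (hardy \<beta>) x2 (mult_op Bt g)"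
        using ip_mult_sums[OF wb rB(2,1) fg(3) xx(3)] unfolding coeff m3_def[symmetric] by (simp add: mult.commute)
      have "(\<lambda>i. n2 (Suc i) * taylor_coeff B (Suc i)) sums ip (hardy \<beta>) x2 (mult_op dB F)"
        using ip_mult_sums[OF wb rd(2,1) F xx(3)] unfolding dB_def taylor_coeff_deriv coeff m2_def[symmetric]
        by (simp add: n2_def mult_ac)
      from sums_Suc[OF this] have t2: "(\<lambda>i. n2 i * taylor_coeff B i) sums ip (hardy \<beta>) x2 (mult_op dB F)"
        by (simp add: n2_def)
      show ?thesis
        using sums_add[OF sums_add[OF t1 t2] t3] unfolding W_def ipt[OF Bt dBan]
        by (simp add: \<nu>_def distrib_right)
    qed
    have "contour_integral (circlepath 0 R) (\<lambda>l. B l * ip HH (resolvent_op HH (T_op \<alpha> \<beta> h) l x) y) =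
        contour_integral (circlepath 0 R) (\<lambda>l. B l * (\<Sum>i. \<nu> i / l ^ Suc i))"
      by (rule contour_integral_eq) (use res R in \<open>simp\<close>)
    also have "\<dots> = 2 * pi * \<i> * ip HH x (W y)"
      by (rule contour_integral_series_circlepath[OF _ BR snu s]) (use R in simp)
    finally show ?thesis by simp
  qed
  have a: "adj W x \<in> vecs HH" by (rule adj_mem[OF Wb x])
  have ai: "ip HH (adj W x) y = ip HH x (W y)" if "y \<in> vecs HH" for y by (rule adj_ip'[OF Wb x that])
  have "fun_calc HH (T_op \<alpha> \<beta> h) B x = adj W x"
    unfolding fun_calc_def Let_def R_def[symmetric]
  proof (rule the_equality)
    show "adj W x \<in> vecs HH \<and> (\<forall>y\<in>vecs HH. ip HH (adj W x) y = 1 / (2 * of_real pi * \<i>) *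
        contour_integral (circlepath 0 R) (\<lambda>l. B l * ip HH (resolvent_op HH (T_op \<alpha> \<beta> h) l x) y))"
      using a ai key by simp
    fix v assume v: "v \<in> vecs HH \<and> (\<forall>y\<in>vecs HH. ip HH v y = 1 / (2 * of_real pi * \<i>) *
        contour_integral (circlepath 0 R) (\<lambda>l. B l * ip HH (resolvent_op HH (T_op \<alpha> \<beta> h) l x) y))"
    show "v = adj W x"
    proof (rule hilbert_eqI[OF HHl _ a])
      show "v \<in> vecs HH" using v by simp
      fix u assume u: "u \<in> vecs HH"
      have "ip HH v u = ip HH (adj W x) u" using v u key[OF u] ai[OF u] by simp
      then show "ip HH u v = ip HH u (adj W x)"
        using hilbert_ip_sym[OF HHl _ u] v a by simp
    qed
  qed
  then show ?thesis by (simp add: W_def dB_def)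
qed

lemma HH_sum:
  fixes n :: nat
  assumes "\<And>i. i < n \<Longrightarrow> u i \<in> vecs HH"
  shows "(\<lambda>z. \<Sum>i<n. fst (u i) z, \<lambda>z. \<Sum>i<n. snd (u i) z) \<in> vecs HH \<and>
    (\<forall>v\<in>vecs HH. ip HH v (\<lambda>z. \<Sum>i<n. fst (u i) z, \<lambda>z. \<Sum>i<n. snd (u i) z) = (\<Sum>i<n. ip HH v (u i)))"
  using assms
proof (induction n)
  case 0
  obtain y where y: "y \<in> vecs HH" using vzero_mem[OF HHl] by blast
  have "vscale HH 0 y = (\<lambda>z. 0, \<lambda>z. 0)" by (simp add: orth_sum_simps hardy_simps)
  then show ?case
    using hilbert_scale[OF HHl y, of 0] hilbert_zero(1)[OF HHl y] by simp
next
  case (Suc n)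
  let ?s = "(\<lambda>z. \<Sum>i<n. fst (u i) z, \<lambda>z. \<Sum>i<n. snd (u i) z)"
  have IH: "?s \<in> vecs HH" "\<And>v. v \<in> vecs HH \<Longrightarrow> ip HH v ?s = (\<Sum>i<n. ip HH v (u i))"
    using Suc by auto
  have un: "u n \<in> vecs HH" using Suc by simp
  have eq: "(\<lambda>z. \<Sum>i<Suc n. fst (u i) z, \<lambda>z. \<Sum>i<Suc n. snd (u i) z) = vadd HH ?s (u n)"
    by (simp add: orth_sum_simps hardy_simps)
  show ?case
    unfolding eq using hilbert_add[OF HHl IH(1) un] hilbert_ip_add_right[OF HHl IH(1) un] IH(2) by simp
qed

text \<open>If X is the similarity and Y its inverse, the coordinates satisfy Y_i B(T) = T Y_i.
  Their adjoints are the P_i, the adjoints of the columns of X are the Q_i, and X Y = 1 says that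
  the products P_i Q_i add up to the identity: this is the joint surjectivity of the P_i.\<close>

lemma similar_imp_intertwiners:
  assumes B: "B analytic_on cball 0 1" and Bt: "Bt analytic_on cball 0 1"
    and coeff: "\<And>i. taylor_coeff Bt i = cnj (taylor_coeff B i)"
    and sim: "similar_op HH (fun_calc HH (T_op \<alpha> \<beta> h) B) (copies n HH) (copies_op n (T_op \<alpha> \<beta> h))"
  obtains P Q where
    "\<And>i v. i < n \<Longrightarrow> v \<in> vecs HH \<Longrightarrow> P i v \<in> vecs HH"
    "\<And>i v. i < n \<Longrightarrow> v \<in> vecs HH \<Longrightarrow> Q i v \<in> vecs HH"
    "\<And>i u v. i < n \<Longrightarrow> u \<in> vecs HH \<Longrightarrow> v \<in> vecs HH \<Longrightarrow> P i (vadd HH u v) = vadd HH (P i u) (P i v)"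
    "\<And>i c v. i < n \<Longrightarrow> v \<in> vecs HH \<Longrightarrow> P i (vscale HH c v) = vscale HH c (P i v)"
    "\<And>i v. i < n \<Longrightarrow> v \<in> vecs HH \<Longrightarrow>
       tri_mult Bt (\<lambda>z. deriv Bt z * h z) (P i v) = P i (tri_mult (\<lambda>z. z) h v)"
    "\<And>v z. v \<in> vecs HH \<Longrightarrow> fst v z = (\<Sum>i<n. fst (P i (Q i v)) z)"
    "\<And>v z. v \<in> vecs HH \<Longrightarrow> snd v z = (\<Sum>i<n. snd (P i (Q i v)) z)"
proof -
  let ?K = "copies n HH"
  let ?T = "T_op \<alpha> \<beta> h"
  define BT where "BT = fun_calc HH ?T B"
  obtain X Y where X: "bounded_op ?K HH X" and Y: "bounded_op HH ?K Y"
    and YX: "\<And>x. x \<in> vecs ?K \<Longrightarrow> Y (X x) = x" and XY: "\<And>x. x \<in> vecs HH \<Longrightarrow> X (Y x) = x"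
    and rel: "\<And>x. x \<in> vecs ?K \<Longrightarrow> BT (X x) = X (copies_op n ?T x)"
    using sim unfolding similar_op_def BT_def by blast
  define S where "S = tri_mult (\<lambda>z. z) h"
  define W where "W = tri_mult Bt (\<lambda>z. deriv Bt z * h z)"
  have id: "(\<lambda>z. z) analytic_on cball 0 1" by (intro analytic_intros)
  have Sb: "bounded_op HH HH S" unfolding S_def by (rule bounded_tri_mult[OF id h_an])
  have Wb: "bounded_op HH HH W"
    unfolding W_def by (intro bounded_tri_mult Bt analytic_on_mult analytic_deriv h_an)
  have Sm: "S v \<in> vecs HH" and Wm: "W v \<in> vecs HH" if "v \<in> vecs HH" for v
    using Sb Wb that unfolding bounded_op_def by blast+
  have T: "?T v = adj S v" if "v \<in> vecs HH" for v using T_op_eq[OF that] by (simp add: S_def)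
  have BTe: "BT v = adj W v" if "v \<in> vecs HH" for v
    using fun_calc_T[OF B Bt coeff that] by (simp add: BT_def W_def)
  have Tm: "?T v \<in> vecs HH" and BTm: "BT v \<in> vecs HH" if "v \<in> vecs HH" for v
    using adj_mem[OF Sb that] adj_mem[OF Wb that] by (simp_all add: T[OF that] BTe[OF that])
  have Yc: "bounded_op HH HH (\<lambda>v. Y v i)" if "i < n" for i by (rule bounded_op_component[OF HHl Y that])
  have Xc: "bounded_op HH HH (\<lambda>v. X (single n HH i v))" if "i < n" for i by (rule bounded_op_single[OF HHl X that])
  have YK: "Y v \<in> vecs ?K" if "v \<in> vecs HH" for v using Y that unfolding bounded_op_def by blast
  have Ym: "Y v i \<in> vecs HH" if "v \<in> vecs HH" "i < n" for v i
    using YK[OF that(1)] that(2) by (auto simp: copies_simps)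
  have YT: "Y (BT v) i = ?T (Y v i)" if v: "v \<in> vecs HH" and i: "i < n" for v i
  proof -
    have m: "copies_op n ?T (Y v) \<in> vecs ?K"
      using Ym[OF v] Tm by (auto simp: copies_op_def copies_simps)
    have "BT v = X (copies_op n ?T (Y v))" using rel[OF YK[OF v]] XY[OF v] by simp
    then have "Y (BT v) = copies_op n ?T (Y v)" using YX[OF m] by simp
    then show ?thesis using i by (simp add: copies_op_def)
  qed
  define P where "P i = adj (\<lambda>v. Y v i)" for i
  define Q where "Q i = adj (\<lambda>v. X (single n HH i v))" for i
  have Pm: "P i v \<in> vecs HH" and Qm: "Q i v \<in> vecs HH" if "i < n" "v \<in> vecs HH" for i v
    unfolding P_def Q_def using adj_mem[OF Yc[OF that(1)] that(2)] adj_mem[OF Xc[OF that(1)] that(2)] by auto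
  \<comment> \<open>The adjoint of the relation \<open>YT\<close>, checked on inner
    products.\<close>
  have PW: "W (P i v) = P i (S v)" if i: "i < n" and v: "v \<in> vecs HH" for i v
  proof (rule hilbert_eqI[OF HHl Wm[OF Pm[OF i v]] Pm[OF i Sm[OF v]]])
    fix u assume u: "u \<in> vecs HH"
    have "ip HH u (W (P i v)) = ip HH (BT u) (P i v)"
      unfolding BTe[OF u] using adj_ip'[OF Wb u Pm[OF i v]] by simp
    also have "\<dots> = ip HH (?T (Y u i)) v"
      unfolding P_def using adj_ip[OF Yc[OF i] v BTm[OF u]] YT[OF u i] by simp
    also have "\<dots> = ip HH (Y u i) (S v)"
      unfolding T[OF Ym[OF u i]] by (rule adj_ip'[OF Sb Ym[OF u i] v])
    also have "\<dots> = ip HH u (P i (S v))"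
      unfolding P_def by (rule adj_ip[OF Yc[OF i] Sm[OF v] u])
    finally show "ip HH u (W (P i v)) = ip HH u (P i (S v))" .
  qed
  have PQ: "v = (\<lambda>z. \<Sum>i<n. fst (P i (Q i v)) z, \<lambda>z. \<Sum>i<n. snd (P i (Q i v)) z)" if v: "v \<in> vecs HH" for v
  proof -
    have m: "P i (Q i v) \<in> vecs HH" if "i < n" for i using Pm Qm that v by blast
    note s = HH_sum[of n "\<lambda>i. P i (Q i v)", OF m]
    show ?thesis
    proof (rule hilbert_eqI[OF HHl v conjunct1[OF s]])
      fix u assume u: "u \<in> vecs HH"
      have "ip HH u v = ip HH (X (Y u)) v" using XY[OF u] by simp
      also have "\<dots> = (\<Sum>i<n. ip HH (X (single n HH i (Y u i))) v)"
        by (rule ip_single_sum[OF HHl HHl X YK[OF u] v])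
      also have "\<dots> = (\<Sum>i<n. ip HH u (P i (Q i v)))"
      proof (rule sum.cong[OF refl])
        fix i assume "i \<in> {..<n}"
        then have i: "i < n" by simp
        show "ip HH (X (single n HH i (Y u i))) v = ip HH u (P i (Q i v))"
          unfolding P_def using adj_ip[OF Xc[OF i] v Ym[OF u i]] adj_ip[OF Yc[OF i] Qm[OF i v] u]
          by (simp add: Q_def)
      qed
      finally show "ip HH u v = ip HH u (\<lambda>z. \<Sum>i<n. fst (P i (Q i v)) z, \<lambda>z. \<Sum>i<n. snd (P i (Q i v)) z)"
        using s u by simp
    qed auto
  qed
  show ?thesis
  proof (rule that[of P Q])
    show "P i (vadd HH u v) = vadd HH (P i u) (P i v)" if "i < n" "u \<in> vecs HH" "v \<in> vecs HH" for i u v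
      unfolding P_def by (rule adjoint_op_linear(1)[OF HHl HHl Yc[OF that(1)] that(2,3)])
    show "P i (vscale HH c v) = vscale HH c (P i v)" if "i < n" "v \<in> vecs HH" for i c v
      unfolding P_def by (rule adjoint_op_linear(2)[OF HHl HHl Yc[OF that(1)] that(2) that(2)])
    show "fst v z = (\<Sum>i<n. fst (P i (Q i v)) z)" if "v \<in> vecs HH" for v z
      using arg_cong[OF PQ[OF that], of "\<lambda>p. fst p z"] by simp
    show "snd v z = (\<Sum>i<n. snd (P i (Q i v)) z)" if "v \<in> vecs HH" for v z
      using arg_cong[OF PQ[OF that], of "\<lambda>p. snd p z"] by simp
  qed (use Pm Qm PW in \<open>auto simp: W_def S_def\<close>)
qed

end

section \<open>Weights against differentiation\<close>

lemma hardy_coeff_tendsto: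
  assumes "weight_seq \<alpha>" "f \<in> vecs (hardy \<alpha>)"
  shows "(\<lambda>k. cmod (taylor_coeff f k) * \<alpha> k) \<longlonglongrightarrow> 0"
proof -
  have "(\<lambda>k. sqrt ((cmod (taylor_coeff f k))\<^sup>2 * (\<alpha> k)\<^sup>2)) \<longlonglongrightarrow> sqrt 0"
    by (intro tendsto_real_sqrt summable_LIMSEQ_zero hardy_summable assms)
  moreover have "\<bar>\<alpha> k\<bar> = \<alpha> k" for k using weight_seq_pos[OF assms(1), of k] by simp
  ultimately show ?thesis by (simp add: real_sqrt_mult)
qed

text \<open>The contribution of the monomial of degree k of f to the coefficient of degree p of f U + f' V.\<close>

definition hump_coeff :: "(nat \<Rightarrow> complex) \<Rightarrow> (nat \<Rightarrow> complex) \<Rightarrow> nat \<Rightarrow> nat \<Rightarrow> complex" where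
  "hump_coeff u v k p = (if k \<le> p then u (p - k) else 0) + (if k \<le> Suc p then of_nat k * v (Suc p - k) else 0)"

text \<open>Differentiation lowers degrees by one, so the monomial of degree p + 1 still reaches the
  coefficient of degree p.\<close>

lemma taylor_coeff_hump:
  assumes "f holomorphic_on ball 0 1" "U holomorphic_on ball 0 1" "V holomorphic_on ball 0 1"
    and "\<And>z. z \<in> ball 0 1 \<Longrightarrow> g z = f z * U z + deriv f z * V z"
  shows "taylor_coeff g p = (\<Sum>k\<le>Suc p. taylor_coeff f k * hump_coeff (taylor_coeff U) (taylor_coeff V) k p)"
proof -
  let ?F = "Abs_fps (taylor_coeff f)" and ?U = "Abs_fps (taylor_coeff U)" and ?V = "Abs_fps (taylor_coeff V)"
  have F: "f has_fps_expansion ?F" "U has_fps_expansion ?U" "V has_fps_expansion ?V"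
    using has_fps_expansion_taylor[OF assms(1)] has_fps_expansion_taylor[OF assms(2)]
      has_fps_expansion_taylor[OF assms(3)] by simp_all
  have fe: "(\<lambda>z. f z * U z + deriv f z * V z) has_fps_expansion (?F * ?U + fps_deriv ?F * ?V)"
    using F by (intro fps_expansion_intros)
  have ev: "\<forall>\<^sub>F z in nhds 0. g z = f z * U z + deriv f z * V z"
    using eventually_nhds_in_open[of "ball 0 1" "0::complex"] by (auto elim!: eventually_mono simp: assms(4))
  have "g has_fps_expansion (?F * ?U + fps_deriv ?F * ?V)"
    by (rule iffD2[OF has_fps_expansion_cong[OF ev refl] fe])
  from taylor_coeff_eq_fps_nth[OF this]
  have "taylor_coeff g p = (\<Sum>i\<le>p. taylor_coeff f i * taylor_coeff U (p - i)) +
      (\<Sum>i\<le>p. of_nat (Suc i) * taylor_coeff f (Suc i) * taylor_coeff V (p - i))"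
    by (simp add: fps_mult_nth atMost_atLeast0)
  also have "(\<Sum>i\<le>p. taylor_coeff f i * taylor_coeff U (p - i)) =
      (\<Sum>k\<le>Suc p. taylor_coeff f k * (if k \<le> p then taylor_coeff U (p - k) else 0))"
    by simp
  also have "(\<Sum>i\<le>p. of_nat (Suc i) * taylor_coeff f (Suc i) * taylor_coeff V (p - i)) =
      (\<Sum>k\<le>Suc p. taylor_coeff f k * (if k \<le> Suc p then of_nat k * taylor_coeff V (Suc p - k) else 0))"
    unfolding sum.atMost_Suc_shift by (simp add: mult_ac)
  finally show ?thesis
    unfolding sum.distrib[symmetric] hump_coeff_def by (simp add: distrib_left)
qed

text \<open>
  Gliding hump: if V \<noteq> 0, then a lacunary series f in the first space is built whose image has
  infinitely many weighted coefficients of modulus at least 1, near the exponents of f.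
\<close>

lemma multiplier_of_derivative_zero:
  assumes wa: "weight_seq \<alpha>" and wb: "weight_seq \<beta>"
    and lim: "(\<lambda>k. \<alpha> k / (real k * \<beta> k)) \<longlonglongrightarrow> 0"
    and U: "U \<in> vecs (hardy \<beta>)" and V: "V \<in> vecs (hardy \<beta>)"
    and mult: "\<And>f. f \<in> vecs (hardy \<alpha>) \<Longrightarrow>
      \<exists>g\<in>vecs (hardy \<beta>). \<forall>z\<in>ball 0 1. g z = f z * U z + deriv f z * V z"
  shows "taylor_coeff V j = 0"
proof (rule ccontr)
  assume "taylor_coeff V j \<noteq> 0"
  define u where "u = taylor_coeff U"
  define v where "v = taylor_coeff V"
  \<comment> \<open>The order of the zero of V at 0. For k \<ge> 1 the image of z^k has coefficient
    k v(m), up to an error independent of k, in degree k + m - 1.\<close>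
  define m where "m = (LEAST j. v j \<noteq> 0)"
  have vm: "v m \<noteq> 0" unfolding m_def by (rule LeastI[of _ j]) (use \<open>taylor_coeff V j \<noteq> 0\<close> v_def in simp)
  define t where "t = hump_coeff u v"
  have pa: "\<alpha> k > 0" and pb: "\<beta> k > 0" for k using weight_seq_pos wa wb by auto
  have hol: "U holomorphic_on ball 0 1" "V holomorphic_on ball 0 1" using U V by (auto simp: mem_hardy)
  \<comment> \<open>Each monomial is itself an admissible f, so its image lies in the second space.
    This lets a new exponent escape the influence of the earlier ones.\<close>
  have t_lim: "(\<lambda>p. cmod (t k p) * \<beta> p) \<longlonglongrightarrow> 0" for k
  proof -
    obtain g where g: "g \<in> vecs (hardy \<beta>)" "\<And>z. z \<in> ball 0 1 \<Longrightarrow> g z = disc_monom k z * U z + deriv (disc_monom k) z * V z"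
      using mult[OF disc_monom_mem[OF wa, of k]] by blast
    have e: "taylor_coeff g p = t k p" for p
    proof -
      have "taylor_coeff g p = (\<Sum>l\<le>Suc p. taylor_coeff (disc_monom k) l * t l p)"
        unfolding t_def u_def v_def
        by (rule taylor_coeff_hump[OF hardy_holomorphic[OF disc_monom_mem[OF wa]] hol g(2)])
      also have "\<dots> = (\<Sum>l\<le>Suc p. if l = k then t l p else 0)"
        unfolding disc_monom_coeff[OF wa] by (intro sum.cong) auto
      also have "\<dots> = t k p"
        by (cases "k \<le> Suc p") (simp_all add: t_def hump_coeff_def del: sum.atMost_Suc)
      finally show ?thesis .
    qed
    show ?thesis using hardy_coeff_tendsto[OF wb g(1)] by (simp add: e)
  qed
  \<comment> \<open>Degree k + m - 1 is a fixed shift of k, backwards by one if m = 0, so the two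
    weights are comparable.\<close>
  obtain E where E: "E > 0" "\<And>k. k \<ge> 1 \<Longrightarrow> \<beta> k \<le> E * \<beta> (k + m - 1)"
  proof (cases m)
    case 0
    obtain C where C: "C > 0" "\<And>m j. \<beta> (m + j) \<le> C * 2 ^ j * \<beta> m"
      using weight_seq_upper[OF wb, of 2] by auto
    have "\<beta> k \<le> (C * 2) * \<beta> (k + m - 1)" if "k \<ge> 1" for k
      using C(2)[of "k - 1" 1] that 0 by simp
    then show ?thesis using that[of "C * 2"] C(1) by simp
  next
    case (Suc m')
    obtain C where C: "C > 0" "\<And>m j. \<beta> m \<le> C * 2 ^ j * \<beta> (m + j)"
      using weight_seq_lower[OF wb, of 2] by auto
    have "\<beta> k \<le> (C * 2 ^ m') * \<beta> (k + m - 1)" if "k \<ge> 1" for k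
      using C(2)[of k m'] that Suc by simp
    then show ?thesis using that[of "C * 2 ^ m'"] C(1) by simp
  qed
  \<comment> \<open>Amplitudes with c i k times \<alpha>(k) equal to 2^(-i): the series lies in the
    first space whichever distinct exponents are chosen.\<close>
  define c :: "nat \<Rightarrow> nat \<Rightarrow> real" where "c i k = 1 / (2 ^ i * \<alpha> k)" for i k
  have c0: "c i k > 0" for i k using pa[of k] by (simp add: c_def)
  \<comment> \<open>The size of the contribution of U to degree k + m - 1; for m = 0 that degree is
    below k and there is none.\<close>
  define A where "A = (if m = 0 then 0 else cmod (u (m - 1)))"
  have t_low: "cmod (t k (k + m - 1)) \<ge> real k * cmod (v m) - A" if "k \<ge> 1" for k
  proof (cases m)
    case 0
    moreover have "\<not> k \<le> k - 1" "Suc (k - 1) = k" using that by auto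
    ultimately show ?thesis by (simp add: t_def hump_coeff_def A_def norm_mult)
  next
    case (Suc m')
    have "t k (k + m - 1) = u m' + of_nat k * v m" using Suc that by (simp add: t_def hump_coeff_def)
    moreover have "cmod (of_nat k * v m) \<le> cmod (u m' + of_nat k * v m) + cmod (u m')"
      using norm_triangle_ineq4[of "u m' + of_nat k * v m" "u m'"] by simp
    ultimately show ?thesis using Suc by (simp add: A_def norm_mult)
  qed
  \<comment> \<open>Requirements on the i-th exponent k: it lies beyond the degrees inspected
    earlier, the earlier terms together disturb the weighted coefficient of degree k + m - 1 by at
    most 1, and its own term contributes at least 2 there.\<close>
  define P where "P f i k \<longleftrightarrow> k \<ge> 1 \<and> (\<forall>l<i. f l + m + 1 < k) \<and>
      (\<Sum>l<i. c l (f l) * (cmod (t (f l) (k + m - 1)) * \<beta> (k + m - 1))) \<le> 1 \<and>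
      c i k * cmod (t k (k + m - 1)) * \<beta> (k + m - 1) \<ge> 2" for f :: "nat \<Rightarrow> nat" and i k
  have "\<exists>f. \<forall>i. P f i (f i)"
  proof (rule dependent_wf_choice[OF wf_less_than])
    show "P f x r = P g x r" if "\<And>z. (z, x) \<in> less_than \<Longrightarrow> f z = g z" for f g x r
      using that by (auto simp: P_def)
    fix i f
    have "filterlim (\<lambda>k. k + m - 1) sequentially sequentially"
      unfolding filterlim_at_top eventually_sequentially
    proof
      show "\<exists>N. \<forall>k\<ge>N. Z \<le> k + m - 1" for Z by (rule exI[of _ "Suc Z"]) auto
    qed
    then have lim1: "(\<lambda>k. \<Sum>l<i. c l (f l) * (cmod (t (f l) (k + m - 1)) * \<beta> (k + m - 1))) \<longlonglongrightarrow> (\<Sum>l<i. c l (f l) * 0)"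
      by (intro tendsto_sum tendsto_mult tendsto_const filterlim_compose[OF t_lim])
    have ev1: "\<forall>\<^sub>F k in sequentially. (\<Sum>l<i. c l (f l) * (cmod (t (f l) (k + m - 1)) * \<beta> (k + m - 1))) < 1"
      using order_tendstoD(2)[OF lim1, of 1] by simp
    \<comment> \<open>The threshold is chosen so that half of the leading term k |v(m)|, weighted by
      \<beta>(k)/E, is at least 2 / c i k.\<close>
    have ev2: "\<forall>\<^sub>F k in sequentially. \<alpha> k / (real k * \<beta> k) < cmod (v m) / (4 * E * 2 ^ i)"
      using order_tendstoD(2)[OF lim] vm E(1) by simp
    \<comment> \<open>For such k the error A is at most half of k |v(m)|.\<close>
    have ev3: "\<forall>\<^sub>F k in sequentially. real k \<ge> 2 * A / cmod (v m)"
      using eventually_ge_at_top[of "nat \<lceil>2 * A / cmod (v m)\<rceil>"] by eventually_elim linarith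
    have ev4: "\<forall>\<^sub>F k in sequentially. k \<ge> 1 + (\<Sum>l<i. f l + m + 2)" by (rule eventually_ge_at_top)
    have "\<forall>\<^sub>F k in sequentially. P f i k"
      using ev1 ev2 ev3 ev4
    proof eventually_elim
      case (elim k)
      have k1: "k \<ge> 1" using elim(4) by simp
      have sep: "f l + m + 1 < k" if "l < i" for l
      proof -
        have "f l + m + 2 \<le> (\<Sum>l<i. f l + m + 2)"
          using that by (intro member_le_sum[of l "{..<i}" "\<lambda>l. f l + m + 2"]) auto
        then show ?thesis using elim(4) by linarith
      qed
      have "2 * A \<le> real k * cmod (v m)" using elim(3) vm by (simp add: divide_le_eq)
      then have tl: "cmod (t k (k + m - 1)) \<ge> real k * cmod (v m) / 2" using t_low[OF k1] by linarith
      have "\<alpha> k * (4 * E * 2 ^ i) < cmod (v m) * (real k * \<beta> k)"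
        using elim(2) k1 pb[of k] E(1) by (simp add: field_simps)
      then have "2 \<le> c i k * (real k * cmod (v m) / 2) * (\<beta> k / E)"
        using pa[of k] E(1) by (simp add: c_def field_simps)
      also have "\<dots> \<le> c i k * cmod (t k (k + m - 1)) * \<beta> (k + m - 1)"
      proof (intro mult_mono)
        show "\<beta> k / E \<le> \<beta> (k + m - 1)" using E(2)[OF k1] E(1) by (simp add: field_simps)
      qed (use tl c0[of i k] pb[of k] E(1) in auto)
      finally show ?case unfolding P_def using k1 sep elim(1) by auto
    qed
    then show "\<exists>r. P f i r" using eventually_happens'[OF sequentially_bot] by blast
  qed
  then obtain \<kappa> where \<kappa>: "\<And>i. P \<kappa> i (\<kappa> i)" by blast
  have sep: "\<kappa> l + m + 1 < \<kappa> i" if "l < i" for l i using \<kappa>[of i] that unfolding P_def by blast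
  have mono: "strict_mono \<kappa>" by (intro strict_monoI) (use sep in force)
  then have inj: "inj \<kappa>" by (rule strict_mono_imp_inj_on)
  define F where "F k = (if k \<in> range \<kappa> then of_real (c (inv_into UNIV \<kappa> k) k) else (0::complex))" for k
  have Fk: "F (\<kappa> i) = of_real (c i (\<kappa> i))" for i by (simp add: F_def inv_f_f[OF inj])
  have "summable (\<lambda>i. (cmod (F (\<kappa> i)))\<^sup>2 * (\<alpha> (\<kappa> i))\<^sup>2)"
  proof -
    have "(cmod (F (\<kappa> i)))\<^sup>2 * (\<alpha> (\<kappa> i))\<^sup>2 = (1 / 4) ^ i" for i
    proof -
      have "(cmod (F (\<kappa> i)))\<^sup>2 * (\<alpha> (\<kappa> i))\<^sup>2 = (c i (\<kappa> i) * \<alpha> (\<kappa> i))\<^sup>2"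
        using c0[of i "\<kappa> i"] by (simp add: Fk power_mult_distrib)
      also have "c i (\<kappa> i) * \<alpha> (\<kappa> i) = (1 / 2) ^ i" using pa[of "\<kappa> i"] by (simp add: c_def power_divide)
      also have "((1 / 2) ^ i)\<^sup>2 = ((1 / 4) ^ i :: real)"
        by (simp add: power2_eq_square power_mult_distrib[symmetric])
      finally show ?thesis .
    qed
    then show ?thesis by (simp add: summable_geometric)
  qed
  then have sF: "summable (\<lambda>k. (cmod (F k))\<^sup>2 * (\<alpha> k)\<^sup>2)"
    by (subst (asm) summable_mono_reindex[OF mono]) (auto simp: F_def)
  note f = series_fun_mem[OF wa sF]
  obtain g where g: "g \<in> vecs (hardy \<beta>)"
    "\<And>z. z \<in> ball 0 1 \<Longrightarrow> g z = series_fun F z * U z + deriv (series_fun F) z * V z"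
    using mult[OF f(1)] by blast
  have big: "cmod (taylor_coeff g (\<kappa> i + m - 1)) * \<beta> (\<kappa> i + m - 1) \<ge> 1" for i
  proof -
    let ?p = "\<kappa> i + m - 1"
    have ki: "\<kappa> i \<ge> 1" using \<kappa>[of i] by (simp add: P_def)
    have "taylor_coeff g ?p = (\<Sum>k\<le>Suc ?p. F k * t k ?p)"
      unfolding t_def u_def v_def using taylor_coeff_hump[OF hardy_holomorphic[OF f(1)] hol g(2)] by (simp only: f(2))
    \<comment> \<open>Exponents after the i-th exceed p + 1 and cannot reach degree p; all other
      degrees have coefficient 0 in F.\<close>
    also have "\<dots> = (\<Sum>k\<in>\<kappa> ` {..i}. F k * t k ?p)"
    proof (rule sum.mono_neutral_right)
      have "\<kappa> l \<le> \<kappa> i" if "l \<le> i" for l using mono that by (simp add: strict_mono_less_eq)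
      then show "\<kappa> ` {..i} \<subseteq> {..Suc ?p}" using ki by fastforce
      show "\<forall>k\<in>{..Suc ?p} - \<kappa> ` {..i}. F k * t k ?p = 0"
      proof
        fix k assume k: "k \<in> {..Suc ?p} - \<kappa> ` {..i}"
        have "k \<notin> range \<kappa>"
        proof
          assume "k \<in> range \<kappa>"
          then obtain l where l: "k = \<kappa> l" by blast
          then have "i < l" using k by (cases "l \<le> i") auto
          then have "\<kappa> i + m + 1 < k" using sep l by simp
          then show False using k ki by simp
        qed
        then show "F k * t k ?p = 0" by (simp add: F_def)
      qed
    qed simp
    also have "\<dots> = (\<Sum>l\<le>i. F (\<kappa> l) * t (\<kappa> l) ?p)"
      by (subst sum.reindex) (use inj in \<open>auto intro: inj_on_subset\<close>)
    also have "\<dots> = F (\<kappa> i) * t (\<kappa> i) ?p + (\<Sum>l<i. F (\<kappa> l) * t (\<kappa> l) ?p)"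
      by (simp add: lessThan_Suc_atMost[symmetric])
    finally have eq: "taylor_coeff g ?p = F (\<kappa> i) * t (\<kappa> i) ?p + (\<Sum>l<i. F (\<kappa> l) * t (\<kappa> l) ?p)" .
    have "cmod (\<Sum>l<i. F (\<kappa> l) * t (\<kappa> l) ?p) \<le> (\<Sum>l<i. c l (\<kappa> l) * cmod (t (\<kappa> l) ?p))"
      using c0 by (intro sum_norm_le) (simp add: Fk norm_mult less_imp_le)
    then have "cmod (\<Sum>l<i. F (\<kappa> l) * t (\<kappa> l) ?p) * \<beta> ?p \<le> (\<Sum>l<i. c l (\<kappa> l) * cmod (t (\<kappa> l) ?p)) * \<beta> ?p"
      using pb[of ?p] by (intro mult_right_mono) auto
    also have "\<dots> \<le> 1"
      using \<kappa>[of i] by (simp add: P_def sum_distrib_right mult.assoc)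
    finally have s1: "cmod (\<Sum>l<i. F (\<kappa> l) * t (\<kappa> l) ?p) * \<beta> ?p \<le> 1" .
    have s2: "cmod (F (\<kappa> i) * t (\<kappa> i) ?p) * \<beta> ?p \<ge> 2"
      using \<kappa>[of i] c0[of i "\<kappa> i"] by (simp add: P_def Fk norm_mult)
    have "cmod (F (\<kappa> i) * t (\<kappa> i) ?p) \<le> cmod (taylor_coeff g ?p) + cmod (\<Sum>l<i. F (\<kappa> l) * t (\<kappa> l) ?p)"
      unfolding eq using norm_triangle_ineq4[of "F (\<kappa> i) * t (\<kappa> i) ?p + (\<Sum>l<i. F (\<kappa> l) * t (\<kappa> l) ?p)"
        "\<Sum>l<i. F (\<kappa> l) * t (\<kappa> l) ?p"] by simp
    from mult_right_mono[OF this, of "\<beta> ?p"] show ?thesis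
      using s1 s2 pb[of ?p] by (simp add: distrib_right)
  qed
  \<comment> \<open>The weighted coefficients of an element of the space tend to 0, which is
    incompatible with \<open>big\<close>.\<close>
  obtain N where N: "\<And>p. p \<ge> N \<Longrightarrow> cmod (taylor_coeff g p) * \<beta> p < 1"
    using order_tendstoD(2)[OF hardy_coeff_tendsto[OF wb g(1)], of 1] by (auto simp: eventually_sequentially)
  have "\<kappa> (Suc N) + m - 1 \<ge> N" using seq_suble[OF mono, of "Suc N"] by simp
  from N[OF this] big[of "Suc N"] show False by simp
qed

text \<open>The function r(z^n) has only exponents divisible by n. Degree j + k n is therefore fed
  by the residue class of j alone, on which the product is an ordinary Cauchy product of degree
  k.\<close>

lemma taylor_coeff_comp_power:
  assumes r: "r holomorphic_on ball 0 1" and U: "U holomorphic_on ball 0 1" and j: "j < n"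
  shows "taylor_coeff (\<lambda>z. r (z ^ n) * U z) (j + k * n) =
    (\<Sum>i\<le>k. taylor_coeff r i * taylor_coeff U (j + (k - i) * n))"
proof -
  have n: "n > 0" using j by simp
  define s where "s a = (if n dvd a then taylor_coeff r (a div n) else 0)" for a
  have mono: "strict_mono (\<lambda>i. i * n)" using n by (intro strict_monoI) simp
  have "(\<lambda>z. r (z ^ n)) has_fps_expansion Abs_fps s"
  proof (rule has_fps_expansionI)
    have "(\<lambda>a. s a * z ^ a) sums r (z ^ n)" if "z \<in> ball 0 1" for z
    proof -
      have "cmod (z ^ n) < 1" using that n by (simp add: norm_power power_less_one_iff)
      then have "(\<lambda>i. taylor_coeff r i * (z ^ n) ^ i) sums r (z ^ n)" by (rule taylor_sums[OF r])
      then have "(\<lambda>i. s (i * n) * z ^ (i * n)) sums r (z ^ n)"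
        using n by (simp add: s_def power_mult[symmetric] mult.commute)
      then show ?thesis
        by (subst (asm) sums_mono_reindex[OF mono, of "\<lambda>a. s a * z ^ a"]) (auto simp: s_def dvd_def mult.commute)
    qed
    then show "\<forall>\<^sub>F z in nhds 0. (\<lambda>a. fps_nth (Abs_fps s) a * z ^ a) sums r (z ^ n)"
      using eventually_nhds_in_open[of "ball 0 1" "0::complex"] by (auto elim!: eventually_mono)
  qed
  from taylor_coeff_eq_fps_nth[OF has_fps_expansion_mult[OF this has_fps_expansion_taylor[OF U]], of "j + k * n"]
  have "taylor_coeff (\<lambda>z. r (z ^ n) * U z) (j + k * n) = (\<Sum>a\<le>j + k * n. s a * taylor_coeff U (j + k * n - a))"
    by (simp add: fps_mult_nth atMost_atLeast0)
  also have "\<dots> = (\<Sum>a\<in>(\<lambda>i. i * n) ` {..k}. s a * taylor_coeff U (j + k * n - a))"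
  proof (rule sum.mono_neutral_right)
    show "(\<lambda>i. i * n) ` {..k} \<subseteq> {..j + k * n}" by (auto intro: trans_le_add2)
    show "\<forall>a\<in>{..j + k * n} - (\<lambda>i. i * n) ` {..k}. s a * taylor_coeff U (j + k * n - a) = 0"
    proof
      fix a assume a: "a \<in> {..j + k * n} - (\<lambda>i. i * n) ` {..k}"
      have "\<not> n dvd a"
      proof
        assume "n dvd a"
        then obtain i where i: "a = i * n" by (auto simp: dvd_def mult.commute)
        then have "k < i" using a by (cases "i \<le> k") auto
        then have "Suc k * n \<le> a" unfolding i by (intro mult_right_mono) auto
        then show False using a j by simp
      qed
      then show "s a * taylor_coeff U (j + k * n - a) = 0" by (simp add: s_def)
    qed
  qed simp
  also have "\<dots> = (\<Sum>i\<le>k. s (i * n) * taylor_coeff U (j + k * n - i * n))"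
    using n by (subst sum.reindex) (auto simp: inj_on_def)
  also have "\<dots> = (\<Sum>i\<le>k. taylor_coeff r i * taylor_coeff U (j + (k - i) * n))"
  proof (rule sum.cong[OF refl])
    fix i assume "i \<in> {..k}"
    then have "j + k * n - i * n = j + (k - i) * n"
      by (simp add: diff_mult_distrib)
    then show "s (i * n) * taylor_coeff U (j + k * n - i * n) = taylor_coeff r i * taylor_coeff U (j + (k - i) * n)"
      using n by (simp add: s_def)
  qed
  finally show ?thesis .
qed

text \<open>
  A function g is the sum of z^j times its jth section at z^n, so that multiplication by r(z^n)
  acts on every section as multiplication by r.
\<close>

definition residue_section :: "nat \<Rightarrow> nat \<Rightarrow> (complex \<Rightarrow> complex) \<Rightarrow> complex \<Rightarrow> complex" where
  "residue_section n j U = series_fun (\<lambda>k. taylor_coeff U (j + k * n))"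

text \<open>Property A gives \<beta>(k) \<le> c1 \<beta>(j + k n), so reindexing the residue class
  by k keeps the coefficients square summable for the same weight.\<close>

lemma
  assumes wb: "weight_seq \<beta>" and A: "property_A \<beta> n" and j: "j < n" and U: "U \<in> vecs (hardy \<beta>)"
  shows residue_section_mem: "residue_section n j U \<in> vecs (hardy \<beta>)"
    and residue_section_coeff: "taylor_coeff (residue_section n j U) = (\<lambda>k. taylor_coeff U (j + k * n))"
proof -
  obtain c1 where c1: "c1 > 0" "\<And>k. \<beta> k \<le> c1 * \<beta> (j + k * n)"
    using A j unfolding property_A_def by blast
  have n: "n > 0" using j by simp
  have "inj (\<lambda>k. j + k * n)" using n by (auto simp: inj_on_def)
  from summable_reindex[OF hardy_summable[OF U] this]
  have "summable (\<lambda>k. (cmod (taylor_coeff U (j + k * n)))\<^sup>2 * (\<beta> (j + k * n))\<^sup>2)"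
    by (simp add: comp_def)
  from summable_mult[OF this, of "c1\<^sup>2"]
  have s: "summable (\<lambda>k. (cmod (taylor_coeff U (j + k * n)))\<^sup>2 * (\<beta> k)\<^sup>2)"
  proof (rule summable_comparison_test'[of _ 0])
    fix k
    have "(\<beta> k)\<^sup>2 \<le> (c1 * \<beta> (j + k * n))\<^sup>2"
      using c1(2) weight_seq_pos[OF wb, of k] by (intro power_mono) auto
    then have "(cmod (taylor_coeff U (j + k * n)))\<^sup>2 * (\<beta> k)\<^sup>2 \<le> (cmod (taylor_coeff U (j + k * n)))\<^sup>2 * (c1 * \<beta> (j + k * n))\<^sup>2"
      by (intro mult_left_mono) auto
    then show "norm ((cmod (taylor_coeff U (j + k * n)))\<^sup>2 * (\<beta> k)\<^sup>2) \<le>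
        c1\<^sup>2 * ((cmod (taylor_coeff U (j + k * n)))\<^sup>2 * (\<beta> (j + k * n))\<^sup>2)"
      by (simp add: power_mult_distrib mult_ac)
  qed
  from series_fun_mem[OF wb this]
  show "residue_section n j U \<in> vecs (hardy \<beta>)" "taylor_coeff (residue_section n j U) = (\<lambda>k. taylor_coeff U (j + k * n))"
    by (simp_all add: residue_section_def)
qed

text \<open>The two-term form fits g = f(\<phi>(z^n)) U + f'(\<phi>(z^n)) V: the sections satisfy
  the same relation with z in place of z^n.\<close>

lemma residue_section_comp_power:
  assumes wb: "weight_seq \<beta>" and A: "property_A \<beta> n" and j: "j < n"
    and U: "U \<in> vecs (hardy \<beta>)" and V: "V \<in> vecs (hardy \<beta>)" and g: "g \<in> vecs (hardy \<beta>)"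
    and r: "r holomorphic_on ball 0 1" and s: "s holomorphic_on ball 0 1"
    and eq: "\<And>z. z \<in> ball 0 1 \<Longrightarrow> g z = r (z ^ n) * U z + s (z ^ n) * V z" and z: "z \<in> ball 0 1"
  shows "residue_section n j g z = r z * residue_section n j U z + s z * residue_section n j V z"
proof -
  note mem = residue_section_mem[OF wb A j] and cf = residue_section_coeff[OF wb A j]
  note hU = hardy_holomorphic[OF U] and hV = hardy_holomorphic[OF V]
  have n: "n > 0" using j by simp
  have pw: "(\<lambda>z. r (z ^ n) * U z) holomorphic_on ball 0 1" if "r holomorphic_on ball 0 1" "U holomorphic_on ball 0 1" for r U
  proof -
    have "(\<lambda>z. r (z ^ n)) holomorphic_on ball 0 1"
      by (rule holomorphic_on_compose_gen[OF _ that(1), of "\<lambda>z. z ^ n", unfolded comp_def])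
        (use n in \<open>auto intro!: holomorphic_intros simp: norm_power power_less_one_iff\<close>)
    then show ?thesis using that(2) by (intro holomorphic_intros)
  qed
  have hr: "(\<lambda>z. r z * residue_section n j U z) holomorphic_on ball 0 1"
    and hs: "(\<lambda>z. s z * residue_section n j V z) holomorphic_on ball 0 1"
    using r s hardy_holomorphic[OF mem[OF U]] hardy_holomorphic[OF mem[OF V]] by (auto intro!: holomorphic_intros)
  have tg: "taylor_coeff g i = taylor_coeff (\<lambda>z. r (z ^ n) * U z) i + taylor_coeff (\<lambda>z. s (z ^ n) * V z) i" for i
  proof -
    have "\<forall>\<^sub>F z in nhds 0. g z = r (z ^ n) * U z + s (z ^ n) * V z"
      using eventually_nhds_in_open[of "ball 0 1" "0::complex"] by (auto elim!: eventually_mono simp: eq)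
    then have "taylor_coeff g i = taylor_coeff (\<lambda>z. r (z ^ n) * U z + s (z ^ n) * V z) i"
      unfolding taylor_coeff_def by (simp add: higher_deriv_cong_ev)
    then show ?thesis using taylor_coeff_add[OF pw[OF r hU] pw[OF s hV]] by simp
  qed
  show ?thesis
  proof (rule holomorphic_eqI_taylor[of _ 1 "\<lambda>z. r z * residue_section n j U z + s z * residue_section n j V z"])
    show "residue_section n j g holomorphic_on ball 0 1" using hardy_holomorphic[OF mem[OF g]] .
    show "(\<lambda>z. r z * residue_section n j U z + s z * residue_section n j V z) holomorphic_on ball 0 1"
      using hr hs by (rule holomorphic_on_add)
    show "cmod z < 1" using z by simp
    show "taylor_coeff (residue_section n j g) k =
        taylor_coeff (\<lambda>z. r z * residue_section n j U z + s z * residue_section n j V z) k" for k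
      using taylor_coeff_add[OF hr hs, of k] taylor_coeff_mult[OF r hardy_holomorphic[OF mem[OF U]], of k]
        taylor_coeff_mult[OF s hardy_holomorphic[OF mem[OF V]], of k]
      by (simp add: cf[OF g] cf[OF U] cf[OF V] tg taylor_coeff_comp_power[OF r hU j] taylor_coeff_comp_power[OF s hV j]
          atMost_atLeast0)
  qed
qed

section \<open>Composition with Moebius functions\<close>

lemma disc_automorphism_Moebius:
  assumes "cmod w < 1"
  shows "disc_automorphism (Moebius_function 0 w)"
proof -
  have "bij_betw (Moebius_function 0 w) (ball 0 1) (ball 0 1)"
  proof (rule bij_betw_byWitness[of _ "Moebius_function 0 (- w)"])
    show "\<forall>z\<in>ball 0 1. Moebius_function 0 (- w) (Moebius_function 0 w z) = z"
      "\<forall>z\<in>ball 0 1. Moebius_function 0 w (Moebius_function 0 (- w) z) = z"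
      using assms Moebius_function_compose by auto
    show "Moebius_function 0 w ` ball 0 1 \<subseteq> ball 0 1" "Moebius_function 0 (- w) ` ball 0 1 \<subseteq> ball 0 1"
      using assms Moebius_function_norm_lt_1 by auto
  qed
  then show ?thesis
    using Moebius_function_holomorphic[OF assms] by (simp add: disc_automorphism_def)
qed

definition disc_comp :: "(complex \<Rightarrow> complex) \<Rightarrow> (complex \<Rightarrow> complex) \<Rightarrow> complex \<Rightarrow> complex" where
  "disc_comp f \<phi> = (\<lambda>z. if z \<in> ball 0 1 then f (\<phi> z) else 0)"

lemma disc_comp_Moebius_mem:
  assumes "moebius_invariant \<alpha>" "cmod w < 1" "f \<in> vecs (hardy \<alpha>)"
  shows "disc_comp f (Moebius_function 0 w) \<in> vecs (hardy \<alpha>)"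
  using assms disc_automorphism_Moebius[OF assms(2)] unfolding moebius_invariant_def disc_comp_def by blast

text \<open>Reduction to the case b(z) = z. Passing to the section of residue j replaces z^n by z,
  and composing with the inverse \<psi> of \<phi> removes \<phi>; both operations stay in the second
  space. So every section of V vanishes, and with it every coefficient.\<close>

lemma multiplier_of_derivative_blaschke_zero:
  assumes wa: "weight_seq \<alpha>" and wb: "weight_seq \<beta>" and mi: "moebius_invariant \<beta>"
    and A: "property_A \<beta> n" and n: "n \<ge> 1" and w: "cmod w < 1"
    and lim: "(\<lambda>k. \<alpha> k / (real k * \<beta> k)) \<longlonglongrightarrow> 0"
    and U: "U \<in> vecs (hardy \<beta>)" and V: "V \<in> vecs (hardy \<beta>)"
    and mult: "\<And>f. f \<in> vecs (hardy \<alpha>) \<Longrightarrow> \<exists>g\<in>vecs (hardy \<beta>). \<forall>z\<in>ball 0 1.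
      g z = f (Moebius_function 0 (- w) (z ^ n)) * U z + deriv f (Moebius_function 0 (- w) (z ^ n)) * V z"
    and z: "cmod z < 1"
  shows "V z = 0"
proof -
  define \<phi> where "\<phi> = Moebius_function 0 (- w)"
  define \<psi> where "\<psi> = Moebius_function 0 w"
  have \<phi>\<psi>: "\<phi> (\<psi> z) = z" "\<psi> (\<phi> z) = z" "\<phi> z \<in> ball 0 1" "\<psi> z \<in> ball 0 1" if "z \<in> ball 0 1" for z
    using that w Moebius_function_compose[of "- w" w z] Moebius_function_compose[of w "- w" z]
      Moebius_function_norm_lt_1[of w z] Moebius_function_norm_lt_1[of "- w" z]
    by (auto simp: \<phi>_def \<psi>_def)
  have hol: "\<phi> holomorphic_on ball 0 1" unfolding \<phi>_def using w by (intro Moebius_function_holomorphic) simp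
  have coeff0: "taylor_coeff V (j + k * n) = 0" if j: "j < n" for j k
  proof -
    note mem = residue_section_mem[OF wb A j] and cf = residue_section_coeff[OF wb A j]
    define V' where "V' = disc_comp (residue_section n j V) \<psi>"
    define U' where "U' = disc_comp (residue_section n j U) \<psi>"
    have m': "V' \<in> vecs (hardy \<beta>)" "U' \<in> vecs (hardy \<beta>)"
      unfolding V'_def U'_def \<psi>_def by (intro disc_comp_Moebius_mem mi w mem U V)+
    have V0: "taylor_coeff V' i = 0" for i
    proof (rule multiplier_of_derivative_zero[OF wa wb lim m'(2,1)])
      fix f assume f: "f \<in> vecs (hardy \<alpha>)"
      have fh: "f holomorphic_on ball 0 1" "deriv f holomorphic_on ball 0 1"
        using hardy_holomorphic[OF f] by (auto intro: holomorphic_deriv)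
      obtain g where g: "g \<in> vecs (hardy \<beta>)"
        "\<And>z. z \<in> ball 0 1 \<Longrightarrow> g z = f (\<phi> (z ^ n)) * U z + deriv f (\<phi> (z ^ n)) * V z"
        using mult[OF f] unfolding \<phi>_def by blast
      have img: "\<phi> ` ball 0 1 \<subseteq> ball 0 1" using \<phi>\<psi>(3) by blast
      have comp: "(\<lambda>z. f (\<phi> z)) holomorphic_on ball 0 1" "(\<lambda>z. deriv f (\<phi> z)) holomorphic_on ball 0 1"
        using holomorphic_on_compose_gen[OF hol fh(1) img] holomorphic_on_compose_gen[OF hol fh(2) img]
        by (simp_all add: comp_def)
      have sec: "residue_section n j g z = f (\<phi> z) * residue_section n j U z + deriv f (\<phi> z) * residue_section n j V z"
        if "z \<in> ball 0 1" for z
        by (rule residue_section_comp_power[OF wb A j U V g(1) comp g(2) that])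
      show "\<exists>g\<in>vecs (hardy \<beta>). \<forall>z\<in>ball 0 1. g z = f z * U' z + deriv f z * V' z"
      proof (intro bexI ballI)
        show "disc_comp (residue_section n j g) \<psi> \<in> vecs (hardy \<beta>)"
          unfolding \<psi>_def by (intro disc_comp_Moebius_mem mi w mem g(1))
        show "disc_comp (residue_section n j g) \<psi> z = f z * U' z + deriv f z * V' z" if "z \<in> ball 0 1" for z
          using sec[OF \<phi>\<psi>(4)[OF that]] \<phi>\<psi>(1)[OF that] that by (simp add: disc_comp_def U'_def V'_def)
      qed
    qed
    have "residue_section n j V z = 0" if "z \<in> ball 0 1" for z
    proof -
      have "V' (\<phi> z) = 0"
        using taylor_sums[OF hardy_holomorphic[OF m'(1)], of "\<phi> z"] \<phi>\<psi>(3)[OF that] by (simp add: V0 sums_iff)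
      then show ?thesis using \<phi>\<psi>(2,3)[OF that] by (simp add: V'_def disc_comp_def)
    qed
    \<comment> \<open>Writing the section as 0 times itself makes its coefficients available through
      \<open>hardy_coeff_scale\<close>.\<close>
    then have "residue_section n j V z = 0 * residue_section n j V z" for z
      using mem[OF V] by (cases "cmod z < 1") (auto simp: mem_hardy)
    then have "residue_section n j V = (\<lambda>z. 0 * residue_section n j V z)" by blast
    then have "taylor_coeff (residue_section n j V) = taylor_coeff (\<lambda>z. 0 * residue_section n j V z)" by (rule arg_cong)
    then have "taylor_coeff (residue_section n j V) k = 0"
      unfolding hardy_coeff_scale[OF mem[OF V]] by simp
    then show ?thesis by (simp add: cf[OF V])
  qed
  have "taylor_coeff V i = 0" for i
    using coeff0[of "i mod n" "i div n"] n by simp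
  then show ?thesis using taylor_sums[OF hardy_holomorphic[OF V] z] by (simp add: sums_iff)
qed

text \<open>Division at w is conjugated by a Moebius function to division at 0, which is the backward shift.\<close>

lemma hardy_division:
  assumes wa: "weight_seq \<alpha>" and mi: "moebius_invariant \<alpha>" and w: "cmod w < 1" and f: "f \<in> vecs (hardy \<alpha>)"
  obtains q where "q \<in> vecs (hardy \<alpha>)" "\<And>z. cmod z < 1 \<Longrightarrow> f z = f w + (z - w) * q z" "q w = deriv f w"
proof -
  define \<phi> where "\<phi> = Moebius_function 0 (- w)"
  define \<psi> where "\<psi> = Moebius_function 0 w"
  define F where "F = disc_comp f \<phi>"
  have F: "F \<in> vecs (hardy \<alpha>)"
    unfolding F_def \<phi>_def using w by (intro disc_comp_Moebius_mem mi f) simp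
  \<comment> \<open>Neighbouring weights are comparable, so the backward shift keeps coefficients
    square summable.\<close>
  obtain C where C: "C > 0" "\<And>m j. \<alpha> m \<le> C * 2 ^ j * \<alpha> (m + j)"
    using weight_seq_lower[OF wa, of 2] by auto
  have "summable (\<lambda>k. (cmod (taylor_coeff F (Suc k)))\<^sup>2 * (\<alpha> (Suc k))\<^sup>2)"
    using hardy_summable[OF F] by (subst (asm) summable_Suc_iff[symmetric])
  from summable_mult[OF this, of "(C * 2)\<^sup>2"]
  have s: "summable (\<lambda>k. (cmod (taylor_coeff F (Suc k)))\<^sup>2 * (\<alpha> k)\<^sup>2)"
  proof (rule summable_comparison_test'[of _ 0])
    fix k
    have "(\<alpha> k)\<^sup>2 \<le> (C * 2 * \<alpha> (Suc k))\<^sup>2"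
      using C(2)[of k 1] weight_seq_pos[OF wa, of k] by (intro power_mono) auto
    then have "(cmod (taylor_coeff F (Suc k)))\<^sup>2 * (\<alpha> k)\<^sup>2 \<le> (cmod (taylor_coeff F (Suc k)))\<^sup>2 * (C * 2 * \<alpha> (Suc k))\<^sup>2"
      by (intro mult_left_mono) auto
    then show "norm ((cmod (taylor_coeff F (Suc k)))\<^sup>2 * (\<alpha> k)\<^sup>2) \<le>
        (C * 2)\<^sup>2 * ((cmod (taylor_coeff F (Suc k)))\<^sup>2 * (\<alpha> (Suc k))\<^sup>2)"
      by (simp add: power_mult_distrib mult_ac)
  qed
  define r where "r = series_fun (\<lambda>k. taylor_coeff F (Suc k))"
  note R = series_fun_mem[OF wa s, folded r_def]
  have Fr: "F z = f w + z * r z" if z: "cmod z < 1" for z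
  proof -
    have "(\<lambda>k. taylor_coeff F (Suc k) * z ^ k) sums r z"
      using taylor_sums[OF hardy_holomorphic[OF R(1)] z] by (simp add: R(2))
    from sums_mult[OF this, of z] have "(\<lambda>k. taylor_coeff F (Suc k) * z ^ Suc k) sums (z * r z)"
      by (simp add: mult_ac)
    from sums_Suc[OF this] have "F z = z * r z + taylor_coeff F 0"
      using taylor_sums[OF hardy_holomorphic[OF F] z] by (simp add: sums_iff)
    moreover have "taylor_coeff F 0 = f w"
      by (simp add: taylor_coeff_def F_def disc_comp_def \<phi>_def Moebius_function_of_zero)
    ultimately show ?thesis by simp
  qed
  have nz: "1 - cnj w * z \<noteq> 0" if "cmod z \<le> 1" for z
  proof -
    have "cmod (cnj w * z) < 1"
      using mult_left_mono[OF that, of "cmod w"] w by (simp add: norm_mult)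
    then show ?thesis by (metis eq_iff_diff_eq_0 less_irrefl norm_one)
  qed
  \<comment> \<open>\<psi>(z) equals (z - w) / (1 - cnj w z). The numerator is the divisor, and the
    denominator goes into the quotient as a multiplier analytic on the closed disc.\<close>
  define q where "q = mult_op (\<lambda>z. 1 / (1 - cnj w * z)) (disc_comp r \<psi>)"
  have "(\<lambda>z. 1 / (1 - cnj w * z)) analytic_on cball 0 1" using nz by (auto intro!: analytic_intros)
  then have q: "q \<in> vecs (hardy \<alpha>)"
    using hardy_mult_bounded[OF wa] disc_comp_Moebius_mem[OF mi w R(1)] unfolding q_def \<psi>_def by blast
  have eq: "f z = f w + (z - w) * q z" if z: "cmod z < 1" for z
  proof -
    have p: "cmod (\<psi> z) < 1" unfolding \<psi>_def by (rule Moebius_function_norm_lt_1[OF w z])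
    have "\<phi> (\<psi> z) = z" unfolding \<phi>_def \<psi>_def by (rule Moebius_function_compose) (use w z in auto)
    then have "f z = F (\<psi> z)" using p by (simp add: F_def disc_comp_def)
    also have "\<dots> = f w + \<psi> z * r (\<psi> z)" by (rule Fr[OF p])
    also have "\<psi> z * r (\<psi> z) = (z - w) * q z"
      using z by (simp add: q_def mult_op_def disc_comp_def) (simp add: \<psi>_def Moebius_function_simple)
    finally show ?thesis .
  qed
  have "q field_differentiable at w"
    using holomorphic_on_imp_differentiable_at[OF hardy_holomorphic[OF q]] w by simp
  then have "(q has_field_derivative deriv q w) (at w)" by (simp add: field_differentiable_derivI)
  \<comment> \<open>Differentiating (z - w) q(z) at w leaves only q(w).\<close>
  then have der: "((\<lambda>z. f w + (z - w) * q z) has_field_derivative q w) (at w)"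
    by (auto intro!: derivative_eq_intros)
  have ev: "\<forall>\<^sub>F z in nhds w. f w + (z - w) * q z = f z"
    using eventually_nhds_in_open[of "ball 0 1" w] w by (auto elim!: eventually_mono simp: eq[symmetric])
  have "(f has_field_derivative q w) (at w)" by (rule iffD1[OF DERIV_cong_ev[OF refl ev refl] der])
  then have "q w = deriv f w" by (simp add: DERIV_imp_deriv)
  with q eq show ?thesis using that by blast
qed

definition disc_one :: "complex \<Rightarrow> complex" where "disc_one = disc_monom 0"

lemma disc_one_mem: "weight_seq \<alpha> \<Longrightarrow> disc_one \<in> vecs (hardy \<alpha>)"
  by (simp add: disc_one_def disc_monom_mem)

lemma disc_one_simps: "cmod z < 1 \<Longrightarrow> disc_one z = 1" "\<not> cmod z < 1 \<Longrightarrow> disc_one z = 0"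
proof -
  have "Abs_fps (\<lambda>k. if k = 0 then 1 else 0) = (1 :: complex fps)" by (rule fps_ext) simp
  then show "cmod z < 1 \<Longrightarrow> disc_one z = 1" "\<not> cmod z < 1 \<Longrightarrow> disc_one z = 0"
    by (simp_all add: disc_one_def disc_monom_def series_fun_def)
qed

text \<open>Intended for L the value at z0 of an entry of an intertwiner, with w = b(z0): the
  intertwining relation then evaluates the difference of the last two terms. The decomposition of f
  is exact, so linearity of L is all that enters.\<close>

lemma linear_functional_division:
  fixes L :: "(complex \<Rightarrow> complex) \<Rightarrow> complex"
  assumes wa: "weight_seq \<alpha>" and mi: "moebius_invariant \<alpha>" and w: "cmod w < 1" and f: "f \<in> vecs (hardy \<alpha>)"
    and add: "\<And>f g. f \<in> vecs (hardy \<alpha>) \<Longrightarrow> g \<in> vecs (hardy \<alpha>) \<Longrightarrow> L (\<lambda>z. f z + g z) = L f + L g"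
    and sc: "\<And>c f. f \<in> vecs (hardy \<alpha>) \<Longrightarrow> L (\<lambda>z. c * f z) = c * L f"
  obtains q where "q \<in> vecs (hardy \<alpha>)" "q w = deriv f w"
    "L f = f w * L disc_one + L (mult_op (\<lambda>z. z) q) - w * L q"
proof -
  obtain q where q: "q \<in> vecs (hardy \<alpha>)" "\<And>z. cmod z < 1 \<Longrightarrow> f z = f w + (z - w) * q z" "q w = deriv f w"
    using hardy_division[OF wa mi w f] by blast
  have id: "(\<lambda>z. z) analytic_on cball 0 1" by (intro analytic_intros)
  have zq: "mult_op (\<lambda>z. z) q \<in> vecs (hardy \<alpha>)" using hardy_mult_bounded[OF wa id] q(1) by blast
  note one = disc_one_mem[OF wa]
  have "f z = f w * disc_one z + (mult_op (\<lambda>z. z) q z + (- w) * q z)" for z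
  proof (cases "cmod z < 1")
    case True
    then show ?thesis using q(2)[OF True] by (simp add: disc_one_simps mult_op_def algebra_simps)
  next
    case False
    then show ?thesis using f q(1) by (simp add: disc_one_simps mult_op_def mem_hardy)
  qed
  then have "f = (\<lambda>z. f w * disc_one z + (mult_op (\<lambda>z. z) q z + (- w) * q z))" by blast
  then have "L f = L (\<lambda>z. f w * disc_one z + (mult_op (\<lambda>z. z) q z + (- w) * q z))" by (rule arg_cong)
  also have "\<dots> = f w * L disc_one + (L (mult_op (\<lambda>z. z) q) + (- w) * L q)"
    by (simp only: add[OF hardy_scale_mem[OF one] hardy_add_mem[OF zq hardy_scale_mem[OF q(1)]]]
      add[OF zq hardy_scale_mem[OF q(1)]] sc[OF one] sc[OF q(1)])
  finally show ?thesis using that[OF q(1,3)] by simp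
qed

text \<open>Used to turn the fact that low Taylor coefficients can be prescribed into uniqueness of
  the values at w that produce them.\<close>

lemma left_inverse_of_right_inverse:
  fixes A C :: "nat \<Rightarrow> nat \<Rightarrow> complex"
  assumes "\<And>i k. i < n \<Longrightarrow> k < n \<Longrightarrow> (\<Sum>j<n. A i j * C j k) = (if i = k then 1 else 0)"
    and "i < n" "k < n"
  shows "(\<Sum>j<n. C i j * A j k) = (if i = k then 1 else 0)"
proof -
  define MA where "MA = mat n n (\<lambda>(i, j). A i j)"
  define MC where "MC = mat n n (\<lambda>(i, j). C i j)"
  have c: "MA \<in> carrier_mat n n" "MC \<in> carrier_mat n n" by (auto simp: MA_def MC_def)
  have "MA * MC = 1\<^sub>m n"
    by (rule eq_matI) (use assms(1) in \<open>auto simp: MA_def MC_def scalar_prod_def atLeast0LessThan\<close>)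
  then have "MC * MA = 1\<^sub>m n" by (rule mat_mult_left_right_inverse[OF c])
  then have "(MC * MA) $$ (i, k) = (1\<^sub>m n) $$ (i, k)" by simp
  then show ?thesis using assms(2,3) by (simp add: MA_def MC_def scalar_prod_def atLeast0LessThan)
qed

lemma taylor_coeff_cnj:
  assumes "B holomorphic_on ball 0 1"
  shows "taylor_coeff (\<lambda>z. cnj (B (cnj z))) i = cnj (taylor_coeff B i)"
proof -
  have "(\<lambda>z. cnj (B (cnj z))) has_fps_expansion Abs_fps (\<lambda>i. cnj (taylor_coeff B i))"
  proof (rule has_fps_expansionI, rule eventually_mono)
    show "\<forall>\<^sub>F z in nhds 0. z \<in> ball (0::complex) 1" by (intro eventually_nhds_in_open) auto
    fix z :: complex assume "z \<in> ball 0 1"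
    then have "(\<lambda>k. taylor_coeff B k * cnj z ^ k) sums B (cnj z)" by (intro taylor_sums[OF assms]) simp
    then have "(\<lambda>k. cnj (taylor_coeff B k * cnj z ^ k)) sums cnj (B (cnj z))" by (simp only: sums_cnj)
    then show "(\<lambda>n. fps_nth (Abs_fps (\<lambda>i. cnj (taylor_coeff B i))) n * z ^ n) sums cnj (B (cnj z))" by simp
  qed
  from taylor_coeff_eq_fps_nth[OF this] show ?thesis by simp
qed

section \<open>Intertwining operators\<close>

context hardy_pair
begin

text \<open>View P as a matrix with rows (a, x) and (c, d). The entries are found in the order x, a,
  d, c: each relation brings in one new entry beside those already known. In a and c a term with
  f'(b) survives the division, and the growth condition removes it.\<close>

lemma intertwiner_values:
  assumes mia: "moebius_invariant \<alpha>" and mib: "moebius_invariant \<beta>"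
    and Aa: "property_A \<alpha> n" and Ab: "property_A \<beta> n" and n: "n \<ge> 1"
    and lim: "(\<lambda>k. \<alpha> k / (real k * \<beta> k)) \<longlonglongrightarrow> 0" and w: "cmod w < 1"
    and Bt: "Bt analytic_on cball 0 1"
    and Bv: "\<And>z. cmod z < 1 \<Longrightarrow> Bt z = Moebius_function 0 (- w) (z ^ n)"
    and Pm: "\<And>v. v \<in> vecs HH \<Longrightarrow> P v \<in> vecs HH"
    and Padd: "\<And>u v. u \<in> vecs HH \<Longrightarrow> v \<in> vecs HH \<Longrightarrow> P (vadd HH u v) = vadd HH (P u) (P v)"
    and Psc: "\<And>c v. v \<in> vecs HH \<Longrightarrow> P (vscale HH c v) = vscale HH c (P v)"
    and rel: "\<And>v. v \<in> vecs HH \<Longrightarrow>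
       tri_mult Bt (\<lambda>z. deriv Bt z * h z) (P v) = P (tri_mult (\<lambda>z. z) h v)"
    and hw: "h w \<noteq> 0" and crit: "deriv Bt 0 * h 0 = 0"
  obtains a c where "a \<in> vecs (hardy \<alpha>)"
    "\<And>s t z. (s, t) \<in> vecs HH \<Longrightarrow> cmod z < 1 \<Longrightarrow> fst (P (s, t)) z = s (Bt z) * a z"
    "\<And>s t. (s, t) \<in> vecs HH \<Longrightarrow> snd (P (s, t)) 0 = s w * c"
proof -
  define Z where "Z = (\<lambda>z::complex. 0::complex)"
  note one_a = disc_one_mem[OF wa] and one_b = disc_one_mem[OF wb]
  have Za: "Z \<in> vecs (hardy \<alpha>)" and Zb: "Z \<in> vecs (hardy \<beta>)"
    using hardy_scale_mem[OF one_a, of 0] hardy_scale_mem[OF one_b, of 0] by (simp_all add: Z_def)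
  have id: "(\<lambda>z. z) analytic_on cball 0 1" by (intro analytic_intros)
  define x where "x g = fst (P (Z, g))" for g
  define d where "d g = snd (P (Z, g))" for g
  define a where "a f = fst (P (f, Z))" for f
  define c where "c f = snd (P (f, Z))" for f
  have mL: "(f, Z) \<in> vecs HH" if "f \<in> vecs (hardy \<alpha>)" for f using that Zb by (simp add: mem_HH)
  have mR: "(Z, g) \<in> vecs HH" if "g \<in> vecs (hardy \<beta>)" for g using that Za by (simp add: mem_HH)
  have xm: "x g \<in> vecs (hardy \<alpha>)" and dm: "d g \<in> vecs (hardy \<beta>)" if "g \<in> vecs (hardy \<beta>)" for g
    using Pm[OF mR[OF that]] by (simp_all add: x_def d_def mem_HH)
  have am: "a f \<in> vecs (hardy \<alpha>)" and cm: "c f \<in> vecs (hardy \<beta>)" if "f \<in> vecs (hardy \<alpha>)" for f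
    using Pm[OF mL[OF that]] by (simp_all add: a_def c_def mem_HH)
  have split: "fst (P (s, t)) z = a s z + x t z" "snd (P (s, t)) z = c s z + d t z"
    if "s \<in> vecs (hardy \<alpha>)" "t \<in> vecs (hardy \<beta>)" for s t z
  proof -
    have "(s, t) = vadd HH (s, Z) (Z, t)" by (simp add: orth_sum_simps hardy_simps Z_def)
    then have "P (s, t) = P (vadd HH (s, Z) (Z, t))" by (rule arg_cong)
    also have "\<dots> = vadd HH (P (s, Z)) (P (Z, t))" by (rule Padd[OF mL[OF that(1)] mR[OF that(2)]])
    finally show "fst (P (s, t)) z = a s z + x t z" "snd (P (s, t)) z = c s z + d t z"
      by (simp_all add: orth_sum_simps hardy_simps a_def x_def c_def d_def)
  qed
  have R_add: "x (\<lambda>z. f z + g z) z0 = x f z0 + x g z0" "d (\<lambda>z. f z + g z) z0 = d f z0 + d g z0"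
    if "f \<in> vecs (hardy \<beta>)" "g \<in> vecs (hardy \<beta>)" for f g z0
  proof -
    have "vadd HH (Z, f) (Z, g) = (Z, \<lambda>z. f z + g z)" by (simp add: orth_sum_simps hardy_simps Z_def)
    with Padd[OF mR[OF that(1)] mR[OF that(2)]]
    show "x (\<lambda>z. f z + g z) z0 = x f z0 + x g z0" "d (\<lambda>z. f z + g z) z0 = d f z0 + d g z0"
      by (simp_all add: orth_sum_simps hardy_simps x_def d_def)
  qed
  have L_add: "a (\<lambda>z. f z + g z) z0 = a f z0 + a g z0" "c (\<lambda>z. f z + g z) z0 = c f z0 + c g z0"
    if "f \<in> vecs (hardy \<alpha>)" "g \<in> vecs (hardy \<alpha>)" for f g z0
  proof -
    have "vadd HH (f, Z) (g, Z) = (\<lambda>z. f z + g z, Z)" by (simp add: orth_sum_simps hardy_simps Z_def)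
    with Padd[OF mL[OF that(1)] mL[OF that(2)]]
    show "a (\<lambda>z. f z + g z) z0 = a f z0 + a g z0" "c (\<lambda>z. f z + g z) z0 = c f z0 + c g z0"
      by (simp_all add: orth_sum_simps hardy_simps a_def c_def)
  qed
  have R_sc: "x (\<lambda>z. b * f z) z0 = b * x f z0" "d (\<lambda>z. b * f z) z0 = b * d f z0"
    if "f \<in> vecs (hardy \<beta>)" for b f z0
  proof -
    have "vscale HH b (Z, f) = (Z, \<lambda>z. b * f z)" by (simp add: orth_sum_simps hardy_simps Z_def)
    with Psc[OF mR[OF that], of b] show "x (\<lambda>z. b * f z) z0 = b * x f z0" "d (\<lambda>z. b * f z) z0 = b * d f z0"
      by (simp_all add: orth_sum_simps hardy_simps x_def d_def)
  qed
  have L_sc: "a (\<lambda>z. b * f z) z0 = b * a f z0" "c (\<lambda>z. b * f z) z0 = b * c f z0"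
    if "f \<in> vecs (hardy \<alpha>)" for b f z0
  proof -
    have "vscale HH b (f, Z) = (\<lambda>z. b * f z, Z)" by (simp add: orth_sum_simps hardy_simps Z_def)
    with Psc[OF mL[OF that], of b] show "a (\<lambda>z. b * f z) z0 = b * a f z0" "c (\<lambda>z. b * f z) z0 = b * c f z0"
      by (simp_all add: orth_sum_simps hardy_simps a_def c_def)
  qed
  have relR: "x (mult_op (\<lambda>z. z) g) z = Bt z * x g z"
    "d (mult_op (\<lambda>z. z) g) z = deriv Bt z * h z * x g z + Bt z * d g z" if "g \<in> vecs (hardy \<beta>)" for g z
  proof -
    have "tri_mult (\<lambda>z. z) h (Z, g) = (Z, mult_op (\<lambda>z. z) g)"
      by (simp add: tri_mult_def mult_op_def Z_def)
    with rel[OF mR[OF that]] have "P (Z, mult_op (\<lambda>z. z) g) = tri_mult Bt (\<lambda>z. deriv Bt z * h z) (P (Z, g))" by simp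
    then show "x (mult_op (\<lambda>z. z) g) z = Bt z * x g z"
      "d (mult_op (\<lambda>z. z) g) z = deriv Bt z * h z * x g z + Bt z * d g z"
      by (simp_all add: x_def d_def tri_mult_def mult_op_def)
  qed
  have hm: "mult_op h f \<in> vecs (hardy \<beta>)" if "f \<in> vecs (hardy \<alpha>)" for f
    by (rule mult_mem_b[OF h_an embed_ab[OF that]])
  have relL: "a (mult_op (\<lambda>z. z) f) z + x (mult_op h f) z = Bt z * a f z"
    "c (mult_op (\<lambda>z. z) f) z + d (mult_op h f) z = deriv Bt z * h z * a f z + Bt z * c f z"
    if "f \<in> vecs (hardy \<alpha>)" for f z
  proof -
    have "tri_mult (\<lambda>z. z) h (f, Z) = (mult_op (\<lambda>z. z) f, mult_op h f)"
      by (simp add: tri_mult_def mult_op_def Z_def)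
    with rel[OF mL[OF that]]
    have e: "P (mult_op (\<lambda>z. z) f, mult_op h f) = tri_mult Bt (\<lambda>z. deriv Bt z * h z) (P (f, Z))" by simp
    show "a (mult_op (\<lambda>z. z) f) z + x (mult_op h f) z = Bt z * a f z"
      "c (mult_op (\<lambda>z. z) f) z + d (mult_op h f) z = deriv Bt z * h z * a f z + Bt z * c f z"
      unfolding split[OF mult_mem_a[OF id that] hm[OF that], symmetric] e
      by (simp_all add: a_def c_def tri_mult_def mult_op_def)
  qed
  have Btd: "cmod (Bt z) < 1" if "cmod z < 1" for z
  proof -
    have "cmod (z ^ n) < 1" using that n by (simp add: norm_power power_less_one_iff)
    then show ?thesis unfolding Bv[OF that] using w by (intro Moebius_function_norm_lt_1) auto
  qed
  have Bt0: "Bt 0 = w" using Bv[of 0] n by (simp add: Moebius_function_of_zero power_0_left)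
  \<comment> \<open>For x the last two terms of the division cancel exactly.\<close>
  have x_val: "x g z0 = g (Bt z0) * x disc_one z0" if g: "g \<in> vecs (hardy \<beta>)" and z0: "cmod z0 < 1" for g z0
  proof -
    obtain q where q: "q \<in> vecs (hardy \<beta>)"
      "x g z0 = g (Bt z0) * x disc_one z0 + x (mult_op (\<lambda>z. z) q) z0 - Bt z0 * x q z0"
      by (rule linear_functional_division[OF wb mib Btd[OF z0] g, of "\<lambda>f. x f z0"]) (simp_all add: R_add R_sc)
    then show ?thesis using relR(1)[OF q(1), of z0] by simp
  qed
  \<comment> \<open>Here a correction \<open>x (mult_op h q)\<close> remains; by
    \<open>x_val\<close> it is a value at b(z0), where q is the derivative of f.\<close>
  have a_val: "a f z0 = f (Bt z0) * a disc_one z0 - deriv f (Bt z0) * x (mult_op h disc_one) z0"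
    if f: "f \<in> vecs (hardy \<alpha>)" and z0: "cmod z0 < 1" for f z0
  proof -
    obtain q where q: "q \<in> vecs (hardy \<alpha>)" "q (Bt z0) = deriv f (Bt z0)"
      "a f z0 = f (Bt z0) * a disc_one z0 + a (mult_op (\<lambda>z. z) q) z0 - Bt z0 * a q z0"
      by (rule linear_functional_division[OF wa mia Btd[OF z0] f, of "\<lambda>f. a f z0"]) (simp_all add: L_add L_sc)
    have "a (mult_op (\<lambda>z. z) q) z0 = Bt z0 * a q z0 - x (mult_op h q) z0"
      using relL(1)[OF q(1), of z0] by (simp add: eq_diff_eq)
    moreover have "x (mult_op h q) z0 = deriv f (Bt z0) * x (mult_op h disc_one) z0"
      unfolding x_val[OF hm[OF q(1)] z0] x_val[OF hm[OF one_a] z0]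
      using Btd[OF z0] by (simp add: mult_op_def disc_one_simps q(2))
    ultimately show ?thesis using q(3) by simp
  qed
  \<comment> \<open>The entry a maps the first space into itself, so the growth condition is used
    for the pair \<alpha>, \<alpha>, where the quotient is 1/k.\<close>
  have hx0: "x (mult_op h disc_one) z = 0" if z: "cmod z < 1" for z
  proof -
    let ?V = "\<lambda>z. (- 1) * x (mult_op h disc_one) z"
    have lima: "(\<lambda>k. \<alpha> k / (real k * \<alpha> k)) \<longlonglongrightarrow> 0"
    proof -
      have "\<alpha> k / (real k * \<alpha> k) = 1 / real k" for k using weight_seq_pos[OF wa, of k] by simp
      then show ?thesis by (simp add: lim_1_over_n)
    qed
    have "?V z = 0"
    proof (rule multiplier_of_derivative_blaschke_zero[OF wa wa mia Aa n w lima am[OF one_a] _ _ z])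
      show "?V \<in> vecs (hardy \<alpha>)" by (rule hardy_scale_mem[OF xm[OF hm[OF one_a]]])
      show "\<exists>g\<in>vecs (hardy \<alpha>). \<forall>z\<in>ball 0 1. g z = f (Moebius_function 0 (- w) (z ^ n)) * a disc_one z +
          deriv f (Moebius_function 0 (- w) (z ^ n)) * ?V z" if "f \<in> vecs (hardy \<alpha>)" for f
        by (rule bexI[OF _ am[OF that]]) (use a_val[OF that] Bv in auto)
    qed
    then show ?thesis by simp
  qed
  \<comment> \<open>Near 0 the factor h(b(z)) is nonzero because b(0) = w; the identity theorem
    extends the vanishing of x(1) to the disc.\<close>
  have x1: "x disc_one z = 0" if z: "cmod z < 1" for z
  proof (rule has_fps_expansion_0_analytic_continuation[where f = "x disc_one" and A = "ball 0 1"])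
    have "h holomorphic_on ball 0 1" using h_an
      by (meson analytic_imp_holomorphic ball_subset_cball holomorphic_on_subset)
    then have "isCont h w" using w
      by (meson continuous_on_interior holomorphic_on_imp_continuous_on interior_open open_ball mem_ball_0 continuous_on_eq_continuous_at)
    moreover have "isCont Bt 0"
      using Bt by (meson analytic_on_analytic_at analytic_at_imp_isCont centre_in_cball zero_le_one)
    ultimately have "isCont (\<lambda>z. h (Bt z)) 0" using isCont_o2[of 0 Bt h] Bt0 by simp
    then have "((\<lambda>z. h (Bt z)) \<longlongrightarrow> h (Bt 0)) (nhds 0)"
      using tendsto_at_iff_tendsto_nhds[of "\<lambda>z. h (Bt z)" 0] by (simp add: isCont_def)
    then have "\<forall>\<^sub>F z in nhds 0. h (Bt z) \<noteq> 0"
      using hw Bt0 by (intro tendsto_imp_eventually_ne) auto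
    moreover have "\<forall>\<^sub>F z in nhds 0. z \<in> ball (0::complex) 1" by (intro eventually_nhds_in_open) auto
    ultimately have "\<forall>\<^sub>F z in nhds 0. x disc_one z = 0"
    proof eventually_elim
      case (elim z)
      then have z: "cmod z < 1" by simp
      have "h (Bt z) * x disc_one z = 0"
        using hx0[OF z] x_val[OF hm[OF one_a] z] Btd[OF z] by (simp add: mult_op_def disc_one_simps)
      then show ?case using elim(1) by simp
    qed
    then show "x disc_one has_fps_expansion 0" by (simp add: has_fps_expansion_0_iff)
    show "x disc_one holomorphic_on ball 0 1" by (rule hardy_holomorphic[OF xm[OF one_b]])
  qed (use z in auto)
  have x0: "x g z = 0" if "g \<in> vecs (hardy \<beta>)" "cmod z < 1" for g z
    using x_val[OF that] x1[OF that(2)] by simp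
  have d_val: "d g z0 = g (Bt z0) * d disc_one z0" if g: "g \<in> vecs (hardy \<beta>)" and z0: "cmod z0 < 1" for g z0
  proof -
    obtain q where q: "q \<in> vecs (hardy \<beta>)"
      "d g z0 = g (Bt z0) * d disc_one z0 + d (mult_op (\<lambda>z. z) q) z0 - Bt z0 * d q z0"
      by (rule linear_functional_division[OF wb mib Btd[OF z0] g, of "\<lambda>f. d f z0"]) (simp_all add: R_add R_sc)
    then show ?thesis using relR(2)[OF q(1), of z0] x0[OF q(1) z0] by simp
  qed
  have a_val': "a f z = f (Bt z) * a disc_one z" if "f \<in> vecs (hardy \<alpha>)" "cmod z < 1" for f z
    using a_val[OF that] hx0[OF that(2)] by simp
  \<comment> \<open>The factor of f'(b) in the entry c. By \<open>d_val\<close> it equals b' h a(1)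
    - h(b) d(1) on the disc.\<close>
  define V where "V z = mult_op (\<lambda>z. deriv Bt z * h z) (a disc_one) z + (- 1) * d (mult_op h disc_one) z" for z
  have dBh: "(\<lambda>z. deriv Bt z * h z) analytic_on cball 0 1"
    using Bt h_an by (intro analytic_on_mult analytic_deriv)
  have Vm: "V \<in> vecs (hardy \<beta>)"
    unfolding V_def
    by (intro hardy_add_mem hardy_scale_mem dm hm one_a mult_mem_b[OF dBh] embed_ab am)
  have c_val: "c f z0 = f (Bt z0) * c disc_one z0 + deriv f (Bt z0) * V z0"
    if f: "f \<in> vecs (hardy \<alpha>)" and z0: "cmod z0 < 1" for f z0
  proof -
    obtain q where q: "q \<in> vecs (hardy \<alpha>)" "q (Bt z0) = deriv f (Bt z0)"
      "c f z0 = f (Bt z0) * c disc_one z0 + c (mult_op (\<lambda>z. z) q) z0 - Bt z0 * c q z0"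
      by (rule linear_functional_division[OF wa mia Btd[OF z0] f, of "\<lambda>f. c f z0"]) (simp_all add: L_add L_sc)
    have C: "c (mult_op (\<lambda>z. z) q) z0 = deriv Bt z0 * h z0 * a q z0 + Bt z0 * c q z0 - d (mult_op h q) z0"
      using relL(2)[OF q(1), of z0] by (simp add: eq_diff_eq)
    have dq: "d (mult_op h q) z0 = deriv f (Bt z0) * d (mult_op h disc_one) z0"
      unfolding d_val[OF hm[OF q(1)] z0] d_val[OF hm[OF one_a] z0]
      using Btd[OF z0] by (simp add: mult_op_def disc_one_simps q(2))
    have V: "V z0 = deriv Bt z0 * h z0 * a disc_one z0 - d (mult_op h disc_one) z0"
      by (simp add: V_def mult_op_def[of _ "a disc_one"])
    show ?thesis
      unfolding q(3) C dq V a_val'[OF q(1) z0] q(2) by (simp add: algebra_simps)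
  qed
  have "V 0 = 0"
  proof (rule multiplier_of_derivative_blaschke_zero[OF wa wb mib Ab n w lim cm[OF one_a] Vm])
    show "\<exists>g\<in>vecs (hardy \<beta>). \<forall>z\<in>ball 0 1. g z = f (Moebius_function 0 (- w) (z ^ n)) * c disc_one z +
        deriv f (Moebius_function 0 (- w) (z ^ n)) * V z" if "f \<in> vecs (hardy \<alpha>)" for f
      by (rule bexI[OF _ cm[OF that]]) (use c_val[OF that] Bv in auto)
  qed simp
  \<comment> \<open>At 0 the hypothesis \<open>crit\<close> removes the first summand of V, leaving
    h(w) d(1)(0) = 0.\<close>
  then have "d (mult_op h disc_one) 0 = 0" using crit by (simp add: V_def mult_op_def)
  then have d10: "d disc_one 0 = 0"
    using d_val[OF hm[OF one_a], of 0] hw w by (simp add: Bt0 mult_op_def disc_one_simps)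
  show ?thesis
  proof (rule that[of "a disc_one" "c disc_one 0"])
    show "a disc_one \<in> vecs (hardy \<alpha>)" by (rule am[OF one_a])
    fix s t assume "(s, t) \<in> vecs HH"
    then have st: "s \<in> vecs (hardy \<alpha>)" "t \<in> vecs (hardy \<beta>)" by (simp_all add: mem_HH)
    show "fst (P (s, t)) z = s (Bt z) * a disc_one z" if "cmod z < 1" for z
      using split(1)[OF st] a_val'[OF st(1) that] x0[OF st(2) that] by simp
    have "V 0 = 0" by fact
    then show "snd (P (s, t)) 0 = s w * c disc_one 0"
      using split(2)[OF st] c_val[OF st(1), of 0] d_val[OF st(2), of 0] d10 by (simp add: Bt0)
  qed
qed

text \<open>Let s_i be the first component of Q_i v. If h(w) is nonzero, the numbers s_i(w)
  determine the coefficients of order below n of the first component of v, and the value at 0 of its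
  second component. Monomials show that this system of n equations is invertible, so all s_i(w)
  vanish for v = (0, 1), whose second component would then be 0 at 0.\<close>

lemma similar_imp_multiplier_zero:
  assumes mia: "moebius_invariant \<alpha>" and mib: "moebius_invariant \<beta>"
    and Aa: "property_A \<alpha> n" and Ab: "property_A \<beta> n" and n: "n \<ge> 1"
    and lim: "(\<lambda>k. \<alpha> k / (real k * \<beta> k)) \<longlonglongrightarrow> 0" and w: "cmod w < 1"
    and B: "B analytic_on cball 0 1" and Bt: "Bt analytic_on cball 0 1"
    and coeff: "\<And>i. taylor_coeff Bt i = cnj (taylor_coeff B i)"
    and Bv: "\<And>z. cmod z < 1 \<Longrightarrow> Bt z = Moebius_function 0 (- w) (z ^ n)"
    and sim: "similar_op HH (fun_calc HH (T_op \<alpha> \<beta> h) B) (copies n HH) (copies_op n (T_op \<alpha> \<beta> h))"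
    and crit: "deriv Bt 0 * h 0 = 0"
  shows "h w = 0"
proof (rule ccontr)
  assume hw: "h w \<noteq> 0"
  obtain P Q where
    Pm: "\<And>i v. i < n \<Longrightarrow> v \<in> vecs HH \<Longrightarrow> P i v \<in> vecs HH" and
    Qm: "\<And>i v. i < n \<Longrightarrow> v \<in> vecs HH \<Longrightarrow> Q i v \<in> vecs HH" and
    Padd: "\<And>i u v. i < n \<Longrightarrow> u \<in> vecs HH \<Longrightarrow> v \<in> vecs HH \<Longrightarrow> P i (vadd HH u v) = vadd HH (P i u) (P i v)" and
    Psc: "\<And>i c v. i < n \<Longrightarrow> v \<in> vecs HH \<Longrightarrow> P i (vscale HH c v) = vscale HH c (P i v)" and
    rel: "\<And>i v. i < n \<Longrightarrow> v \<in> vecs HH \<Longrightarrow>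
       tri_mult Bt (\<lambda>z. deriv Bt z * h z) (P i v) = P i (tri_mult (\<lambda>z. z) h v)" and
    PQ1: "\<And>v z. v \<in> vecs HH \<Longrightarrow> fst v z = (\<Sum>i<n. fst (P i (Q i v)) z)" and
    PQ2: "\<And>v z. v \<in> vecs HH \<Longrightarrow> snd v z = (\<Sum>i<n. snd (P i (Q i v)) z)"
    using similar_imp_intertwiners[OF B Bt coeff sim] by blast
  have "\<exists>a c. a \<in> vecs (hardy \<alpha>) \<and>
      (\<forall>s t z. (s, t) \<in> vecs HH \<longrightarrow> cmod z < 1 \<longrightarrow> fst (P i (s, t)) z = s (Bt z) * a z) \<and>
      (\<forall>s t. (s, t) \<in> vecs HH \<longrightarrow> snd (P i (s, t)) 0 = s w * c)" if i: "i < n" for i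
    by (rule intertwiner_values[OF mia mib Aa Ab n lim w Bt Bv Pm[OF i] Padd[OF i] Psc[OF i] rel[OF i] hw crit]) blast+
  then obtain a c where
    am: "\<And>i. i < n \<Longrightarrow> a i \<in> vecs (hardy \<alpha>)" and
    fstP: "\<And>i s t z. i < n \<Longrightarrow> (s, t) \<in> vecs HH \<Longrightarrow> cmod z < 1 \<Longrightarrow> fst (P i (s, t)) z = s (Bt z) * a i z" and
    sndP: "\<And>i s t. i < n \<Longrightarrow> (s, t) \<in> vecs HH \<Longrightarrow> snd (P i (s, t)) 0 = s w * c i"
    by metis
  define \<phi> where "\<phi> = Moebius_function 0 (- w)"
  have hol\<phi>: "\<phi> holomorphic_on ball 0 1" unfolding \<phi>_def using w by (intro Moebius_function_holomorphic) simp
  have img: "\<phi> ` ball 0 1 \<subseteq> ball 0 1" unfolding \<phi>_def using w Moebius_function_norm_lt_1[of "- w"] by auto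
  \<comment> \<open>s(\<phi>(z^n)) has constant term s(w) and no terms of degree 1 to n - 1, so in
    these orders it acts on a_i as the scalar s(w).\<close>
  have coeffs: "taylor_coeff (fst v) m = (\<Sum>i<n. taylor_coeff (a i) m * fst (Q i v) w)"
    if v: "v \<in> vecs HH" and m: "m < n" for v m
  proof -
    have Qv: "Q i v = (fst (Q i v), snd (Q i v))" "(fst (Q i v), snd (Q i v)) \<in> vecs HH"
      "fst (Q i v) \<in> vecs (hardy \<alpha>)" if "i < n" for i
      using Qm[OF that v] by (simp_all add: mem_HH)
    have r: "(\<lambda>z. fst (Q i v) (\<phi> z)) holomorphic_on ball 0 1" if "i < n" for i
      using holomorphic_on_compose_gen[OF hol\<phi> hardy_holomorphic[OF Qv(3)[OF that]] img] by (simp add: comp_def)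
    have ex: "(\<lambda>z. fst (Q i v) (\<phi> (z ^ n)) * a i z) has_fps_expansion
        Abs_fps (taylor_coeff (\<lambda>z. fst (Q i v) (\<phi> (z ^ n)) * a i z))" if "i < n" for i
    proof (rule has_fps_expansion_taylor)
      have "(\<lambda>z. fst (Q i v) (\<phi> (z ^ n))) holomorphic_on ball 0 1"
        by (rule holomorphic_on_compose_gen[OF _ r[OF that], of "\<lambda>z. z ^ n", unfolded comp_def])
          (use n in \<open>auto intro!: holomorphic_intros simp: norm_power power_less_one_iff\<close>)
      then show "(\<lambda>z. fst (Q i v) (\<phi> (z ^ n)) * a i z) holomorphic_on ball 0 1"
        using hardy_holomorphic[OF am[OF that]] by (rule holomorphic_on_mult)
    qed simp
    have "fst v z = (\<Sum>i<n. fst (Q i v) (\<phi> (z ^ n)) * a i z)" if "cmod z < 1" for z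
      unfolding PQ1[OF v]
    proof (rule sum.cong[OF refl])
      fix i assume "i \<in> {..<n}"
      then have i: "i < n" by simp
      have "fst (P i (Q i v)) z = fst (P i (fst (Q i v), snd (Q i v))) z" by simp
      also have "\<dots> = fst (Q i v) (\<phi> (z ^ n)) * a i z"
        using fstP[OF i Qv(2)[OF i] that] Bv[OF that] by (simp add: \<phi>_def)
      finally show "fst (P i (Q i v)) z = fst (Q i v) (\<phi> (z ^ n)) * a i z" .
    qed
    then have ev: "\<forall>\<^sub>F z in nhds 0. fst v z = (\<Sum>i<n. fst (Q i v) (\<phi> (z ^ n)) * a i z)"
      using eventually_nhds_in_open[of "ball 0 1" "0::complex"] by (auto elim!: eventually_mono)
    have "fst v has_fps_expansion (\<Sum>i<n. Abs_fps (taylor_coeff (\<lambda>z. fst (Q i v) (\<phi> (z ^ n)) * a i z)))"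
      by (rule iffD2[OF has_fps_expansion_cong[OF ev refl]]) (intro has_fps_expansion_sum ex, simp)
    from taylor_coeff_eq_fps_nth[OF this, of m]
    have "taylor_coeff (fst v) m = (\<Sum>i<n. taylor_coeff (\<lambda>z. fst (Q i v) (\<phi> (z ^ n)) * a i z) m)"
      by (simp add: fps_sum_nth)
    also have "\<dots> = (\<Sum>i<n. taylor_coeff (a i) m * fst (Q i v) w)"
    proof (rule sum.cong[OF refl])
      fix i assume "i \<in> {..<n}"
      then have i: "i < n" by simp
      have "taylor_coeff (\<lambda>z. fst (Q i v) (\<phi> z)) 0 = fst (Q i v) w"
        by (simp add: taylor_coeff_def \<phi>_def Moebius_function_of_zero)
      then show "taylor_coeff (\<lambda>z. fst (Q i v) (\<phi> (z ^ n)) * a i z) m = taylor_coeff (a i) m * fst (Q i v) w"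
        using taylor_coeff_comp_power[OF r[OF i] hardy_holomorphic[OF am[OF i]] m, of 0] by (simp add: mult.commute)
    qed
    finally show ?thesis .
  qed
  define Z where "Z = (\<lambda>z::complex. 0::complex)"
  note one_a = disc_one_mem[OF wa] and one_b = disc_one_mem[OF wb]
  have Za: "Z \<in> vecs (hardy \<alpha>)" and Zb: "Z \<in> vecs (hardy \<beta>)"
    using hardy_scale_mem[OF one_a, of 0] hardy_scale_mem[OF one_b, of 0] by (simp_all add: Z_def)
  have em: "(disc_monom k, Z) \<in> vecs HH" for k using disc_monom_mem[OF wa] Zb by (simp add: mem_HH)
  have om: "(Z, disc_one) \<in> vecs HH" using one_b Za by (simp add: mem_HH)
  \<comment> \<open>Applied to the n monomials, \<open>coeffs\<close> exhibits a right inverse of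
    the square matrix of low coefficients of the a_i.\<close>
  have right: "(\<Sum>i<n. taylor_coeff (a i) m * fst (Q i (disc_monom k, Z)) w) = (if m = k then 1 else 0)"
    if "m < n" "k < n" for m k
    using coeffs[OF em[of k] that(1)] by (simp add: disc_monom_coeff[OF wa])
  have left: "(\<Sum>m<n. fst (Q i (disc_monom m, Z)) w * taylor_coeff (a k) m) = (if i = k then 1 else 0)"
    if "i < n" "k < n" for i k
    by (rule left_inverse_of_right_inverse[of n "\<lambda>m i. taylor_coeff (a i) m" "\<lambda>i k. fst (Q i (disc_monom k, Z)) w", OF right that])
  have "Z = (\<lambda>z. 0 * disc_one z)" by (simp add: Z_def)
  then have "taylor_coeff Z = (\<lambda>k. 0)" using hardy_coeff_scale[OF one_a, of 0] by simp
  then have zero: "(\<Sum>k<n. taylor_coeff (a k) m * fst (Q k (Z, disc_one)) w) = 0" if "m < n" for m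
    using coeffs[OF om that] by simp
  \<comment> \<open>The left inverse is applied to the n homogeneous equations
    \<open>zero\<close>.\<close>
  have s0: "fst (Q i (Z, disc_one)) w = 0" if i: "i < n" for i
  proof -
    have "fst (Q i (Z, disc_one)) w = (\<Sum>k<n. if i = k then fst (Q k (Z, disc_one)) w else 0)"
      using i by simp
    also have "\<dots> = (\<Sum>k<n. (if i = k then 1 else 0) * fst (Q k (Z, disc_one)) w)"
      by (rule sum.cong) auto
    also have "\<dots> = (\<Sum>k<n. (\<Sum>m<n. fst (Q i (disc_monom m, Z)) w * taylor_coeff (a k) m) * fst (Q k (Z, disc_one)) w)"
      by (intro sum.cong refl) (use left[OF i] in simp)
    also have "\<dots> = (\<Sum>m<n. fst (Q i (disc_monom m, Z)) w * (\<Sum>k<n. taylor_coeff (a k) m * fst (Q k (Z, disc_one)) w))"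
      unfolding sum_distrib_right sum_distrib_left by (subst sum.swap) (simp add: mult.assoc)
    also have "\<dots> = 0" by (simp add: zero)
    finally show ?thesis .
  qed
  have "(1::complex) = snd (Z, disc_one) 0" by (simp add: disc_one_simps)
  also have "\<dots> = (\<Sum>i<n. snd (P i (Q i (Z, disc_one))) 0)" by (rule PQ2[OF om])
  also have "\<dots> = 0"
  proof (intro sum.neutral ballI)
    fix i assume "i \<in> {..<n}"
    then have i: "i < n" by simp
    have "(fst (Q i (Z, disc_one)), snd (Q i (Z, disc_one))) \<in> vecs HH" using Qm[OF i om] by simp
    from sndP[OF i this] show "snd (P i (Q i (Z, disc_one))) 0 = 0" using s0[OF i] by simp
  qed
  finally show False by simp
qed

end

section \<open>The choice of Blaschke products\<close>

theorem theorem1p1: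
  fixes \<alpha> \<beta> :: "nat \<Rightarrow> real" and n0 :: nat and h :: "complex \<Rightarrow> complex"
  assumes "weight_seq \<alpha>" and "weight_seq \<beta>"
    and "moebius_invariant \<alpha>" and "moebius_invariant \<beta>"
    and "n0 \<ge> 2" and "property_A \<alpha> n0" and "property_A \<beta> n0"
    and "bdd_above (range (\<lambda>k. \<beta> k / \<alpha> k))"
    and "(\<lambda>k. \<alpha> k / (real k * \<beta> k)) \<longlonglongrightarrow> 0"
    and "h analytic_on cball 0 1"
    and "\<And>n B. n \<ge> 1 \<Longrightarrow> finite_blaschke n B \<Longrightarrow>
           similar_op (orth_sum (hardy \<alpha>) (hardy \<beta>))
                      (fun_calc (orth_sum (hardy \<alpha>) (hardy \<beta>)) (T_op \<alpha> \<beta> h) B)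
                      (copies n (orth_sum (hardy \<alpha>) (hardy \<beta>)))
                      (copies_op n (T_op \<alpha> \<beta> h))"
  shows "\<forall>z\<in>cball 0 1. h z = 0"
proof -
  obtain D where D: "\<And>k. \<beta> k / \<alpha> k \<le> D" using assms(8) by (auto simp: bdd_above_def)
  interpret hardy_pair \<alpha> \<beta> D h
  proof
    show "\<beta> k \<le> D * \<alpha> k" for k
      using D[of k] weight_seq_pos[OF assms(1), of k] by (simp add: divide_le_eq)
  qed (use assms in auto)
  \<comment> \<open>The parameter of the Blaschke product is conjugated so that \<open>?Bt\<close>,
    which has the conjugate Taylor coefficients, is \<phi>(z^n) and sends 0 to w. The disjunction in
    \<open>crit\<close> lists the two ways to obtain b'(0) h(0) = 0.\<close>
  have main: "h w = 0"
    if n: "n \<ge> 1" and A: "property_A \<alpha> n" "property_A \<beta> n" and w: "cmod w < 1"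
      and crit: "n \<ge> 2 \<or> h 0 = 0" and blaschke: "finite_blaschke n (\<lambda>z. (z ^ n + cnj w) / (1 + w * z ^ n))" for n w
  proof -
    let ?B = "\<lambda>z. (z ^ n + cnj w) / (1 + w * z ^ n)"
    let ?Bt = "\<lambda>z. (z ^ n + w) / (1 + cnj w * z ^ n)"
    have nz: "1 + b * z ^ n \<noteq> 0" if "cmod z \<le> 1" "cmod b < 1" for b z :: complex
    proof -
      have "cmod (b * z ^ n) \<le> cmod b * 1"
        unfolding norm_mult norm_power using that by (intro mult_left_mono power_le_one) auto
      then have "cmod (b * z ^ n) < 1" using that by simp
      then show ?thesis by (metis add.inverse_inverse add_eq_0_iff less_irrefl norm_minus_cancel norm_one)
    qed
    have B: "?B analytic_on cball 0 1" and Bt: "?Bt analytic_on cball 0 1"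
      using nz w by (auto intro!: analytic_intros)
    have Bh: "?B holomorphic_on ball 0 1"
      using B by (meson analytic_imp_holomorphic ball_subset_cball holomorphic_on_subset)
    have coeff: "taylor_coeff ?Bt i = cnj (taylor_coeff ?B i)" for i
      using taylor_coeff_cnj[OF Bh, of i] by simp
    have Bv: "?Bt z = Moebius_function 0 (- w) (z ^ n)" for z by (simp add: Moebius_function_simple)
    have "deriv ?Bt 0 * h 0 = 0"
    proof (cases "n \<ge> 2")
      case True
      then obtain k where k: "n = Suc (Suc k)" by (metis add_2_eq_Suc le_iff_add)
      have "(?Bt has_field_derivative 0) (at 0)"
        unfolding k by (auto intro!: derivative_eq_intros)
      then show ?thesis by (simp add: DERIV_imp_deriv)
    qed (use crit in auto)
    from similar_imp_multiplier_zero[OF assms(3,4) A n assms(9) w B Bt coeff Bv assms(11)[OF n blaschke] this]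
    show ?thesis .
  qed
  \<comment> \<open>The case w = 0, where \<phi> is the identity and \<open>n0 \<ge> 2\<close>
    supplies the vanishing derivative.\<close>
  have h0: "h 0 = 0"
  proof (rule main[of n0])
    have "finite_blaschke n0 (\<lambda>z. z ^ n0)"
      unfolding finite_blaschke_def by (intro exI[of _ 0] exI[of _ "\<lambda>_. 0"]) auto
    then show "finite_blaschke n0 (\<lambda>z. (z ^ n0 + cnj 0) / (1 + 0 * z ^ n0))" by simp
  qed (use assms(5-7) in auto)
  \<comment> \<open>For n = 1 the only residue is j = 0, and both constants can be 1.\<close>
  have pA1: "property_A \<gamma> 1" for \<gamma> :: "nat \<Rightarrow> real"
    unfolding property_A_def by (rule exI[of _ 1], simp, rule exI[of _ 1], simp)
  have ball: "h w = 0" if w: "cmod w < 1" for w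
  proof (rule main[of 1])
    \<comment> \<open>A single Blaschke factor with zero at - cnj w and angle 0.\<close>
    have "(\<lambda>z. (z + cnj w) / (1 + w * z)) =
        (\<lambda>z. exp (\<i> * of_real 0) * (\<Prod>j\<in>{1..1::nat}. (z - (- cnj w)) / (1 - cnj (- cnj w) * z)))" by simp
    moreover have "- cnj w \<in> ball 0 1" using w by simp
    ultimately show "finite_blaschke 1 (\<lambda>z. (z ^ 1 + cnj w) / (1 + w * z ^ 1))"
      unfolding finite_blaschke_def by (intro exI[of _ "0::real"] exI[of _ "\<lambda>_. - cnj w"]) auto
  qed (use w h0 pA1 in auto)
  \<comment> \<open>Continuity carries the result from the open disc to its boundary.\<close>
  have "continuous_on (closure (ball 0 1)) h"
    using assms(10) by (simp add: analytic_imp_holomorphic holomorphic_on_imp_continuous_on)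
  then have "h z = 0" if "z \<in> closure (ball 0 1)" for z
    using continuous_constant_on_closure[of "ball 0 1" h 0 z] ball that by simp
  then show ?thesis by simp
qed

end
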